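(* Let $F$ satisfy the Nonlinearity Condition, let $\{g_\alpha\}$ satisfy Filter Conditions A and B, and let $\{\alpha_n\}$ be given by $\alpha_n=\alpha_0r^n$, $n=0,1,\dots$, for some $\alpha_0>0$ and $0<r<1$. If $x_0-x^\dagger\in\mathcal N(F'(x^\dagger))^\perp$ and $K_0\|x_0-x^\dagger\|$ is suitably small, then $$\lim_{\delta\to0}x_{n_\delta}^\delta=x^\dagger$$ for the integer $n_\delta$ determined by the discrepancy principle $$\|F(x_{n_\delta}^\delta)-y^\delta\|\le\tau\delta<\|F(x_n^\delta)-y^\delta\|,\qquad 0\le n<n_\delta,$$ with $\tau>1$.
   Context: Setting. $X,Y$ are Hilbert spaces; $F:D(F)\subset X\to Y$ is Fréchet differentiable with derivative $F'(x)$ and adjoint $F'(x)^*$; $x^\dagger\in D(F)$ and $F(x^\dagger)=y$. The data $y^\delta\in Y$ satisfy $\|y^\delta-y\|\le\delta$ with noise level $\delta>0$. $B_\rho(x^\dagger)$ is the ball of radius $\rho>0$ around $x^\dagger$, and $\mathcal N(\cdot)$ denotes the null space. Given an initial guess $x_0\in D(F)$, the inexact Newton iteration is $x_0^\delta:=x_0$ and $$x_{n+1}^\delta=x_n^\delta-g_{\alpha_n}\left(F'(x_n^\delta)^*F'(x_n^\delta)\right)F'(x_n^\delta)^*\left(F(x_n^\delta)-y^\delta\right),$$ where $\{g_\alpha\}_{\alpha>0}$ is a family of spectral filter functions. Put $s_{-1}=0$, $s_n:=\sum_{j=0}^n1/\alpha_j$; $c_0>1$ and $c_1>0$ denote constants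 with $s_{n+1}\le c_0s_n$ and $0<\alpha_n\le c_1$ for all $n\ge0$ (these exist for the geometric sequence above). Filter Condition A. For each $\alpha>0$ the function $\varphi_\alpha(\lambda):=g_\alpha(\lambda)-\frac1{\alpha+\lambda}$ extends to a complex analytic function defined on a domain $D_\alpha\subset\mathbb C$ such that $[0,1]\subset D_\alpha$, and there is a contour $\Gamma_\alpha\subset D_\alpha$ enclosing $[0,1]$ such that $|z|\ge\frac12\alpha$ and $\frac{|z|+\lambda}{|z-\lambda|}\le b_0$ for all $z\in\Gamma_\alpha$, $\alpha>0$ and $\lambda\in[0,1]$, where $b_0$ is a constant independent of $\alpha>0$. Moreover, there is a constant $b_1$ such that $\int_{\Gamma_\alpha}|\varphi_\alpha(z)|\,|dz|\le b_1$ for all $0<\alpha\le c_1$. Filter Condition B. With $r_\alpha(\lambda):=1-\lambda g_\alpha(\lambda)$, there is a constant $b_2>0$ such that $$0\le\lambda^\mu\prod_{k=j}^n r_{\alpha_k}(\lambda)\le(s_n-s_{j-1})^{-\mu},\qquad 0\le\lambda^\mu g_{\alpha_j}(\lambda)\prod_{k=j+1}^n r_{\alpha_k}(\lambda)\le b_2\frac1{\alpha_j}(s_n-s_{j-1})^{-\mu}$$ for $0\le\mu\le1$, $0\le\lambda\le1$ and $j=0,1,\dots,n$ (empty products equal $1$). Nonlinearity Condition. (a) There exists $K_0\ge0$ such that $F'(x)=R(x,\bar x)F'(\bar x)$ and $\|I-R(x,\bar x)\|\le K_0\|x-\bar x\|$ for all $x,\bar x\in B_\rho(x^\dagger)\subset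 D(F)$, with bounded linear operators $R(x,\bar x):Y\to Y$. (b) $F$ is properly scaled so that $\|F'(x)\|\le\min\{1,\sqrt{\alpha_0}\}$ for all $x\in B_\rho(x^\dagger)$.
   Formalization: The initial guess is required to satisfy ‖x0−x†‖ ≤ θρ for some fixed θ<1 (so x0 lies in B_ρ(x†)), and the smallness threshold for K0‖x0−x†‖ may depend on θ; for x0 outside the ball the claim can fail. *)

theory Defs
  imports "HOL-Complex_Analysis.Complex_Analysis"
begin

section \<open>Adjoints and continuous functional calculus\<close>

text \<open>The library constant \<^const>\<open>adjoint\<close> acts on plain functions; between Hilbert spaces the
  adjoint of a bounded operator is bounded, so it can be packaged as a bounded operator again.\<close>

definition adj ::
  "('a::{real_inner,complete_space} \<Rightarrow>\<^sub>L 'b::{real_inner,complete_space}) \<Rightarrow> ('b \<Rightarrow>\<^sub>L 'a)" where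
  "adj T = Blinfun (adjoint (blinfun_apply T))"

definition null_space :: "('a::real_normed_vector \<Rightarrow>\<^sub>L 'b::real_normed_vector) \<Rightarrow> 'a set" where
  "null_space T = {x. blinfun_apply T x = 0}"

definition op_spectrum :: "('a::real_normed_vector \<Rightarrow>\<^sub>L 'a) \<Rightarrow> real set" where
  "op_spectrum T = {l. \<not> (\<exists>S. S o\<^sub>L (T - l *\<^sub>R id_blinfun) = id_blinfun \<and>
                           (T - l *\<^sub>R id_blinfun) o\<^sub>L S = id_blinfun)}"

definition op_poly :: "real poly \<Rightarrow> ('a::real_normed_vector \<Rightarrow>\<^sub>L 'a) \<Rightarrow> ('a \<Rightarrow>\<^sub>L 'a)" where
  "op_poly p T = (\<Sum>i\<le>degree p. coeff p i *\<^sub>R (((o\<^sub>L) T) ^^ i) id_blinfun)"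

text \<open>Continuous functional calculus \<open>f(T)\<close> for a bounded self-adjoint \<open>T\<close> and \<open>f\<close> continuous on
  the spectrum: the common operator-norm limit of \<open>p\<^sub>k(T)\<close> over all sequences of polynomials
  converging to \<open>f\<close> uniformly on the spectrum. For other \<open>T\<close> or \<open>f\<close> the value is meaningless.\<close>

definition op_fun :: "(real \<Rightarrow> real) \<Rightarrow> ('a::real_normed_vector \<Rightarrow>\<^sub>L 'a) \<Rightarrow> ('a \<Rightarrow>\<^sub>L 'a)" where
  "op_fun f T = (THE S. \<forall>p :: nat \<Rightarrow> real poly.
     uniform_limit (op_spectrum T) (\<lambda>k. poly (p k)) f sequentially \<longrightarrow>
     (\<lambda>k. op_poly (p k) T) \<longlonglongrightarrow> S)"


section \<open>The iteration and the discrepancy principle\<close>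

primrec newton_iterate ::
  "(nat \<Rightarrow> real) \<Rightarrow> (real \<Rightarrow> real \<Rightarrow> real) \<Rightarrow>
   ('a::{real_inner,complete_space} \<Rightarrow> 'b::{real_inner,complete_space}) \<Rightarrow>
   ('a \<Rightarrow> 'a \<Rightarrow>\<^sub>L 'b) \<Rightarrow> 'a \<Rightarrow> 'b \<Rightarrow> nat \<Rightarrow> 'a" where
  "newton_iterate \<alpha> g F F' x0 yd 0 = x0"
| "newton_iterate \<alpha> g F F' x0 yd (Suc n) =
     (let x = newton_iterate \<alpha> g F F' x0 yd n
      in x - op_fun (g (\<alpha> n)) (adj (F' x) o\<^sub>L F' x) (adj (F' x) (F x - yd)))"

definition discrepancy ::
  "('a \<Rightarrow> 'b::real_normed_vector) \<Rightarrow> (nat \<Rightarrow> 'a) \<Rightarrow> 'b \<Rightarrow> real \<Rightarrow> real \<Rightarrow> nat \<Rightarrow> bool" where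
  "discrepancy F x yd \<tau> \<delta> N \<longleftrightarrow>
     norm (F (x N) - yd) \<le> \<tau> * \<delta> \<and> (\<forall>n<N. \<tau> * \<delta> < norm (F (x n) - yd))"

definition stopping_index ::
  "('a \<Rightarrow> 'b::real_normed_vector) \<Rightarrow> (nat \<Rightarrow> 'a) \<Rightarrow> 'b \<Rightarrow> real \<Rightarrow> real \<Rightarrow> nat" where
  "stopping_index F x yd \<tau> \<delta> = (THE N. discrepancy F x yd \<tau> \<delta> N)"


section \<open>Conditions on the filter functions\<close>

text \<open>\<open>inv_sum \<alpha> m\<close> is \<open>s\<^sub>m\<close>; the index is an integer so that \<open>s\<^sub>-\<^sub>1 = 0\<close> is covered.\<close>

definition inv_sum :: "(nat \<Rightarrow> real) \<Rightarrow> int \<Rightarrow> real" where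
  "inv_sum \<alpha> m = (\<Sum>j<nat (m + 1). 1 / \<alpha> j)"

text \<open>The filter conditions use \<open>0\<^sup>0 = 1\<close>, whereas \<open>0 powr 0 = 0\<close>.\<close>

definition rpow :: "real \<Rightarrow> real \<Rightarrow> real" where
  "rpow x \<mu> = (if \<mu> = 0 then 1 else x powr \<mu>)"

definition arclength_integral :: "(complex \<Rightarrow> real) \<Rightarrow> (real \<Rightarrow> complex) \<Rightarrow> real" where
  "arclength_integral h \<gamma> =
     integral {0..1} (\<lambda>t. h (\<gamma> t) * norm (vector_derivative \<gamma> (at t within {0..1})))"

text \<open>A contour in \<open>D\<close> enclosing \<open>K\<close>, in the sense needed for Cauchy's formula: a closed piecewise
  \<open>C\<^sup>1\<close> path with winding number \<open>1\<close> about the points of \<open>K\<close> and \<open>0\<close> about those outside \<open>D\<close>.\<close>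

definition encloses_in :: "(real \<Rightarrow> complex) \<Rightarrow> complex set \<Rightarrow> complex set \<Rightarrow> bool" where
  "encloses_in \<gamma> D K \<longleftrightarrow>
     valid_path \<gamma> \<and> pathfinish \<gamma> = pathstart \<gamma> \<and> path_image \<gamma> \<subseteq> D - K \<and>
     (\<forall>w\<in>K. winding_number \<gamma> w = 1) \<and> (\<forall>w. w \<notin> D \<longrightarrow> winding_number \<gamma> w = 0)"

definition filter_condition_A ::
  "(real \<Rightarrow> real \<Rightarrow> real) \<Rightarrow> real \<Rightarrow> real \<Rightarrow> real \<Rightarrow> bool" where
  "filter_condition_A g c1 b0 b1 \<longleftrightarrow>
     (\<forall>\<alpha>>0. \<exists>D \<Phi> \<Gamma>.
        open D \<and> connected D \<and> complex_of_real ` {0..1} \<subseteq> D \<and>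
        \<Phi> holomorphic_on D \<and>
        (\<forall>l\<in>{0..1}. \<Phi> (complex_of_real l) = complex_of_real (g \<alpha> l - 1 / (\<alpha> + l))) \<and>
        encloses_in \<Gamma> D (complex_of_real ` {0..1}) \<and>
        (\<forall>z\<in>path_image \<Gamma>. norm z \<ge> \<alpha> / 2 \<and>
           (\<forall>l\<in>{0..1}. (norm z + l) / norm (z - complex_of_real l) \<le> b0)) \<and>
        (\<alpha> \<le> c1 \<longrightarrow> arclength_integral (\<lambda>z. norm (\<Phi> z)) \<Gamma> \<le> b1))"

definition residual_filter :: "(real \<Rightarrow> real \<Rightarrow> real) \<Rightarrow> real \<Rightarrow> real \<Rightarrow> real" where
  "residual_filter g \<alpha> l = 1 - l * g \<alpha> l"

definition filter_condition_B ::
  "(real \<Rightarrow> real \<Rightarrow> real) \<Rightarrow> (nat \<Rightarrow> real) \<Rightarrow> real \<Rightarrow> bool" where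
  "filter_condition_B g \<alpha> b2 \<longleftrightarrow> b2 > 0 \<and>
     (\<forall>\<mu>\<in>{0..1}. \<forall>l\<in>{0..1}. \<forall>n. \<forall>j\<le>n.
        0 \<le> rpow l \<mu> * (\<Prod>k=j..n. residual_filter g (\<alpha> k) l) \<and>
        rpow l \<mu> * (\<Prod>k=j..n. residual_filter g (\<alpha> k) l)
          \<le> (inv_sum \<alpha> (int n) - inv_sum \<alpha> (int j - 1)) powr (- \<mu>) \<and>
        0 \<le> rpow l \<mu> * g (\<alpha> j) l * (\<Prod>k=Suc j..n. residual_filter g (\<alpha> k) l) \<and>
        rpow l \<mu> * g (\<alpha> j) l * (\<Prod>k=Suc j..n. residual_filter g (\<alpha> k) l)
          \<le> b2 * (1 / \<alpha> j) * (inv_sum \<alpha> (int n) - inv_sum \<alpha> (int j - 1)) powr (- \<mu>))"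


section \<open>Conditions on the forward operator\<close>

definition frechet_derivative_on ::
  "('a::real_normed_vector \<Rightarrow> 'b::real_normed_vector) \<Rightarrow> ('a \<Rightarrow> 'a \<Rightarrow>\<^sub>L 'b) \<Rightarrow> 'a set \<Rightarrow> bool" where
  "frechet_derivative_on F F' D \<longleftrightarrow>
     (\<forall>x\<in>D. (F has_derivative blinfun_apply (F' x)) (at x within D))"

definition nonlinearity_condition ::
  "('a::real_normed_vector \<Rightarrow> 'a \<Rightarrow>\<^sub>L 'b::real_normed_vector) \<Rightarrow> 'a set \<Rightarrow>
   'a \<Rightarrow> real \<Rightarrow> real \<Rightarrow> real \<Rightarrow> bool" where
  "nonlinearity_condition F' D xdag \<rho> K0 \<alpha>0 \<longleftrightarrow>
     K0 \<ge> 0 \<and> ball xdag \<rho> \<subseteq> D \<and>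
     (\<exists>R :: 'a \<Rightarrow> 'a \<Rightarrow> 'b \<Rightarrow>\<^sub>L 'b. \<forall>x\<in>ball xdag \<rho>. \<forall>x'\<in>ball xdag \<rho>.
        F' x = R x x' o\<^sub>L F' x' \<and> norm (id_blinfun - R x x') \<le> K0 * norm (x - x')) \<and>
     (\<forall>x\<in>ball xdag \<rho>. norm (F' x) \<le> min 1 (sqrt \<alpha>0))"

end

theory Submission
  imports Defs "HOL-Computational_Algebra.Fundamental_Theorem_Algebra"
begin

text \<open>From the filter conditions the argument uses that \<open>g\<^sub>\<alpha>\<close> is continuous on \<open>[0,1]\<close>, and that there
  \<open>0 \<le> r\<^sub>\<alpha> \<le> 1\<close>, \<open>\<lambda> r\<^sub>\<alpha>(\<lambda>) \<le> \<alpha>\<close> and \<open>0 \<le> g\<^sub>\<alpha> \<le> b/\<alpha>\<close> for each \<open>\<alpha> = \<alpha>\<^sub>n\<close>.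
  With \<open>T = F'(x\<^sup>\<dagger>)\<close> and the error \<open>e\<^sub>n\<close>, the functional
  \<open>W\<^sub>n = \<parallel>e\<^sub>n\<parallel>\<^sup>2 + \<eta> \<langle>\<alpha>\<^sub>n(\<alpha>\<^sub>n + T\<^sup>*T)\<^sup>-\<^sup>1 e\<^sub>n, e\<^sub>n\<rangle> + \<kappa> \<parallel>T e\<^sub>n\<parallel>\<^sup>2/\<alpha>\<^sub>n\<close> decreases by at least
  \<open>\<kappa>/8 \<cdot> \<parallel>T e\<^sub>n\<parallel>\<^sup>2/\<alpha>\<^sub>n\<close> per step, up to a multiple of \<open>\<delta>\<^sup>2/\<alpha>\<^sub>n\<close>: for \<open>F'(x\<^sub>n)\<close> in place of \<open>T\<close> this is
  a scalar inequality on the spectrum, and exchanging the two operators costs only a small multiple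
  of \<open>\<parallel>T e\<^sub>n\<parallel>\<^sup>2/\<alpha>\<^sub>n\<close>, which the decrease absorbs.

  Hence \<open>\<parallel>T e\<^sub>n\<parallel>\<^sup>2/\<alpha>\<^sub>n\<close> is small for some \<open>n\<close> below a bound independent of \<open>\<delta>\<close>. As \<open>e\<^sub>n - e\<^sub>0\<close> lies in
  the range of \<open>T\<^sup>*\<close> and \<open>e\<^sub>0\<close> in its closure, \<open>W\<^sub>n\<close> is small there too. From that index on, the residual
  is, after boundedly many steps, at most \<open>\<delta>\<close> plus a small multiple of \<open>\<delta> + \<surd>(\<alpha>\<^sub>n W\<^sub>n)\<close>, so an unmet discrepancy
  criterion keeps \<open>\<delta>\<^sup>2/\<alpha>\<^sub>n\<close>, and with it \<open>W\<^sub>n\<close>, small until the iteration stops.\<close>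

section \<open>Hilbert space preliminaries\<close>

text \<open>The derivatives F'(x_n) change with n and do not commute, so the product bounds of the
  filter condition do not apply directly along the iteration; a quantity that decreases step by step
  replaces them. Its resolvent term is forced: when alpha shrinks by q the last term grows by 1/q,
  and where lambda is small against alpha the filter may damp nothing, so only the drop of
  alpha/(alpha + lambda) can pay for that growth. Perturbations must be relative to |T e_n| and not
  to |e_n|, since the decrease controls nothing else; the factorization F'(x) = R F'(z) supplies
  exactly such bounds. That \<tau> is only assumed to exceed 1 is the second obstacle: the energy
  alone bounds the residual by some multiple of \<delta>. Following the residual over m + 1 steps
  gives \<delta> the factor 1. This dictates the order of choices: the constants of the functional,
  then m from \<tau>, then the nonlinearity level e, small against 2^-m; only after these come the
  operator, the target accuracy, the approximate source element, the index bound n1, and last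
  \<delta>.\<close>

lemma convex_min_norm_element:
  fixes C :: "'a::{real_inner,complete_space} set"
  assumes "convex C" "closed C" "C \<noteq> {}"
  obtains d where "d \<in> C" "\<And>x. x \<in> C \<Longrightarrow> norm d \<le> norm x"
proof -
  define m where "m = Inf (norm ` C)"
  have bdd: "bdd_below (norm ` C)" by (rule bdd_belowI[of _ 0]) auto
  have m_le: "m \<le> norm x" if "x \<in> C" for x
    unfolding m_def using that bdd by (intro cInf_lower) auto
  have m0: "m \<ge> 0" unfolding m_def using assms(3) by (intro cInf_greatest) auto
  have "\<exists>x\<in>C. norm x < m + 1 / real (Suc k)" for k
  proof -
    have "Inf (norm ` C) < m + 1 / real (Suc k)" by (simp add: m_def)
    then show ?thesis using cInf_lessD[of "norm ` C" "m + 1 / real (Suc k)"] assms(3) by auto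
  qed
  then obtain u where uC: "\<And>k. u k \<in> C" and u: "\<And>k. norm (u k) < m + 1 / real (Suc k)"
    by metis
  have lim: "(\<lambda>k. norm (u k)) \<longlonglongrightarrow> m"
  proof (rule tendsto_sandwich[of "\<lambda>_. m" _ _ "\<lambda>k. m + 1 / real (Suc k)"])
    show "(\<lambda>k. m + 1 / real (Suc k)) \<longlonglongrightarrow> m"
      using tendsto_add[OF tendsto_const[of m] LIMSEQ_inverse_real_of_nat] by (simp add: inverse_eq_divide)
  qed (use m_le uC less_imp_le[OF u] in auto)
  \<comment> \<open>Parallelogram law: the midpoint of \<open>u i\<close> and \<open>u j\<close>
    lies in \<open>C\<close>, so its norm is at least \<open>m\<close>. This makes a minimizing
    sequence Cauchy.\<close>
  have par: "(norm (u i - u j))\<^sup>2 \<le> 2 * (norm (u i))\<^sup>2 + 2 * (norm (u j))\<^sup>2 - 4 * m\<^sup>2" for i j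
  proof -
    have "(1/2) *\<^sub>R u i + (1/2) *\<^sub>R u j \<in> C"
      using assms(1) uC by (intro convexD) auto
    from m_le[OF this] have "m \<le> norm ((1/2) *\<^sub>R (u i + u j))" by (simp add: scaleR_add_right)
    then have "2 * m \<le> norm (u i + u j)" by simp
    then have "(2 * m)\<^sup>2 \<le> (norm (u i + u j))\<^sup>2" using m0 by (intro power_mono) auto
    moreover have "(norm (u i + u j))\<^sup>2 + (norm (u i - u j))\<^sup>2 = 2 * (norm (u i))\<^sup>2 + 2 * (norm (u j))\<^sup>2"
      by (simp add: power2_norm_eq_inner inner_add_left inner_add_right inner_diff_left inner_diff_right inner_commute)
    ultimately show ?thesis by (simp add: power_mult_distrib)
  qed
  have "Cauchy u"
  proof (rule metric_CauchyI)
    fix e :: real assume e: "e > 0"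
    have "(\<lambda>k. (norm (u k))\<^sup>2) \<longlonglongrightarrow> m\<^sup>2" by (intro tendsto_intros lim)
    then have "\<forall>\<^sub>F k in sequentially. dist ((norm (u k))\<^sup>2) (m\<^sup>2) < e\<^sup>2/4"
      using e by (intro tendstoD) auto
    then obtain N where N: "\<And>k. k \<ge> N \<Longrightarrow> \<bar>(norm (u k))\<^sup>2 - m\<^sup>2\<bar> < e\<^sup>2/4"
      unfolding eventually_sequentially dist_real_def by blast
    show "\<exists>N. \<forall>i\<ge>N. \<forall>j\<ge>N. dist (u i) (u j) < e"
    proof (intro exI allI impI)
      fix i j assume "i \<ge> N" "j \<ge> N"
      with N[of i] N[of j] par[of i j] have "(norm (u i - u j))\<^sup>2 < e\<^sup>2" by linarith
      then show "dist (u i) (u j) < e" using e by (simp add: dist_norm power_less_imp_less_base)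
    qed
  qed
  then obtain d where d: "u \<longlonglongrightarrow> d" using Cauchy_convergent_iff convergent_def by blast
  have "d \<in> C" using assms(2) uC d closed_sequentially by blast
  moreover have "norm d = m" using LIMSEQ_unique[OF tendsto_norm[OF d] lim] .
  ultimately show thesis using m_le that by auto
qed

text \<open>The parabola |d + t v|^2 in \<open>t\<close> is tested at its vertex, where it lies
  below |d|^2 unless \<open>inner d v\<close> vanishes.\<close>

lemma min_norm_orthogonal:
  fixes d v :: "'a::real_inner"
  assumes "\<And>t::real. norm d \<le> norm (d + t *\<^sub>R v)"
  shows "inner d v = 0"
proof (rule ccontr)
  assume n: "inner d v \<noteq> 0"
  then have v: "inner v v > 0" by auto
  define t where "t = - inner d v / inner v v"
  have "inner d d \<le> inner (d + t *\<^sub>R v) (d + t *\<^sub>R v)"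
    using assms[of t] by (simp add: norm_le)
  also have "\<dots> = inner d d + (2 * t * inner d v + t\<^sup>2 * inner v v)"
    by (simp add: inner_add_left inner_add_right inner_commute power2_eq_square algebra_simps)
  also have "2 * t * inner d v + t\<^sup>2 * inner v v = - (inner d v)\<^sup>2 / inner v v"
    unfolding t_def using v by (simp add: field_simps power2_eq_square)
  finally have "(inner d v)\<^sup>2 / inner v v \<le> 0" by simp
  then show False using n v by (simp add: divide_le_0_iff)
qed

text \<open>The point \<open>d\<close> of least norm on the hyperplane where the functional equals 1
  is orthogonal to the kernel. Since x - \<phi>(x) d lies in the kernel, \<open>d\<close> divided by
  |d|^2 represents the functional.\<close>

lemma riesz_representation:
  fixes \<phi> :: "'a::{real_inner,complete_space} \<Rightarrow> real"
  assumes "bounded_linear \<phi>"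
  obtains w where "\<And>x. \<phi> x = inner x w"
proof (cases "\<forall>x. \<phi> x = 0")
  case True
  then show ?thesis by (intro that[of 0]) auto
next
  case False
  interpret bounded_linear \<phi> by fact
  define C where "C = {x. \<phi> x = 1}"
  obtain x0 where x0: "\<phi> x0 \<noteq> 0" using False by auto
  have "C \<noteq> {}" unfolding C_def using x0 scale[of "1 / \<phi> x0" x0] by auto
  moreover have "closed C"
    unfolding C_def by (intro closed_Collect_eq continuous_intros linear_continuous_on assms)
  moreover have "convex C" unfolding C_def convex_def by (auto simp: add scale)
  ultimately obtain d where d: "d \<in> C" "\<And>x. x \<in> C \<Longrightarrow> norm d \<le> norm x"
    using convex_min_norm_element by metis
  have orth: "inner d z = 0" if "\<phi> z = 0" for z
    by (rule min_norm_orthogonal) (use d that in \<open>auto simp: C_def add scale\<close>)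
  have d1: "\<phi> d = 1" using d by (simp add: C_def)
  then have dn: "inner d d \<noteq> 0" using zero by auto
  show ?thesis
  proof (rule that[of "(1 / inner d d) *\<^sub>R d"])
    fix x
    have "inner d (x - \<phi> x *\<^sub>R d) = 0" by (rule orth) (simp add: diff scale d1)
    then show "\<phi> x = inner x ((1 / inner d d) *\<^sub>R d)"
      using dn by (simp add: inner_diff_right field_simps inner_commute)
  qed
qed

text \<open>Makes \<open>adj\<close> usable: Riesz provides the map pointwise, uniqueness identifies
  it with \<open>adjoint\<close>, and its boundedness is what allows \<open>Blinfun\<close> to be
  unfolded.\<close>

lemma
  fixes T :: "'a::{real_inner,complete_space} \<Rightarrow>\<^sub>L 'b::{real_inner,complete_space}"
  shows inner_adj_right: "inner x (adj T y) = inner (T x) y"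
    and inner_adj_left: "inner (adj T y) x = inner y (T x)"
    and norm_adj_apply_le: "norm (adj T y) \<le> norm T * norm y"
proof -
  have "\<exists>w. \<forall>x. inner (T x) y = inner x w" for y
  proof -
    have "bounded_linear (\<lambda>x. inner (T x) y)" by (intro bounded_linear_intros)
    then show ?thesis using riesz_representation by metis
  qed
  then obtain S where S: "\<And>x y. inner (T x) y = inner x (S y)" by metis
  have eq: "adjoint (blinfun_apply T) = S" by (rule adjoint_unique) (use S in auto)
  have nS: "norm (S y) \<le> norm T * norm y" for y
  proof (cases "S y = 0")
    case False
    have "norm (S y) * norm (S y) = inner (T (S y)) y"
      unfolding S by (simp add: power2_norm_eq_inner flip: power2_eq_square)
    also have "\<dots> \<le> norm (T (S y)) * norm y" by (rule norm_cauchy_schwarz)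
    also have "\<dots> \<le> (norm T * norm (S y)) * norm y" by (intro mult_right_mono norm_blinfun) auto
    finally show ?thesis using False by (simp add: mult.commute mult.left_commute)
  qed simp
  have "bounded_linear S"
  proof (rule bounded_linear_intro)
    show "S (x + y) = S x + S y" for x y
      by (rule vector_eq_ldot[THEN iffD1]) (simp add: inner_add_right flip: S)
    show "S (r *\<^sub>R x) = r *\<^sub>R S x" for r x
      by (rule vector_eq_ldot[THEN iffD1]) (simp flip: S)
    show "norm (S y) \<le> norm y * norm T" for y using nS[of y] by (simp add: mult.commute)
  qed
  then have a: "blinfun_apply (adj T) = S" by (simp add: adj_def eq bounded_linear_Blinfun_apply)
  show "inner x (adj T y) = inner (T x) y" by (simp add: a S)
  then show "inner (adj T y) x = inner y (T x)" by (simp add: inner_commute)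
  show "norm (adj T y) \<le> norm T * norm y" using nS by (simp add: a)
qed

text \<open>Coercivity makes x - t (P x - y) a contraction in x for a suitable step
  \<open>t\<close>; its fixed point solves P x = y, and |P x| \<ge> c |x| bounds the
  inverse.\<close>

lemma lax_milgram:
  fixes P :: "'a::{real_inner,complete_space} \<Rightarrow>\<^sub>L 'a"
  assumes c: "c > 0" and P: "\<And>x. inner (P x) x \<ge> c * (norm x)\<^sup>2"
  obtains S where "S o\<^sub>L P = id_blinfun" "P o\<^sub>L S = id_blinfun"
proof -
  \<comment> \<open>Adding \<open>c\<close> ensures M > 0 and c \<le> M, hence 0 \<le> 1 - t c for t
    = c / M^2.\<close>
  define M where "M = norm P + c"
  have M: "M > 0" "norm P \<le> M" "c \<le> M" using c by (auto simp: M_def add_nonneg_pos)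
  define t where "t = c / M\<^sup>2"
  have t: "t > 0" using c M by (simp add: t_def)
  have contr: "(norm (x - t *\<^sub>R P x))\<^sup>2 \<le> (1 - t * c) * (norm x)\<^sup>2" for x
  proof -
    have "norm (P x) \<le> M * norm x" using norm_blinfun[of P x] M
      by (meson dual_order.trans mult_right_mono norm_ge_zero)
    then have "(norm (P x))\<^sup>2 \<le> (M * norm x)\<^sup>2" by (intro power_mono) auto
    then have "t\<^sup>2 * (norm (P x))\<^sup>2 \<le> t\<^sup>2 * (M * norm x)\<^sup>2" by (intro mult_left_mono) auto
    also have "\<dots> = t * c * (norm x)\<^sup>2" using M by (simp add: t_def power2_eq_square)
    finally have 1: "t\<^sup>2 * (norm (P x))\<^sup>2 \<le> t * c * (norm x)\<^sup>2" .
    have 2: "t * (c * (norm x)\<^sup>2) \<le> t * inner (P x) x" using P[of x] t by (intro mult_left_mono) auto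
    have "(norm (x - t *\<^sub>R P x))\<^sup>2 = (norm x)\<^sup>2 - 2 * (t * inner (P x) x) + t\<^sup>2 * (norm (P x))\<^sup>2"
      unfolding power2_norm_eq_inner
      by (simp add: inner_diff_left inner_diff_right inner_commute power2_eq_square algebra_simps)
    with 1 2 show ?thesis by (simp add: algebra_simps)
  qed
  have tc: "0 \<le> 1 - t * c" "1 - t * c < 1"
  proof -
    have "c * c \<le> M * M" using c M by (intro mult_mono) auto
    then show "0 \<le> 1 - t * c" using M by (simp add: t_def power2_eq_square field_simps)
    show "1 - t * c < 1" using t c by simp
  qed
  define k where "k = sqrt (1 - t * c)"
  have k: "0 \<le> k" "k < 1" using tc by (auto simp: k_def real_sqrt_lt_1_iff)
  have contr': "norm (x - t *\<^sub>R P x) \<le> k * norm x" for x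
    using real_sqrt_le_mono[OF contr[of x]] by (simp add: real_sqrt_mult k_def)
  have surj: "\<exists>x. P x = y" for y
  proof -
    have "\<exists>!x. x - t *\<^sub>R P x + t *\<^sub>R y = x"
    proof (rule banach_fix_type[OF k], intro allI)
      fix x z :: 'a
      have "(x - t *\<^sub>R P x + t *\<^sub>R y) - (z - t *\<^sub>R P z + t *\<^sub>R y) = (x - z) - t *\<^sub>R P (x - z)"
        by (simp add: blinfun.diff_right scaleR_diff_right)
      then show "dist (x - t *\<^sub>R P x + t *\<^sub>R y) (z - t *\<^sub>R P z + t *\<^sub>R y) \<le> k * dist x z"
        using contr'[of "x - z"] unfolding dist_norm by presburger
    qed
    then obtain x where "x - t *\<^sub>R P x + t *\<^sub>R y = x" by auto
    then have "t *\<^sub>R (y - P x) = 0" by (simp add: scaleR_diff_right algebra_simps)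
    then show ?thesis using t by auto
  qed
  have low: "c * norm x \<le> norm (P x)" for x
  proof (cases "x = 0")
    case False
    have "c * norm x * norm x \<le> norm (P x) * norm x"
      using P[of x] norm_cauchy_schwarz[of "P x" x] by (simp add: power2_eq_square mult.assoc)
    then show ?thesis using False by simp
  qed simp
  obtain Q where Q: "\<And>y. P (Q y) = y" using surj by metis
  have inj: "x = z" if "P x = P z" for x z
    using low[of "x - z"] that c by (simp add: blinfun.diff_right mult_le_0_iff)
  have QP: "Q (P x) = x" for x by (rule inj) (simp add: Q)
  have "bounded_linear Q"
  proof (rule bounded_linear_intro)
    show "Q (x + y) = Q x + Q y" for x y by (rule inj) (simp add: Q blinfun.add_right)
    show "Q (r *\<^sub>R x) = r *\<^sub>R Q x" for r x by (rule inj) (simp add: Q blinfun.scaleR_right)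
    show "norm (Q x) \<le> norm x * (1 / c)" for x
      using low[of "Q x"] c by (simp add: Q field_simps)
  qed
  then have "blinfun_apply (Blinfun Q) = Q" by (rule bounded_linear_Blinfun_apply)
  then show thesis by (intro that[of "Blinfun Q"]) (auto intro!: blinfun_eqI simp: Q QP)
qed

section \<open>Functional calculus\<close>

definition invertible_op :: "('a::real_normed_vector \<Rightarrow>\<^sub>L 'a) \<Rightarrow> bool" where
  "invertible_op P \<longleftrightarrow> (\<exists>S. S o\<^sub>L P = id_blinfun \<and> P o\<^sub>L S = id_blinfun)"

definition selfadj :: "('a::real_inner \<Rightarrow>\<^sub>L 'a) \<Rightarrow> bool" where
  "selfadj A \<longleftrightarrow> (\<forall>x y. inner (A x) y = inner x (A y))"

lemma selfadjD: "selfadj A \<Longrightarrow> inner (A x) y = inner x (A y)"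
  by (simp add: selfadj_def)

lemma op_spectrum_iff: "l \<in> op_spectrum T \<longleftrightarrow> \<not> invertible_op (T - l *\<^sub>R id_blinfun)"
  by (simp add: op_spectrum_def invertible_op_def)

section \<open>Algebra of polynomials of an operator\<close>

lemma op_poly_eq_sum:
  assumes "degree p \<le> n"
  shows "op_poly p T = (\<Sum>i\<le>n. coeff p i *\<^sub>R (((o\<^sub>L) T) ^^ i) id_blinfun)"
  unfolding op_poly_def
  by (rule sum.mono_neutral_left) (use assms in \<open>auto simp: coeff_eq_0\<close>)

lemma op_poly_0 [simp]: "op_poly 0 T = 0"
  by (simp add: op_poly_def)

lemma op_poly_pCons: "op_poly (pCons a p) T = a *\<^sub>R id_blinfun + (T o\<^sub>L op_poly p T)"
proof -
  interpret C: bounded_bilinear "(o\<^sub>L) :: ('a \<Rightarrow>\<^sub>L 'a) \<Rightarrow> ('a \<Rightarrow>\<^sub>L 'a) \<Rightarrow> ('a \<Rightarrow>\<^sub>L 'a)"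
    by (rule bounded_bilinear_blinfun_compose)
  have "degree (pCons a p) \<le> Suc (degree p)" by (rule degree_pCons_le)
  from op_poly_eq_sum[OF this, of T] show ?thesis
    by (simp add: sum.atMost_Suc_shift op_poly_def[of p] C.sum_right C.scaleR_right
        del: sum.atMost_Suc degree_pCons_eq_if)
qed

lemma op_poly_add: "op_poly (p + q) T = op_poly p T + op_poly q T"
  using degree_add_le_max[of p q]
  by (simp add: op_poly_eq_sum[of _ "max (degree p) (degree q)"] scaleR_add_left sum.distrib)

lemma op_poly_smult: "op_poly (smult c p) T = c *\<^sub>R op_poly p T"
  using degree_smult_le[of c p]
  by (simp add: op_poly_eq_sum[of _ "degree p"] scaleR_sum_right)

lemma op_poly_minus: "op_poly (- p) T = - op_poly p T"
  using op_poly_smult[of "-1" p T] by simp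

lemma op_poly_diff: "op_poly (p - q) T = op_poly p T - op_poly q T"
  using op_poly_add[of p "- q" T] by (simp add: op_poly_minus)

lemma op_poly_mult: "op_poly (p * q) T = op_poly p T o\<^sub>L op_poly q T"
proof (induction p)
  case (pCons a p)
  then show ?case
    by (intro blinfun_eqI)
      (simp add: op_poly_pCons op_poly_add op_poly_smult blinfun.bilinear_simps)
qed simp

lemma op_poly_const [simp]: "op_poly [:c:] T = c *\<^sub>R id_blinfun"
  by (simp add: op_poly_pCons)

lemma op_poly_linear: "op_poly [:c, d:] T = c *\<^sub>R id_blinfun + d *\<^sub>R T"
  by (intro blinfun_eqI) (simp add: op_poly_pCons blinfun.bilinear_simps)

lemma selfadj_op_poly:
  assumes "selfadj A" shows "selfadj (op_poly p A)"
proof (induction p)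
  case (pCons a p)
  have "op_poly p A o\<^sub>L A = A o\<^sub>L op_poly p A"
    using op_poly_mult[of p "[:0,1:]" A] op_poly_mult[of "[:0,1:]" p A] by (simp add: op_poly_linear mult.commute)
  then have "op_poly p A (A x) = A (op_poly p A x)" for x
    by (metis blinfun_apply_blinfun_compose)
  then show ?case using pCons assms
    by (simp add: selfadj_def op_poly_pCons blinfun.bilinear_simps inner_add_left inner_add_right)
qed (simp add: selfadj_def)

section \<open>Invertibility of polynomials of a self-adjoint operator and the spectral norm
  bound\<close>

lemma invertible_op_compose:
  assumes "invertible_op P" "invertible_op Q"
  shows "invertible_op (P o\<^sub>L Q)"
proof -
  obtain P' Q' where "P' o\<^sub>L P = id_blinfun" "P o\<^sub>L P' = id_blinfun"
    "Q' o\<^sub>L Q = id_blinfun" "Q o\<^sub>L Q' = id_blinfun"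
    using assms by (auto simp: invertible_op_def)
  then have "P' (P x) = x" "P (P' x) = x" "Q' (Q x) = x" "Q (Q' x) = x" for x
    by (metis blinfun_apply_blinfun_compose blinfun_apply_id_blinfun)+
  then show ?thesis
    unfolding invertible_op_def by (intro exI[of _ "Q' o\<^sub>L P'"]) (auto intro!: blinfun_eqI)
qed

lemma map_poly_of_real_add:
  "map_poly of_real (p + q) = (map_poly of_real p + map_poly of_real q :: 'a::{real_algebra_1,comm_ring_1} poly)"
  by (intro poly_eqI) (simp add: coeff_map_poly)

lemma map_poly_of_real_mult:
  "map_poly of_real (p * q) = (map_poly of_real p * map_poly of_real q :: 'a::{real_algebra_1,comm_ring_1} poly)"
  by (intro poly_eqI) (simp add: coeff_map_poly coeff_mult)

lemma poly_map_poly_of_real: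
  "poly (map_poly of_real p) (of_real x) = (of_real (poly p x) :: 'a::{real_algebra_1,comm_ring_1})"
  by (induction p) (simp_all add: map_poly_pCons)

text \<open>The quadratic is the product of X - z and X - conj z. The remainder of \<open>q\<close>
  modulo it is real of degree at most 1 and vanishes at the nonreal \<open>z\<close>, so it is
  0.\<close>

lemma real_poly_complex_root_dvd:
  fixes q :: "real poly"
  assumes z: "poly (map_poly complex_of_real q) z = 0" and im: "Im z \<noteq> 0"
  shows "[:(Re z)\<^sup>2 + (Im z)\<^sup>2, - 2 * Re z, 1:] dvd q"
proof -
  define d where "d = [:(Re z)\<^sup>2 + (Im z)\<^sup>2, - 2 * Re z, 1:]"
  define m where "m = q mod d"
  have "d \<noteq> 0" "degree d = 2" by (auto simp: d_def)
  then have "degree m < 2" unfolding m_def using degree_mod_less[of d q] by auto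
  then have m: "m = [:coeff m 0, coeff m 1:]"
    by (intro poly_eqI) (auto simp: coeff_pCons coeff_eq_0 split: nat.splits)
  have dz: "poly (map_poly complex_of_real d) z = 0"
    by (simp add: d_def map_poly_pCons complex_eq_iff power2_eq_square algebra_simps)
  have "q = d * (q div d) + m" by (simp add: m_def)
  then have "map_poly complex_of_real q =
      map_poly complex_of_real d * map_poly complex_of_real (q div d) + map_poly complex_of_real m"
    by (metis map_poly_of_real_add map_poly_of_real_mult)
  then have "poly (map_poly complex_of_real m) z = 0" using z dz by simp
  moreover have "poly (map_poly complex_of_real m) z = of_real (coeff m 0) + z * of_real (coeff m 1)"
    by (subst m) (simp add: map_poly_pCons)
  ultimately have "coeff m 1 = 0 \<and> coeff m 0 = 0" using im by (auto simp: complex_eq_iff)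
  then have "m = 0" by (subst m) simp
  then show ?thesis by (simp add: m_def d_def mod_eq_0_iff_dvd)
qed

text \<open>Spectral mapping in a real space without complexification. By induction on the degree
  one real factor is split off: a real root lies outside the spectrum, so its linear factor is
  invertible; a nonreal root gives (A - Re z)^2 + (Im z)^2, which is coercive because
  \<open>A\<close> is self-adjoint, so \<open>lax_milgram\<close> inverts it.\<close>

lemma invertible_op_poly:
  fixes A :: "'a::{real_inner,complete_space} \<Rightarrow>\<^sub>L 'a"
  assumes A: "selfadj A"
  shows "q \<noteq> 0 \<Longrightarrow> (\<And>l. l \<in> op_spectrum A \<Longrightarrow> poly q l \<noteq> 0) \<Longrightarrow> invertible_op (op_poly q A)"
proof (induction "degree q" arbitrary: q rule: less_induct)
  case less
  show ?case
  proof (cases "degree q = 0")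
    case True
    then obtain c where q: "q = [:c:]" by (meson degree_eq_zeroE)
    then have "c \<noteq> 0" using less by auto
    then show ?thesis unfolding invertible_op_def q
      by (intro exI[of _ "(1/c) *\<^sub>R id_blinfun"]) (auto intro!: blinfun_eqI simp: blinfun.bilinear_simps)
  next
    case False
    then have "degree (map_poly complex_of_real q) > 0" by (simp add: degree_map_poly)
      then obtain z where z: "poly (map_poly complex_of_real q) z = 0"
      using alg_closed_imp_poly_has_root by blast
    have *: ?thesis if d: "d dvd q" "degree d > 0" "invertible_op (op_poly d A)" for d
    proof -
      obtain q' where q': "q = d * q'" using d by blast
      then have nz: "q' \<noteq> 0" "d \<noteq> 0" using less.prems by auto
      then have "degree q' < degree q" using d by (simp add: q' degree_mult_eq)
      then have "invertible_op (op_poly q' A)"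
        using nz less.prems q' by (intro less.hyps) auto
      then show ?thesis using d by (simp add: q' op_poly_mult invertible_op_compose)
    qed
    show ?thesis
    proof (cases "Im z = 0")
      case True
      then have "z = of_real (Re z)" by (simp add: complex_eq_iff)
      then have "complex_of_real (poly q (Re z)) = 0" using z by (metis poly_map_poly_of_real)
      then have root: "poly q (Re z) = 0" by simp
      then have "[:- Re z, 1:] dvd q" by (simp add: poly_eq_0_iff_dvd)
      moreover have "Re z \<notin> op_spectrum A" using root less.prems by blast
      then have "invertible_op (op_poly [:- Re z, 1:] A)"
        by (simp add: op_spectrum_iff op_poly_linear algebra_simps)
      ultimately show ?thesis by (intro *) auto
    next
      case False
      define d where "d = [:(Re z)\<^sup>2 + (Im z)\<^sup>2, - 2 * Re z, 1:]"
      have "d = [:- Re z, 1:] * [:- Re z, 1:] + [:(Im z)\<^sup>2:]"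
        by (simp add: d_def power2_eq_square)
      then have opd: "op_poly d A x = (A - Re z *\<^sub>R id_blinfun) ((A - Re z *\<^sub>R id_blinfun) x) + (Im z)\<^sup>2 *\<^sub>R x" for x
        by (simp only: op_poly_add op_poly_mult op_poly_linear op_poly_const) (simp add: blinfun.bilinear_simps algebra_simps)
      have sa: "inner ((A - Re z *\<^sub>R id_blinfun) x) y = inner x ((A - Re z *\<^sub>R id_blinfun) y)" for x y
        using A by (simp add: selfadj_def blinfun.bilinear_simps inner_diff_left inner_diff_right)
      have "inner (op_poly d A x) x \<ge> (Im z)\<^sup>2 * (norm x)\<^sup>2" for x
        using sa[of "(A - Re z *\<^sub>R id_blinfun) x" x]
        by (simp only: opd inner_add_left) (simp add: power2_norm_eq_inner)
      moreover have "(Im z)\<^sup>2 > 0" using False by simp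
      ultimately have "invertible_op (op_poly d A)"
        unfolding invertible_op_def using lax_milgram by metis
      moreover have "d dvd q" unfolding d_def using real_poly_complex_root_dvd[OF z False] .
      ultimately show ?thesis by (intro *[of d]) (auto simp: d_def)
    qed
  qed
qed

text \<open>An inverse of |P|^2 - P^2 would give |x|^2 \<le> K (|P|^2 |x|^2 - |P x|^2), where the
  cross term of the expanded square is absorbed by |P (P x)| \<le> |P| |P x|. Then |P x|^2 \<le>
  (|P|^2 - 1/K) |x|^2, which improves on the operator norm. The vector \<open>x0\<close> excludes
  the zero space, where every operator is invertible.\<close>

lemma not_invertible_norm_sq:
  fixes P :: "'a::{real_inner,complete_space} \<Rightarrow>\<^sub>L 'a"
  assumes P: "selfadj P" and x0: "(x0::'a) \<noteq> 0"
  shows "\<not> invertible_op ((norm P)\<^sup>2 *\<^sub>R id_blinfun - (P o\<^sub>L P))"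
proof
  define \<mu> where "\<mu> = norm P"
  assume "invertible_op ((norm P)\<^sup>2 *\<^sub>R id_blinfun - (P o\<^sub>L P))"
  then obtain S where "S o\<^sub>L (\<mu>\<^sup>2 *\<^sub>R id_blinfun - (P o\<^sub>L P)) = id_blinfun"
    unfolding invertible_op_def \<mu>_def by blast
  then have S: "S (\<mu>\<^sup>2 *\<^sub>R x - P (P x)) = x" for x
    by (drule_tac arg_cong[where f="\<lambda>f. blinfun_apply f x"]) (simp add: blinfun.bilinear_simps)
  have mu0: "\<mu> \<ge> 0" by (simp add: \<mu>_def)
  have key: "(norm x)\<^sup>2 \<le> (norm S)\<^sup>2 * (\<mu>\<^sup>2 * (\<mu>\<^sup>2 * (norm x)\<^sup>2 - (norm (P x))\<^sup>2))" for x
  proof -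
    have "inner (P (P x)) x = (norm (P x))\<^sup>2" using P by (simp add: selfadj_def power2_norm_eq_inner)
    then have "(norm (\<mu>\<^sup>2 *\<^sub>R x - P (P x)))\<^sup>2 = \<mu>\<^sup>2 * (\<mu>\<^sup>2 * (norm x)\<^sup>2) - 2 * (\<mu>\<^sup>2 * (norm (P x))\<^sup>2) + (norm (P (P x)))\<^sup>2"
      unfolding power2_norm_eq_inner by (simp add: inner_diff_left inner_diff_right inner_commute algebra_simps)
    moreover have "(norm (P (P x)))\<^sup>2 \<le> (\<mu> * norm (P x))\<^sup>2"
      unfolding \<mu>_def by (intro power_mono norm_blinfun) auto
    ultimately have a: "(norm (\<mu>\<^sup>2 *\<^sub>R x - P (P x)))\<^sup>2 \<le> \<mu>\<^sup>2 * (\<mu>\<^sup>2 * (norm x)\<^sup>2 - (norm (P x))\<^sup>2)"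
      by (simp add: power_mult_distrib algebra_simps)
    have "(norm x)\<^sup>2 \<le> (norm S * norm (\<mu>\<^sup>2 *\<^sub>R x - P (P x)))\<^sup>2"
      using norm_blinfun[of S "\<mu>\<^sup>2 *\<^sub>R x - P (P x)"] by (intro power_mono) (auto simp: S)
    also have "\<dots> \<le> (norm S)\<^sup>2 * (\<mu>\<^sup>2 * (\<mu>\<^sup>2 * (norm x)\<^sup>2 - (norm (P x))\<^sup>2))"
      unfolding power_mult_distrib by (intro mult_left_mono a) auto
    finally show ?thesis .
  qed
  define K where "K = (norm S)\<^sup>2 * \<mu>\<^sup>2"
  have key': "(norm x)\<^sup>2 \<le> K * (\<mu>\<^sup>2 * (norm x)\<^sup>2 - (norm (P x))\<^sup>2)" for x
    using key[of x] by (simp add: K_def mult.assoc)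
  have "K \<noteq> 0" using key'[of x0] x0 by auto
  then have K: "K > 0" by (auto simp: K_def)
  have b: "(norm (P x))\<^sup>2 \<le> (\<mu>\<^sup>2 - 1/K) * (norm x)\<^sup>2" for x
    using key'[of x] K by (simp add: field_simps)
  have nn: "0 \<le> \<mu>\<^sup>2 - 1/K"
  proof -
    have "0 \<le> (\<mu>\<^sup>2 - 1/K) * (norm x0)\<^sup>2" using b[of x0] by (meson order_trans zero_le_power2)
    then show ?thesis using x0 by (simp add: zero_le_mult_iff)
  qed
  have "norm P \<le> sqrt (\<mu>\<^sup>2 - 1/K)"
  proof (rule norm_blinfun_bound)
    show "norm (P x) \<le> sqrt (\<mu>\<^sup>2 - 1/K) * norm x" for x
      using real_sqrt_le_mono[OF b[of x]] by (simp add: real_sqrt_mult)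
  qed (use nn in simp)
  also have "\<dots> < \<mu>" using K mu0 by (intro real_less_lsqrt) auto
  finally show False by (simp add: \<mu>_def)
qed

text \<open>With empty spectrum every nonzero polynomial of \<open>A\<close> would be invertible, in
  particular |A|^2 - A^2.\<close>

lemma op_spectrum_nonempty:
  fixes A :: "'a::{real_inner,complete_space} \<Rightarrow>\<^sub>L 'a"
  assumes A: "selfadj A" and x0: "(x0::'a) \<noteq> 0"
  shows "op_spectrum A \<noteq> {}"
proof
  assume e: "op_spectrum A = {}"
  have "invertible_op (op_poly [:(norm A)\<^sup>2, 0, -1:] A)"
    using e by (intro invertible_op_poly A) auto
  moreover have "op_poly [:(norm A)\<^sup>2, 0, -1:] A = (norm A)\<^sup>2 *\<^sub>R id_blinfun - (A o\<^sub>L A)"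
    by (intro blinfun_eqI) (simp add: op_poly_pCons blinfun.bilinear_simps)
  ultimately show False using not_invertible_norm_sq[OF A x0] by simp
qed

text \<open>If \<mu> = |p(A)| exceeded m, the polynomial \<mu>^2 - p^2 would be positive on the
  spectrum, hence invertible at \<open>A\<close>, against \<open>not_invertible_norm_sq\<close> for
  p(A). This bound is what makes \<open>op_fun\<close> well defined.\<close>

lemma norm_op_poly_le:
  fixes A :: "'a::{real_inner,complete_space} \<Rightarrow>\<^sub>L 'a"
  assumes A: "selfadj A" and m: "m \<ge> 0" "\<And>l. l \<in> op_spectrum A \<Longrightarrow> \<bar>poly p l\<bar> \<le> m"
  shows "norm (op_poly p A) \<le> m"
proof (rule ccontr)
  assume not: "\<not> ?thesis"
  define \<mu> where "\<mu> = norm (op_poly p A)"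
  have mu: "m < \<mu>" using not by (simp add: \<mu>_def)
  then have "op_poly p A \<noteq> 0" using m by (auto simp: \<mu>_def)
  then obtain x0 :: 'a where x0: "x0 \<noteq> 0" by (metis blinfun.zero_right blinfun_eqI zero_blinfun.rep_eq)
  define q where "q = [:\<mu>\<^sup>2:] - p * p"
  have pq: "poly q l > 0" if "l \<in> op_spectrum A" for l
  proof -
    have "\<bar>poly p l\<bar> < \<mu>" using m(2)[OF that] mu by simp
    then have "\<bar>poly p l\<bar>\<^sup>2 < \<mu>\<^sup>2" by (intro power_strict_mono) auto
    then show ?thesis by (simp add: q_def power2_eq_square)
  qed
  \<comment> \<open>Positivity on the spectrum excludes q = 0 only because the spectrum has a
    point.\<close>
  have "q \<noteq> 0" using pq op_spectrum_nonempty[OF A x0] by fastforce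
  then have "invertible_op (op_poly q A)" using pq by (intro invertible_op_poly A) fastforce+
  moreover have "op_poly q A = \<mu>\<^sup>2 *\<^sub>R id_blinfun - (op_poly p A o\<^sub>L op_poly p A)"
    by (simp add: q_def op_poly_diff op_poly_mult)
  ultimately show False
    using not_invertible_norm_sq[OF selfadj_op_poly[OF A] x0] by (simp add: \<mu>_def)
qed

text \<open>These properties place the spectrum in [0,1], the interval on which the filter
  conditions are stated.\<close>

definition pos_contr :: "('a::real_inner \<Rightarrow>\<^sub>L 'a) \<Rightarrow> bool" where
  "pos_contr A \<longleftrightarrow> selfadj A \<and> (\<forall>x. 0 \<le> inner (A x) x) \<and> norm A \<le> 1"

text \<open>For l < 0 the operator A - l is coercive with constant -l, for l > 1 the operator l - A
  with constant l - 1.\<close>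

lemma op_spectrum_subset:
  fixes A :: "'a::{real_inner,complete_space} \<Rightarrow>\<^sub>L 'a"
  assumes A: "pos_contr A"
  shows "op_spectrum A \<subseteq> {0..1}"
proof
  fix l assume l: "l \<in> op_spectrum A"
  show "l \<in> {0..1}"
  proof (rule ccontr)
    assume "l \<notin> {0..1}"
    then consider "l < 0" | "l > 1" by force
    then have "invertible_op (A - l *\<^sub>R id_blinfun)"
    proof cases
      case 1
      have "inner ((A - l *\<^sub>R id_blinfun) x) x \<ge> (-l) * (norm x)\<^sup>2" for x
        using A by (simp add: pos_contr_def blinfun.bilinear_simps inner_diff_left power2_norm_eq_inner)
      then show ?thesis unfolding invertible_op_def using 1 lax_milgram[of "-l" "A - l *\<^sub>R id_blinfun"] by force
    next
      case 2
      have "inner ((l *\<^sub>R id_blinfun - A) x) x \<ge> (l - 1) * (norm x)\<^sup>2" for x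
      proof -
        have "inner (A x) x \<le> norm (A x) * norm x" by (rule norm_cauchy_schwarz)
        also have "norm (A x) \<le> 1 * norm x"
          using norm_blinfun[of A x] mult_right_mono[of "norm A" 1 "norm x"] A by (simp add: pos_contr_def)
        then have "norm (A x) * norm x \<le> (1 * norm x) * norm x" by (intro mult_right_mono) auto
        finally show ?thesis
          by (simp add: blinfun.bilinear_simps inner_diff_left power2_norm_eq_inner algebra_simps)
            (simp add: power2_norm_eq_inner flip: power2_eq_square)
      qed
      then obtain S where S: "S o\<^sub>L (l *\<^sub>R id_blinfun - A) = id_blinfun" "(l *\<^sub>R id_blinfun - A) o\<^sub>L S = id_blinfun"
        using 2 lax_milgram[of "l - 1" "l *\<^sub>R id_blinfun - A"] by force
      then have "S ((l *\<^sub>R id_blinfun - A) x) = x" "(l *\<^sub>R id_blinfun - A) (S x) = x" for x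
        by (metis blinfun_apply_blinfun_compose blinfun_apply_id_blinfun)+
      then show ?thesis unfolding invertible_op_def
        by (intro exI[of _ "- S"]) (auto intro!: blinfun_eqI simp: blinfun.bilinear_simps algebra_simps)
    qed
    then show False using l by (simp add: op_spectrum_iff)
  qed
qed

section \<open>From polynomials to continuous functions\<close>

lemma uniform_poly_approx:
  fixes f :: "real \<Rightarrow> real"
  assumes "continuous_on {0..1} f"
  obtains p :: "nat \<Rightarrow> real poly" where "uniform_limit {0..1} (\<lambda>k. poly (p k)) f sequentially"
proof -
  have "\<exists>p::real poly. \<forall>x\<in>{0..1}. \<bar>f x - poly p x\<bar> < 1 / real (Suc k)" for k
  proof -
    obtain h where h: "real_polynomial_function h" "\<And>x. x \<in> {0..1} \<Longrightarrow> \<bar>f x - h x\<bar> < 1 / real (Suc k)"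
      using Stone_Weierstrass_real_polynomial_function[OF compact_Icc assms, of "1 / real (Suc k)"] by auto
    obtain a n where an: "h = (\<lambda>x. \<Sum>i\<le>n. a i * x ^ i)"
      using h(1) unfolding real_polynomial_function_iff_sum by blast
    have "poly (\<Sum>i\<le>n. monom (a i) i) = h"
      by (simp add: an fun_eq_iff poly_sum poly_monom)
    then show ?thesis using h(2) by metis
  qed
  then obtain p :: "nat \<Rightarrow> real poly" where p: "\<And>k x. x \<in> {0..1} \<Longrightarrow> \<bar>f x - poly (p k) x\<bar> < 1 / real (Suc k)"
    by metis
  show thesis
  proof (rule that[of p], rule uniform_limitI)
    fix e :: real assume "e > 0"
    then obtain N where N: "1 / real (Suc N) < e" using nat_approx_posE by blast
    show "\<forall>\<^sub>F n in sequentially. \<forall>x\<in>{0..1}. dist (poly (p n) x) (f x) < e"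
    proof (rule eventually_sequentiallyI[of N], intro ballI)
      fix n x assume n: "N \<le> n" and x: "x \<in> {0..1::real}"
      have "1 / real (Suc n) \<le> 1 / real (Suc N)" using n by (simp add: frac_le)
      with N p[OF x, of n] show "dist (poly (p n) x) (f x) < e" by (simp add: dist_real_def abs_minus_commute)
    qed
  qed
qed

text \<open>The library instance for \<^class>\<open>banach\<close> does not apply, since \<^class>\<open>banach\<close> is not
  inferred from \<^class>\<open>real_inner\<close> and \<^class>\<open>complete_space\<close>.\<close>

lemma Cauchy_blinfun_converges:
  fixes X :: "nat \<Rightarrow> 'a::real_normed_vector \<Rightarrow>\<^sub>L 'b::{real_normed_vector,complete_space}"
  assumes X: "Cauchy X"
  obtains S where "X \<longlonglongrightarrow> S"
proof -
  have close: "\<exists>N. \<forall>m\<ge>N. \<forall>n\<ge>N. norm (X m - X n) < e" if "e > 0" for e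
    using X that unfolding Cauchy_def dist_norm by simp
  have pt: "norm (X m x - X n x) \<le> norm (X m - X n) * norm x" for m n x
    using norm_blinfun[of "X m - X n" x] by (simp add: blinfun.diff_left)
  have "\<exists>y. (\<lambda>n. X n x) \<longlonglongrightarrow> y" for x
  proof -
    have "Cauchy (\<lambda>n. X n x)"
    proof (rule metric_CauchyI)
      fix e :: real assume e: "e > 0"
      then obtain N where N: "\<forall>m\<ge>N. \<forall>n\<ge>N. norm (X m - X n) < e / (1 + norm x)"
        using close[of "e / (1 + norm x)"] by (auto simp: add_pos_nonneg)
      have "dist (X m x) (X n x) < e" if mn: "m \<ge> N" "n \<ge> N" for m n
      proof -
        have "norm (X m x - X n x) \<le> norm (X m - X n) * norm x" by (rule pt)
        also have "\<dots> \<le> norm (X m - X n) * (1 + norm x)" by (intro mult_left_mono) auto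
        also have "\<dots> < e" using N mn by (simp add: pos_less_divide_eq add_pos_nonneg)
        finally show ?thesis by (simp add: dist_norm)
      qed
      then show "\<exists>M. \<forall>m\<ge>M. \<forall>n\<ge>M. dist (X m x) (X n x) < e" by blast
    qed
    then show ?thesis unfolding Cauchy_convergent_iff convergent_def .
  qed
  then obtain L where L: "\<And>x. (\<lambda>n. X n x) \<longlonglongrightarrow> L x" by metis
  have bd: "\<exists>N. \<forall>n\<ge>N. \<forall>x. norm (X n x - L x) \<le> e * norm x" if e: "e > 0" for e
  proof -
    obtain N where N: "\<forall>m\<ge>N. \<forall>n\<ge>N. norm (X m - X n) < e" using close[OF e] by blast
    have "norm (X n x - L x) \<le> e * norm x" if n: "n \<ge> N" for n x
    proof (rule tendsto_upperbound)
      show "(\<lambda>m. norm (X n x - X m x)) \<longlonglongrightarrow> norm (X n x - L x)" by (intro tendsto_intros L)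
      have "norm (X n x - X m x) \<le> e * norm x" if "m \<ge> N" for m
        using pt[of n x m] N n that by (meson less_imp_le mult_right_mono norm_ge_zero order_trans)
      then show "\<forall>\<^sub>F m in sequentially. norm (X n x - X m x) \<le> e * norm x"
        by (intro eventually_sequentiallyI[of N])
    qed simp
    then show ?thesis by blast
  qed
  obtain N where N: "\<forall>n\<ge>N. \<forall>x. norm (X n x - L x) \<le> 1 * norm x" using bd[of 1] by auto
  have "bounded_linear L"
  proof (rule bounded_linear_intro)
    show "L (x + y) = L x + L y" for x y
      using LIMSEQ_unique[OF L[of "x + y"]] tendsto_add[OF L[of x] L[of y]] by (simp add: blinfun.add_right)
    show "L (r *\<^sub>R x) = r *\<^sub>R L x" for r x
      using LIMSEQ_unique[OF L[of "r *\<^sub>R x"]] tendsto_scaleR[OF tendsto_const L[of x], of r]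
      by (simp add: blinfun.scaleR_right)
    show "norm (L x) \<le> norm x * (1 + norm (X N))" for x
    proof -
      have "norm (X N x - L x) \<le> norm x" using N by simp
      moreover have "norm (L x) \<le> norm (X N x) + norm (X N x - L x)"
        using norm_triangle_ineq4[of "X N x" "X N x - L x"] by simp
      ultimately show ?thesis using norm_blinfun[of "X N" x] by (simp add: algebra_simps)
    qed
  qed
  then have apply_L: "blinfun_apply (Blinfun L) = L" by (rule bounded_linear_Blinfun_apply)
  have "X \<longlonglongrightarrow> Blinfun L"
  proof (rule LIMSEQ_I)
    fix e :: real assume e: "e > 0"
    then obtain N where N: "\<forall>n\<ge>N. \<forall>x. norm (X n x - L x) \<le> e/2 * norm x" using bd[of "e/2"] by auto
    have "norm (X n - Blinfun L) \<le> e/2" if "n \<ge> N" for n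
      using N that e by (intro norm_blinfun_bound) (auto simp: blinfun.diff_left apply_L)
    then show "\<exists>no. \<forall>n\<ge>no. norm (X n - Blinfun L) < e"
      using e by (intro exI[of _ N]) (smt (verit) field_sum_of_halves)
  qed
  then show thesis by (rule that)
qed

text \<open>Two sequences are compared so that one statement yields both the Cauchy property (p = q)
  and the independence of the limit from the approximating sequence.\<close>

lemma op_poly_uniform_close:
  fixes A :: "'a::{real_inner,complete_space} \<Rightarrow>\<^sub>L 'a"
  assumes A: "selfadj A" and e: "e > 0"
    and p: "uniform_limit (op_spectrum A) (\<lambda>k. poly (p k)) f sequentially"
    and q: "uniform_limit (op_spectrum A) (\<lambda>k. poly (q k)) f sequentially"
  shows "\<exists>N. \<forall>k\<ge>N. \<forall>l\<ge>N. norm (op_poly (p k) A - op_poly (q l) A) < e"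
proof -
  have "\<forall>\<^sub>F n in sequentially. (\<forall>x\<in>op_spectrum A. dist (poly (p n) x) (f x) < e/4) \<and>
      (\<forall>x\<in>op_spectrum A. dist (poly (q n) x) (f x) < e/4)"
    using uniform_limitD[OF p, of "e/4"] uniform_limitD[OF q, of "e/4"] e
    by (intro eventually_conj) auto
  then obtain N where N: "\<And>n x. n \<ge> N \<Longrightarrow> x \<in> op_spectrum A \<Longrightarrow> dist (poly (p n) x) (f x) < e/4"
      "\<And>n x. n \<ge> N \<Longrightarrow> x \<in> op_spectrum A \<Longrightarrow> dist (poly (q n) x) (f x) < e/4"
    unfolding eventually_sequentially by blast
  have "norm (op_poly (p k) A - op_poly (q l) A) \<le> e/2" if "k \<ge> N" "l \<ge> N" for k l
    unfolding op_poly_diff[symmetric]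
  proof (rule norm_op_poly_le[OF A])
    fix x assume "x \<in> op_spectrum A"
    from N(1)[OF that(1) this] N(2)[OF that(2) this]
    show "\<bar>poly (p k - q l) x\<bar> \<le> e/2" unfolding dist_real_def poly_diff by linarith
  qed (use e in simp)
  then show ?thesis using e by (intro exI[of _ N]) (smt (verit) field_sum_of_halves)
qed

lemma op_fun_tendsto:
  fixes A :: "'a::{real_inner,complete_space} \<Rightarrow>\<^sub>L 'a"
  assumes A: "pos_contr A" and f: "continuous_on {0..1} f"
    and p: "uniform_limit {0..1} (\<lambda>k. poly (p k)) f sequentially"
  shows "(\<lambda>k. op_poly (p k) A) \<longlonglongrightarrow> op_fun f A"
proof -
  have sa: "selfadj A" using A by (simp add: pos_contr_def)
  have p': "uniform_limit (op_spectrum A) (\<lambda>k. poly (p k)) f sequentially"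
    using uniform_limit_on_subset[OF p op_spectrum_subset[OF A]] .
  have "Cauchy (\<lambda>k. op_poly (p k) A)"
    unfolding Cauchy_def dist_norm using op_poly_uniform_close[OF sa _ p' p'] by meson
  then obtain S where S: "(\<lambda>k. op_poly (p k) A) \<longlonglongrightarrow> S"
    by (rule Cauchy_blinfun_converges)
  have all: "(\<lambda>k. op_poly (q k) A) \<longlonglongrightarrow> S"
    if q: "uniform_limit (op_spectrum A) (\<lambda>k. poly (q k)) f sequentially" for q
  proof -
    have "(\<lambda>k. op_poly (q k) A - op_poly (p k) A) \<longlonglongrightarrow> 0"
    proof (rule LIMSEQ_I)
      fix e :: real assume "e > 0"
      from op_poly_uniform_close[OF sa this q p']
      show "\<exists>N. \<forall>n\<ge>N. norm (op_poly (q n) A - op_poly (p n) A - 0) < e" by auto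
    qed
    from tendsto_add[OF this S] show ?thesis by simp
  qed
  \<comment> \<open>Uniqueness in the definite description rests on \<open>p'\<close>: at least one
    approximating sequence exists, so the defining condition is not vacuous.\<close>
  have "op_fun f A = S"
    unfolding op_fun_def
    by (rule the_equality) (use all S p' LIMSEQ_unique in blast)+
  then show ?thesis using S by simp
qed

lemma op_fun_cong:
  fixes A :: "'a::{real_inner,complete_space} \<Rightarrow>\<^sub>L 'a"
  assumes A: "pos_contr A" and f: "continuous_on {0..1} f" and eq: "\<And>l. l \<in> {0..1} \<Longrightarrow> f l = g l"
  shows "op_fun f A = op_fun g A"
proof -
  have g: "continuous_on {0..1} g" using continuous_on_eq[OF f eq] .
  obtain p where p: "uniform_limit {0..1} (\<lambda>k. poly (p k)) f sequentially"
    using uniform_poly_approx[OF f] .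
  then have p': "uniform_limit {0..1} (\<lambda>k. poly (p k)) g sequentially"
    using uniform_limit_cong'[of "{0..1}" "\<lambda>k. poly (p k)" "\<lambda>k. poly (p k)" f g] eq by auto
  show ?thesis
    using LIMSEQ_unique[OF op_fun_tendsto[OF A f p] op_fun_tendsto[OF A g p']] .
qed

lemma op_fun_poly:
  fixes A :: "'a::{real_inner,complete_space} \<Rightarrow>\<^sub>L 'a"
  assumes A: "pos_contr A"
  shows "op_fun (poly p) A = op_poly p A"
proof -
  have "uniform_limit {0..1} (\<lambda>k::nat. poly p) (poly p) sequentially"
    by (rule uniform_limit_const)
  from op_fun_tendsto[OF A _ this] have "(\<lambda>k::nat. op_poly p A) \<longlonglongrightarrow> op_fun (poly p) A"
    by (simp add: continuous_on_poly)
  then show ?thesis by (simp add: LIMSEQ_const_iff)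
qed

context
  fixes A :: "'a::{real_inner,complete_space} \<Rightarrow>\<^sub>L 'a"
  assumes A: "pos_contr A"
begin

lemma op_fun_const: "op_fun (\<lambda>_. c) A x = c *\<^sub>R x"
proof -
  have "(\<lambda>_. c) = poly [:c:]" by (simp add: fun_eq_iff)
  then show ?thesis by (simp only: op_fun_poly[OF A] op_poly_const) (simp add: blinfun.bilinear_simps)
qed

lemma op_fun_ident: "op_fun (\<lambda>l. l) A = A"
proof -
  have "(\<lambda>l::real. l) = poly [:0, 1:]" by (simp add: fun_eq_iff)
  then show ?thesis by (simp only: op_fun_poly[OF A] op_poly_linear) simp
qed

lemma op_fun_add:
  assumes f: "continuous_on {0..1} f" and g: "continuous_on {0..1} g"
  shows "op_fun (\<lambda>l. f l + g l) A x = op_fun f A x + op_fun g A x"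
proof -
  obtain p q where p: "uniform_limit {0..1} (\<lambda>k. poly (p k)) f sequentially"
    and q: "uniform_limit {0..1} (\<lambda>k. poly (q k)) g sequentially"
    using uniform_poly_approx[OF f] uniform_poly_approx[OF g] by metis
  have "uniform_limit {0..1} (\<lambda>k. poly (p k + q k)) (\<lambda>l. f l + g l) sequentially"
  proof -
    have "(\<lambda>k. poly (p k + q k)) = (\<lambda>k l. poly (p k) l + poly (q k) l)" by (simp add: fun_eq_iff)
    then show ?thesis using uniform_limit_add[OF p q] by simp
  qed
  from op_fun_tendsto[OF A _ this] have "(\<lambda>k. op_poly (p k + q k) A) \<longlonglongrightarrow> op_fun (\<lambda>l. f l + g l) A"
    using f g by (simp add: continuous_on_add)
  moreover have "(\<lambda>k. op_poly (p k + q k) A) \<longlonglongrightarrow> op_fun f A + op_fun g A"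
    unfolding op_poly_add by (intro tendsto_add op_fun_tendsto[OF A] f g p q)
  ultimately have "op_fun (\<lambda>l. f l + g l) A = op_fun f A + op_fun g A" by (rule LIMSEQ_unique)
  then show ?thesis by (simp add: blinfun.bilinear_simps)
qed

lemma op_fun_mult:
  assumes f: "continuous_on {0..1} f" and g: "continuous_on {0..1} g"
  shows "op_fun (\<lambda>l. f l * g l) A x = op_fun f A (op_fun g A x)"
proof -
  interpret C: bounded_bilinear "(o\<^sub>L) :: ('a \<Rightarrow>\<^sub>L 'a) \<Rightarrow> ('a \<Rightarrow>\<^sub>L 'a) \<Rightarrow> ('a \<Rightarrow>\<^sub>L 'a)"
    by (rule bounded_bilinear_blinfun_compose)
  obtain p q where p: "uniform_limit {0..1} (\<lambda>k. poly (p k)) f sequentially"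
    and q: "uniform_limit {0..1} (\<lambda>k. poly (q k)) g sequentially"
    using uniform_poly_approx[OF f] uniform_poly_approx[OF g] by metis
  have bf: "bounded (f ` {0..1})" and bg: "bounded (g ` {0..1})"
    by (intro compact_imp_bounded compact_continuous_image f g compact_Icc)+
  have "uniform_limit {0..1} (\<lambda>k. poly (p k * q k)) (\<lambda>l. f l * g l) sequentially"
  proof -
    have "(\<lambda>k. poly (p k * q k)) = (\<lambda>k l. poly (p k) l * poly (q k) l)" by (simp add: fun_eq_iff)
    then show ?thesis
      using bounded_bilinear.bounded_uniform_limit[OF bounded_bilinear_mult p q bg bf] by simp
  qed
  from op_fun_tendsto[OF A _ this] have "(\<lambda>k. op_poly (p k * q k) A) \<longlonglongrightarrow> op_fun (\<lambda>l. f l * g l) A"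
    using f g by (simp add: continuous_on_mult)
  moreover have "(\<lambda>k. op_poly (p k * q k) A) \<longlonglongrightarrow> (op_fun f A o\<^sub>L op_fun g A)"
    unfolding op_poly_mult by (intro C.tendsto op_fun_tendsto[OF A] f g p q)
  ultimately have "op_fun (\<lambda>l. f l * g l) A = (op_fun f A o\<^sub>L op_fun g A)" by (rule LIMSEQ_unique)
  then show ?thesis by simp
qed

lemma op_fun_scale:
  assumes f: "continuous_on {0..1} f"
  shows "op_fun (\<lambda>l. c * f l) A x = c *\<^sub>R op_fun f A x"
  using op_fun_mult[of "\<lambda>_. c" f x] f by (simp add: op_fun_const)

lemma op_fun_diff:
  assumes f: "continuous_on {0..1} f" and g: "continuous_on {0..1} g"
  shows "op_fun (\<lambda>l. f l - g l) A x = op_fun f A x - op_fun g A x"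
  using op_fun_add[of f "\<lambda>l. - 1 * g l" x] op_fun_scale[of g "-1" x] f g
  by (simp add: continuous_on_minus)

lemma inner_op_fun_commute:
  assumes f: "continuous_on {0..1} f"
  shows "inner (op_fun f A x) y = inner x (op_fun f A y)"
proof -
  obtain p where p: "uniform_limit {0..1} (\<lambda>k. poly (p k)) f sequentially"
    using uniform_poly_approx[OF f] .
  have l: "(\<lambda>k. op_poly (p k) A z) \<longlonglongrightarrow> op_fun f A z" for z
    by (intro tendsto_intros op_fun_tendsto[OF A f p])
  have "(\<lambda>k. inner (op_poly (p k) A x) y) \<longlonglongrightarrow> inner (op_fun f A x) y"
    by (intro tendsto_intros l)
  moreover have "(\<lambda>k. inner (op_poly (p k) A x) y) \<longlonglongrightarrow> inner x (op_fun f A y)"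
  proof -
    have "inner (op_poly (p k) A x) y = inner x (op_poly (p k) A y)" for k
      using selfadjD[OF selfadj_op_poly[of A]] A unfolding pos_contr_def by blast
    then show ?thesis by (simp only:) (intro tendsto_intros l)
  qed
  ultimately show ?thesis by (rule LIMSEQ_unique)
qed

text \<open>The form equals |h(A) x|^2 for h = sqrt f.\<close>

lemma op_fun_nonneg:
  assumes f: "continuous_on {0..1} f" and nn: "\<And>l. l \<in> {0..1} \<Longrightarrow> f l \<ge> 0"
  shows "inner (op_fun f A x) x \<ge> 0"
proof -
  have s: "continuous_on {0..1} (\<lambda>l. sqrt (f l))" by (intro continuous_intros f)
  have "op_fun f A = op_fun (\<lambda>l. sqrt (f l) * sqrt (f l)) A"
    using nn by (intro op_fun_cong[OF A f]) simp
  then have "op_fun f A x = op_fun (\<lambda>l. sqrt (f l)) A (op_fun (\<lambda>l. sqrt (f l)) A x)"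
    using op_fun_mult[OF s s, of x] by simp
  then have "inner (op_fun f A x) x = inner (op_fun (\<lambda>l. sqrt (f l)) A x) (op_fun (\<lambda>l. sqrt (f l)) A x)"
    using inner_op_fun_commute[OF s, of "op_fun (\<lambda>l. sqrt (f l)) A x" x] by simp
  then show ?thesis by simp
qed

text \<open>The bridge by which scalar inequalities on [0,1] become estimates of quadratic
  forms.\<close>

lemma op_fun_mono:
  assumes f: "continuous_on {0..1} f" and g: "continuous_on {0..1} g"
    and le: "\<And>l. l \<in> {0..1} \<Longrightarrow> f l \<le> g l"
  shows "inner (op_fun f A x) x \<le> inner (op_fun g A x) x"
  using op_fun_nonneg[of "\<lambda>l. g l - f l" x] f g le
  by (simp add: op_fun_diff continuous_on_diff inner_diff_left)

lemma norm_op_fun_sq: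
  assumes f: "continuous_on {0..1} f"
  shows "(norm (op_fun f A x))\<^sup>2 = inner (op_fun (\<lambda>l. f l * f l) A x) x"
  by (simp add: op_fun_mult[OF f f] inner_op_fun_commute[OF f] power2_norm_eq_inner)

lemma norm_op_fun_le:
  assumes f: "continuous_on {0..1} f" and m: "m \<ge> 0" and le: "\<And>l. l \<in> {0..1} \<Longrightarrow> \<bar>f l\<bar> \<le> m"
  shows "norm (op_fun f A x) \<le> m * norm x"
proof -
  have sq: "f l * f l \<le> m\<^sup>2" if "l \<in> {0..1}" for l
    using le[OF that] m power_mono[of "\<bar>f l\<bar>" m 2] by (simp add: power2_eq_square)
  have "(norm (op_fun f A x))\<^sup>2 \<le> inner (op_fun (\<lambda>_. m\<^sup>2) A x) x"
    unfolding norm_op_fun_sq[OF f] by (rule op_fun_mono) (intro continuous_intros f sq | assumption)+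
  also have "\<dots> = (m * norm x)\<^sup>2" by (simp add: op_fun_const power_mult_distrib power2_norm_eq_inner)
  finally show ?thesis by (rule power2_le_imp_le) (simp add: m)
qed

end

text \<open>True for polynomials by induction, then in the limit. Applied with \<open>P\<close>
  equal to \<open>T\<close> or \<open>adj T\<close>, it moves functions of one Gram operator across
  to the other.\<close>

lemma op_fun_intertwine:
  fixes A :: "'a::{real_inner,complete_space} \<Rightarrow>\<^sub>L 'a" and B :: "'b::{real_inner,complete_space} \<Rightarrow>\<^sub>L 'b"
    and P :: "'a \<Rightarrow>\<^sub>L 'b"
  assumes A: "pos_contr A" and B: "pos_contr B" and P: "\<And>x. P (A x) = B (P x)"
    and f: "continuous_on {0..1} f"
  shows "P (op_fun f A x) = op_fun f B (P x)"
proof -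
  obtain p where p: "uniform_limit {0..1} (\<lambda>k. poly (p k)) f sequentially"
    using uniform_poly_approx[OF f] .
  have c: "P (op_poly q A x) = op_poly q B (P x)" for q
    by (induction q) (simp_all add: op_poly_pCons blinfun.bilinear_simps P)
  have "(\<lambda>k. P (op_poly (p k) A x)) \<longlonglongrightarrow> P (op_fun f A x)"
    by (intro tendsto_intros op_fun_tendsto[OF A f p])
  moreover have "(\<lambda>k. P (op_poly (p k) A x)) \<longlonglongrightarrow> op_fun f B (P x)"
    unfolding c by (intro tendsto_intros op_fun_tendsto[OF B f p])
  ultimately show ?thesis by (rule LIMSEQ_unique)
qed

section \<open>Estimates for functions of a Gram operator\<close>

text \<open>By \<open>adj_adj\<close>, \<open>gram (adj T)\<close> is
  \<open>T o\<^sub>L adj T\<close>, so one notation covers both orders of the product.\<close>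

abbreviation gram ::
  "('a::{real_inner,complete_space} \<Rightarrow>\<^sub>L 'b::{real_inner,complete_space}) \<Rightarrow> ('a \<Rightarrow>\<^sub>L 'a)" where
  "gram T \<equiv> adj T o\<^sub>L T"

lemma adj_adj: "adj (adj T) = T"
  by (intro blinfun_eqI vector_eq_ldot[THEN iffD1]) (simp add: inner_adj_left inner_adj_right)

lemma norm_adj_le: "norm (adj T) \<le> norm T"
  by (intro norm_blinfun_bound norm_adj_apply_le) simp

lemma pos_contr_gram:
  assumes "norm T \<le> 1" shows "pos_contr (gram T)"
proof -
  have "norm (gram T) \<le> norm (adj T) * norm T" by (rule norm_blinfun_compose)
  also have "\<dots> \<le> 1 * 1" using norm_adj_le[of T] assms by (intro mult_mono) auto
  finally show ?thesis
    by (auto simp: pos_contr_def selfadj_def inner_adj_left inner_adj_right)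
qed

context
  fixes T :: "'a::{real_inner,complete_space} \<Rightarrow>\<^sub>L 'b::{real_inner,complete_space}"
  assumes T: "norm T \<le> 1"
begin

lemma norm_adj_le_1: "norm (adj T) \<le> 1"
  using norm_adj_le[of T] T by simp

lemma op_fun_gram_left:
  assumes "continuous_on {0..1} f"
  shows "T (op_fun f (gram T) x) = op_fun f (gram (adj T)) (T x)"
  by (rule op_fun_intertwine[OF pos_contr_gram[OF T] pos_contr_gram[OF norm_adj_le_1] _ assms]) (simp add: adj_adj)

lemma op_fun_gram_right:
  assumes "continuous_on {0..1} f"
  shows "adj T (op_fun f (gram (adj T)) y) = op_fun f (gram T) (adj T y)"
  by (rule op_fun_intertwine[OF pos_contr_gram[OF norm_adj_le_1] pos_contr_gram[OF T] _ assms]) (simp add: adj_adj)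

lemma op_fun_gram_ident_mult:
  assumes "continuous_on {0..1} f"
  shows "op_fun (\<lambda>l. l * f l) (gram T) x = gram T (op_fun f (gram T) x)"
  using op_fun_mult[OF pos_contr_gram[OF T] continuous_on_id assms]
  by (simp add: op_fun_ident[OF pos_contr_gram[OF T]])

lemma op_fun_gram_mult_ident:
  assumes "continuous_on {0..1} f"
  shows "op_fun (\<lambda>l. f l * l) (gram T) x = op_fun f (gram T) (gram T x)"
  using op_fun_mult[OF pos_contr_gram[OF T] assms continuous_on_id]
  by (simp add: op_fun_ident[OF pos_contr_gram[OF T]])

lemma norm_gram_op_fun_sq:
  assumes f: "continuous_on {0..1} f"
  shows "(norm (T (op_fun f (gram T) x)))\<^sup>2 = inner (op_fun (\<lambda>l. l * (f l * f l)) (gram T) x) x"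
proof -
  note P = pos_contr_gram[OF T]
  have "op_fun (\<lambda>l. l * (f l * f l)) (gram T) x = op_fun (\<lambda>l. f l * (l * f l)) (gram T) x"
    by (simp add: mult.left_commute)
  also have "\<dots> = op_fun f (gram T) (gram T (op_fun f (gram T) x))"
    using f by (subst op_fun_mult[OF P]) (auto intro!: continuous_intros simp: op_fun_gram_ident_mult)
  finally show ?thesis
    by (simp add: inner_op_fun_commute[OF P f] inner_adj_left power2_norm_eq_inner)
qed

text \<open>After \<open>T\<close> is moved to the right, the function acts on the image side; this
  is why |T x| and not only |x| appears in the bound.\<close>

lemma norm_gram_op_fun_le:
  assumes f: "continuous_on {0..1} f" and m: "m \<ge> 0" and le: "\<And>l. l \<in> {0..1} \<Longrightarrow> \<bar>f l\<bar> \<le> m"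
  shows "norm (T (op_fun f (gram T) x)) \<le> m * norm (T x)"
  unfolding op_fun_gram_left[OF f]
  by (intro norm_op_fun_le pos_contr_gram norm_adj_le_1 f m le)

text \<open>Needed with f l = a / (a + l) and m = sqrt a, where the error itself and not its image
  is the controlled quantity.\<close>

lemma norm_gram_op_fun_le_sqrt:
  assumes f: "continuous_on {0..1} f" and m: "m \<ge> 0" and le: "\<And>l. l \<in> {0..1} \<Longrightarrow> l * (f l)\<^sup>2 \<le> m\<^sup>2"
  shows "norm (T (op_fun f (gram T) x)) \<le> m * norm x"
proof -
  have "(norm (T (op_fun f (gram T) x)))\<^sup>2 \<le> inner (op_fun (\<lambda>_. m\<^sup>2) (gram T) x) x"
    unfolding norm_gram_op_fun_sq[OF f]
    by (rule op_fun_mono[OF pos_contr_gram[OF T]])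
      (intro continuous_intros f le[unfolded power2_eq_square[of "f _"]] | assumption)+
  also have "\<dots> = (m * norm x)\<^sup>2"
    by (simp add: op_fun_const[OF pos_contr_gram[OF T]] power_mult_distrib power2_norm_eq_inner)
  finally show ?thesis by (rule power2_le_imp_le) (simp add: m)
qed

text \<open>The first conclusion is the normal equation of Tikhonov regularization. It serves to
  compare the resolvents of two operators and to split a vector into a small part and a part in the
  range of the Gram operator.\<close>

lemma resolvent_gram:
  fixes x :: 'a
  assumes a: "a > 0"
  defines "y \<equiv> op_fun (\<lambda>l. 1 / (a + l)) (gram T) x"
  shows "gram T y + a *\<^sub>R y = x" and "norm (T y) \<le> norm (T x) / a" and "norm y \<le> norm x / a"
    and "op_fun (\<lambda>l. a / (a + l)) (gram T) x = a *\<^sub>R y"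
proof -
  note P = pos_contr_gram[OF T]
  have c: "continuous_on {0..1} (\<lambda>l. 1 / (a + l))" using a by (intro continuous_intros) auto
  have le: "\<bar>1 / (a + l)\<bar> \<le> 1 / a" if "l \<in> {0..1}" for l using that a by (simp add: frac_le)
  show s: "op_fun (\<lambda>l. a / (a + l)) (gram T) x = a *\<^sub>R y"
    unfolding y_def using op_fun_scale[OF P c, of a x] by simp
  have "gram T y + a *\<^sub>R y = op_fun (\<lambda>l. l * (1 / (a + l)) + a * (1 / (a + l))) (gram T) x"
    unfolding y_def
    by (simp only: op_fun_add[OF P continuous_on_mult[OF continuous_on_id c] continuous_on_mult[OF continuous_on_const c]]
        op_fun_gram_ident_mult[OF c] op_fun_scale[OF P c])
  also have "op_fun (\<lambda>l. l * (1 / (a + l)) + a * (1 / (a + l))) (gram T) = op_fun (\<lambda>_. 1) (gram T)"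
  proof (rule op_fun_cong[OF P])
    show "continuous_on {0..1} (\<lambda>l. l * (1 / (a + l)) + a * (1 / (a + l)))"
      using a by (intro continuous_intros) auto
    show "l * (1 / (a + l)) + a * (1 / (a + l)) = 1" if "l \<in> {0..1}" for l
    proof -
      have "a + l > 0" using a that by (auto intro: add_pos_nonneg)
      then show ?thesis by (simp add: add.commute flip: add_divide_distrib)
    qed
  qed
  finally show "gram T y + a *\<^sub>R y = x" by (simp add: op_fun_const[OF P])
  show "norm (T y) \<le> norm (T x) / a"
    unfolding y_def using norm_gram_op_fun_le[OF c _ le] a by simp
  show "norm y \<le> norm x / a"
    unfolding y_def using norm_op_fun_le[OF P c _ le] a by simp
qed

end

section \<open>The Lyapunov functional\<close>

definition energy_weight :: "real \<Rightarrow> real \<Rightarrow> real \<Rightarrow> real \<Rightarrow> real" where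
  "energy_weight \<eta> \<kappa> a l = 1 + \<eta> * (a / (a + l)) + \<kappa> / a * l"

text \<open>The term in \<open>T x\<close> stands outside the functional calculus because energies
  of different operators are compared, and |T x| is the quantity in which the two are relatively
  close.\<close>

definition energy ::
  "real \<Rightarrow> real \<Rightarrow> real \<Rightarrow> ('a::{real_inner,complete_space} \<Rightarrow>\<^sub>L 'b::{real_inner,complete_space}) \<Rightarrow> 'a \<Rightarrow> real" where
  "energy \<eta> \<kappa> a T x =
     (norm x)\<^sup>2 + \<eta> * inner (op_fun (\<lambda>l. a / (a + l)) (gram T) x) x + \<kappa> / a * (norm (T x))\<^sup>2"

lemma continuous_on_energy_weight:
  "a > 0 \<Longrightarrow> continuous_on {0..1} (energy_weight \<eta> \<kappa> a)"
  unfolding energy_weight_def by (intro continuous_intros) auto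

lemma energy_eq:
  assumes T: "norm T \<le> 1" and a: "a > 0"
  shows "energy \<eta> \<kappa> a T x = inner (op_fun (energy_weight \<eta> \<kappa> a) (gram T) x) x"
proof -
  note P = pos_contr_gram[OF T]
  have c: "continuous_on {0..1} (\<lambda>l. a / (a + l))" using a by (intro continuous_intros) auto
  have "op_fun (energy_weight \<eta> \<kappa> a) (gram T) x =
      x + \<eta> *\<^sub>R op_fun (\<lambda>l. a / (a + l)) (gram T) x + (\<kappa> / a) *\<^sub>R gram T x"
    unfolding energy_weight_def using c
    by (simp add: op_fun_add[OF P] op_fun_scale[OF P] op_fun_const[OF P] op_fun_ident[OF P] continuous_intros
        continuous_on_mult continuous_on_add del: times_divide_eq_left times_divide_eq_right)
  then show ?thesis
    by (simp add: energy_def inner_add_left inner_adj_left power2_norm_eq_inner)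
qed

lemma energy_bounds:
  fixes T :: "'a::{real_inner,complete_space} \<Rightarrow>\<^sub>L 'b::{real_inner,complete_space}"
  assumes T: "norm T \<le> 1" and a: "a > 0" and \<eta>: "\<eta> \<ge> 0" and \<kappa>: "\<kappa> \<ge> 0"
  shows "(norm x)\<^sup>2 + \<kappa> / a * (norm (T x))\<^sup>2 \<le> energy \<eta> \<kappa> a T x"
    and "energy \<eta> \<kappa> a T x \<le> (1 + \<eta>) * (norm x)\<^sup>2 + \<kappa> / a * (norm (T x))\<^sup>2"
proof -
  note P = pos_contr_gram[OF T]
  have c: "continuous_on {0..1} (\<lambda>l. a / (a + l))" using a by (intro continuous_intros) auto
  have "0 \<le> inner (op_fun (\<lambda>l. a / (a + l)) (gram T) x) x"
    using a by (intro op_fun_nonneg[OF P c]) auto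
  then show "(norm x)\<^sup>2 + \<kappa> / a * (norm (T x))\<^sup>2 \<le> energy \<eta> \<kappa> a T x"
    using \<eta> by (simp add: energy_def)
  have "inner (op_fun (\<lambda>l. a / (a + l)) (gram T) x) x \<le> inner (op_fun (\<lambda>_. 1) (gram T) x) x"
    using a by (intro op_fun_mono[OF P c]) auto
  then have "inner (op_fun (\<lambda>l. a / (a + l)) (gram T) x) x \<le> (norm x)\<^sup>2"
    by (simp add: op_fun_const[OF P] power2_norm_eq_inner)
  from mult_left_mono[OF this \<eta>] show "energy \<eta> \<kappa> a T x \<le> (1 + \<eta>) * (norm x)\<^sup>2 + \<kappa> / a * (norm (T x))\<^sup>2"
    by (simp add: energy_def algebra_simps)
qed

text \<open>The price is proportional to |T x|^2 / a and not to |x|^2, so the per-step decrease can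
  absorb it. Of the 7, the resolvent term contributes 4 and the difference of |S x|^2 and |T x|^2
  contributes 3.\<close>

lemma energy_diff_le:
  fixes S T :: "'a::{real_inner,complete_space} \<Rightarrow>\<^sub>L 'b::{real_inner,complete_space}"
  assumes T: "norm T \<le> 1" and S: "norm S \<le> 1" and a: "a > 0"
    and \<eta>: "0 \<le> \<eta>" "\<eta> \<le> 1" and \<kappa>: "0 \<le> \<kappa>" "\<kappa> \<le> 1" and e: "0 \<le> e" "e \<le> 1"
    and ST: "\<And>x. norm (S x - T x) \<le> e * norm (T x)" and TS: "\<And>x. norm (T x - S x) \<le> e * norm (S x)"
  shows "energy \<eta> \<kappa> a S x \<le> energy \<eta> \<kappa> a T x + 7 * e / a * (norm (T x))\<^sup>2"
proof -
  define y where "y = op_fun (\<lambda>l. 1 / (a + l)) (gram S) x"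
  define z where "z = op_fun (\<lambda>l. 1 / (a + l)) (gram T) x"
  note y = resolvent_gram[OF S a, of x, folded y_def]
  note z = resolvent_gram[OF T a, of x, folded z_def]
  have Sx: "norm (S x) \<le> 2 * norm (T x)"
    using norm_triangle_ineq2[of "S x" "T x"] ST[of x] e mult_right_mono[of e 1 "norm (T x)"] by simp
  \<comment> \<open>Each \<open>x\<close> is replaced by the normal equation of the other operator,
    so that the terms with \<open>a\<close> cancel and only the relatively small differences of
    \<open>S\<close> and \<open>T\<close> remain.\<close>
  have "inner y x - inner z x = inner y (gram T z + a *\<^sub>R z) - inner z (gram S y + a *\<^sub>R y)"
    by (simp only: y z)
  also have "\<dots> = inner (T y) (T z) - inner (S y) (S z)"
    by (simp add: inner_add_right inner_adj_right inner_commute)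
  also have "\<dots> = inner (T y - S y) (T z) - inner (S y) (S z - T z)"
    by (simp add: inner_diff_left inner_diff_right)
  also have "\<dots> \<le> norm (T y - S y) * norm (T z) + norm (S y) * norm (S z - T z)"
    using norm_cauchy_schwarz[of "T y - S y" "T z"] Cauchy_Schwarz_ineq2[of "S y" "S z - T z"] by simp
  also have "\<dots> \<le> (e * norm (S y)) * norm (T z) + norm (S y) * (e * norm (T z))"
    by (intro add_mono mult_right_mono mult_left_mono ST TS) auto
  also have "\<dots> = 2 * e * (norm (S y) * norm (T z))" by simp
  also have "\<dots> \<le> 2 * e * ((2 * norm (T x) / a) * (norm (T x) / a))"
  proof -
    have "norm (S y) \<le> 2 * norm (T x) / a" using y(2) Sx a by (meson divide_right_mono less_imp_le order_trans)
    then show ?thesis using z(2) e a by (intro mult_left_mono mult_mono) auto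
  qed
  finally have "inner y x - inner z x \<le> 4 * e / (a * a) * (norm (T x))\<^sup>2"
    by (simp add: power2_eq_square)
  from mult_left_mono[OF this, of a] a
  have U: "a * inner y x - a * inner z x \<le> 4 * e / a * (norm (T x))\<^sup>2"
    by (simp add: right_diff_distrib)
  have "\<eta> * (a * inner y x - a * inner z x) \<le> \<eta> * (4 * e / a * (norm (T x))\<^sup>2)"
    using \<eta> U by (intro mult_left_mono) auto
  also have "\<dots> \<le> 1 * (4 * e / a * (norm (T x))\<^sup>2)"
    using \<eta> e a by (intro mult_right_mono) auto
  finally have U': "\<eta> * (a * inner y x) - \<eta> * (a * inner z x) \<le> 4 * e / a * (norm (T x))\<^sup>2"
    by (simp add: algebra_simps)
  have "(norm (S x))\<^sup>2 - (norm (T x))\<^sup>2 = (norm (S x) - norm (T x)) * (norm (S x) + norm (T x))"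
    by (simp add: power2_eq_square algebra_simps)
  also have "\<dots> \<le> (e * norm (T x)) * (norm (S x) + norm (T x))"
    using norm_triangle_ineq2[of "S x" "T x"] ST[of x] by (intro mult_right_mono) auto
  also have "\<dots> \<le> (e * norm (T x)) * (3 * norm (T x))"
    using Sx e by (intro mult_left_mono) auto
  finally have V: "(norm (S x))\<^sup>2 - (norm (T x))\<^sup>2 \<le> 3 * e * (norm (T x))\<^sup>2"
    by (simp add: power2_eq_square)
  have "\<kappa> / a * ((norm (S x))\<^sup>2 - (norm (T x))\<^sup>2) \<le> \<kappa> / a * (3 * e * (norm (T x))\<^sup>2)"
    using V \<kappa> a by (intro mult_left_mono) auto
  also have "\<dots> \<le> 1 / a * (3 * e * (norm (T x))\<^sup>2)"
    using \<kappa> a e by (intro mult_right_mono divide_right_mono) auto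
  finally have V': "\<kappa> / a * (norm (S x))\<^sup>2 - \<kappa> / a * (norm (T x))\<^sup>2 \<le> 3 * e / a * (norm (T x))\<^sup>2"
    by (simp add: algebra_simps)
  have sum7: "4 * e / a * (norm (T x))\<^sup>2 + 3 * e / a * (norm (T x))\<^sup>2 = 7 * e / a * (norm (T x))\<^sup>2"
    using a by (simp add: field_simps)
  have arith: "n + A + C \<le> n + B + D + R" if "A - B \<le> P" "C - D \<le> Q" "P + Q = R"
    for n A B C D P Q R :: real using that by linarith
  show ?thesis
    unfolding energy_def y(4) z(4) inner_scaleR_left by (rule arith[OF U' V' sum7])
qed

text \<open>Here \<open>s\<close> is the residual filter at \<open>l\<close>, and x = l / a. For x
  \<le> 2 only s \<le> 1 is used: the growth \<kappa> x / q of the last term is paid by the drop of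
  the resolvent term, \<eta> x (1 - q) / ((1 + x)(q + x)), whose denominator is at most 9; the value
  of \<kappa> equates the two. For x > 2, l s \<le> a forces s \<le> 1/2, and s^2 pushes the whole
  left side below 1.\<close>

lemma energy_weight_decrease:
  assumes a: "a > 0" and q: "0 < q" "q < 1" and \<eta>: "0 < \<eta>" "\<eta> \<le> 1" and \<kappa>: "\<kappa> = \<eta> * q * (1 - q) / 9"
    and l: "l \<ge> 0" and s: "0 \<le> s" "s \<le> 1" "l * s \<le> a"
  shows "energy_weight \<eta> \<kappa> (q * a) l * s\<^sup>2 \<le> energy_weight \<eta> \<kappa> a l - \<kappa> / a * l"
proof -
  define x where "x = l / a"
  have x: "x \<ge> 0" "x * s \<le> 1" using l a s by (auto simp: x_def field_simps)
  have w: "energy_weight \<eta> \<kappa> a l = 1 + \<eta> / (1 + x) + \<kappa> * x"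
    using a l by (simp add: energy_weight_def x_def field_simps)
  have qal: "q * a + l > 0" "q + l / a > 0" using a q l by (auto intro: add_pos_nonneg)
  have "q * a / (q * a + l) = q / (q + x)" using a qal by (simp add: x_def field_simps)
  then have w': "energy_weight \<eta> \<kappa> (q * a) l = 1 + \<eta> * (q / (q + x)) + \<kappa> / q * x"
    unfolding energy_weight_def by (simp add: x_def)
  have k0: "\<kappa> > 0" using \<eta> q by (simp add: \<kappa>)
  have kq: "\<kappa> \<le> q"
  proof -
    have "\<eta> * (1 - q) \<le> 1 * 1" using \<eta> q by (intro mult_mono) auto
    then have "q * (\<eta> * (1 - q)) \<le> q * 9" using q by (intro mult_left_mono) auto
    then show ?thesis by (simp add: \<kappa> mult_ac)
  qed
  have q1: "q / (q + x) \<le> 1" using q x by (simp add: field_simps)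
  show ?thesis
  proof (cases "x \<le> 2")
    case True
    have s2: "s\<^sup>2 \<le> 1" using s by (simp add: power_le_one)
    have wp: "0 \<le> 1 + \<eta> * (q / (q + x)) + \<kappa> / q * x" using \<eta> q x k0 by simp
    have d: "1 / (1 + x) - q / (q + x) = x * (1 - q) / ((1 + x) * (q + x))"
      using x q by (simp add: field_simps)
    have "(1 + x) * (q + x) \<le> 3 * 3" using True x q by (intro mult_mono) auto
    then have "x * (1 - q) / 9 \<le> x * (1 - q) / ((1 + x) * (q + x))"
      using x q by (intro divide_left_mono) (auto intro!: mult_pos_pos add_pos_nonneg)
    then have "\<eta> * (x * (1 - q) / 9) \<le> \<eta> * (1 / (1 + x) - q / (q + x))"
      unfolding d using \<eta> by (intro mult_left_mono) auto
    moreover have "\<kappa> / q * x = \<eta> * (x * (1 - q) / 9)" using q by (simp add: \<kappa>)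
    ultimately have "\<kappa> / q * x \<le> \<eta> * (1 / (1 + x)) - \<eta> * (q / (q + x))"
      by (simp only: right_diff_distrib)
    then have "1 + \<eta> * (q / (q + x)) + \<kappa> / q * x \<le> 1 + \<eta> / (1 + x)" by simp
    moreover have "(1 + \<eta> * (q / (q + x)) + \<kappa> / q * x) * s\<^sup>2 \<le> (1 + \<eta> * (q / (q + x)) + \<kappa> / q * x) * 1"
      using wp s2 by (intro mult_left_mono) auto
    ultimately show ?thesis unfolding w w' by (simp add: x_def)
  next
    case False
    then have s1: "s \<le> 1 / 2"
      using x(2) s mult_right_mono[of 2 x s] by simp
    then have s2: "s\<^sup>2 \<le> 1/4" using s power_mono[of s "1/2" 2] by (simp add: power2_eq_square)
    have "\<eta> * (q / (q + x)) \<le> 1 * 1" using \<eta> q x q1 by (intro mult_mono) auto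
    then have "(1 + \<eta> * (q / (q + x))) * s\<^sup>2 \<le> 2 * (1/4)" using s2 \<eta> q x by (intro mult_mono) auto
    moreover have "\<kappa> / q * ((x * s) * s) \<le> 1 * (1 * (1/2))"
      using kq k0 q x s s1 by (intro mult_mono) auto
    then have "\<kappa> / q * x * s\<^sup>2 \<le> 1/2" by (simp only: power2_eq_square mult.assoc mult_1)
    ultimately have "(1 + \<eta> * (q / (q + x)) + \<kappa> / q * x) * s\<^sup>2 \<le> 1"
      by (simp only: distrib_right[of _ "\<kappa> / q * x"])
    moreover have "\<eta> / (1 + x) \<ge> 0" using \<eta> x by simp
    ultimately show ?thesis unfolding w w' by (simp add: x_def)
  qed
qed

section \<open>Energy balance of a single Newton step\<close>

definition filter_step :: "(real \<Rightarrow> real) \<Rightarrow> real \<Rightarrow> real \<Rightarrow> bool" where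
  "filter_step g a b \<longleftrightarrow> a > 0 \<and> b \<ge> 1 \<and> continuous_on {0..1} g \<and>
     (\<forall>l\<in>{0..1}. 0 \<le> 1 - l * g l \<and> 1 - l * g l \<le> 1 \<and> l * (1 - l * g l) \<le> a \<and> 0 \<le> g l \<and> g l \<le> b / a)"

lemma filter_stepD:
  assumes "filter_step g a b"
  shows "a > 0" "b \<ge> 1" "continuous_on {0..1} g" "continuous_on {0..1} (\<lambda>l. 1 - l * g l)"
    and "\<And>l. l \<in> {0..1} \<Longrightarrow> 0 \<le> 1 - l * g l" "\<And>l. l \<in> {0..1} \<Longrightarrow> 1 - l * g l \<le> 1"
      "\<And>l. l \<in> {0..1} \<Longrightarrow> l * (1 - l * g l) \<le> a" "\<And>l. l \<in> {0..1} \<Longrightarrow> 0 \<le> g l"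
      "\<And>l. l \<in> {0..1} \<Longrightarrow> g l \<le> b / a"
      "\<And>l. l \<in> {0..1} \<Longrightarrow> 0 \<le> l * g l" "\<And>l. l \<in> {0..1} \<Longrightarrow> l * g l \<le> 1"
  using assms unfolding filter_step_def by (auto intro!: continuous_intros)

text \<open>The increment does not involve the base point, so the same formula updates iterates and
  errors; it is applied to errors, with \<open>f\<close> the nonlinear residual.\<close>

definition newton_step ::
  "(real \<Rightarrow> real) \<Rightarrow> ('a::{real_inner,complete_space} \<Rightarrow>\<^sub>L 'b::{real_inner,complete_space}) \<Rightarrow> 'a \<Rightarrow> 'b \<Rightarrow> 'a" where
  "newton_step g S x f = x - op_fun g (gram S) (adj S f)"

context
  fixes S :: "'a::{real_inner,complete_space} \<Rightarrow>\<^sub>L 'b::{real_inner,complete_space}" and g a b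
  assumes S: "norm S \<le> 1" and g: "filter_step g a b"
begin

lemma newton_step_split:
  "newton_step g S x (S x + u) = op_fun (\<lambda>l. 1 - l * g l) (gram S) x - op_fun g (gram S) (adj S u)"
proof -
  note P = pos_contr_gram[OF S] and c = filter_stepD(3)[OF g]
  have "op_fun (\<lambda>l. 1 - l * g l) (gram S) x = x - op_fun (\<lambda>l. g l * l) (gram S) x"
    using op_fun_diff[OF P continuous_on_const continuous_on_mult[OF continuous_on_id c], of 1 x]
    by (simp add: op_fun_const[OF P] mult.commute)
  also have "op_fun (\<lambda>l. g l * l) (gram S) x = op_fun g (gram S) (gram S x)"
    by (rule op_fun_gram_mult_ident[OF S c])
  finally show ?thesis by (simp add: newton_step_def blinfun.add_right)
qed

lemma newton_step_residual:
  "f + S (newton_step g S x f - x) = op_fun (\<lambda>l. 1 - l * g l) (gram (adj S)) f"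
proof -
  note S' = norm_adj_le_1[OF S] note P = pos_contr_gram[OF S'] and c = filter_stepD(3)[OF g]
  have "op_fun (\<lambda>l. 1 - l * g l) (gram (adj S)) f = f - op_fun (\<lambda>l. g l * l) (gram (adj S)) f"
    using op_fun_diff[OF P continuous_on_const continuous_on_mult[OF continuous_on_id c], of 1 f]
    by (simp add: op_fun_const[OF P] mult.commute)
  also have "op_fun (\<lambda>l. g l * l) (gram (adj S)) f = op_fun g (gram (adj S)) (S (adj S f))"
    using op_fun_gram_mult_ident[OF S' c] by (simp add: adj_adj)
  also have "\<dots> = S (op_fun g (gram S) (adj S f))"
    using op_fun_gram_left[OF S c, of "adj S f"] by simp
  finally show ?thesis by (simp add: newton_step_def blinfun.minus_right)
qed

lemma norm_newton_step_residual: "norm (S (newton_step g S x f - x)) \<le> norm f"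
proof -
  note S' = norm_adj_le_1[OF S] note P = pos_contr_gram[OF S'] and c = filter_stepD(3)[OF g]
  have "S (newton_step g S x f - x) = - op_fun (\<lambda>l. g l * l) (gram (adj S)) f"
    using op_fun_gram_left[OF S c, of "adj S f"] op_fun_gram_mult_ident[OF S' c, of f]
    by (simp add: adj_adj newton_step_def blinfun.minus_right)
  moreover have "norm (op_fun (\<lambda>l. g l * l) (gram (adj S)) f) \<le> 1 * norm f"
    using filter_stepD(10,11)[OF g] c
    by (intro norm_op_fun_le[OF P] continuous_intros) (auto simp: mult.commute)
  ultimately show ?thesis by simp
qed

text \<open>The defect \<open>u\<close> is multiplied by a function with values in [-1,0], the
  residual filter minus 1, so it costs |u| and not 2 |u|.\<close>

lemma norm_newton_step_le: "norm (S (newton_step g S x (S x + u))) \<le> norm (S x) + norm u"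
proof -
  have "S (newton_step g S x (S x + u)) = S x + S (newton_step g S x (S x + u) - x)"
    by (simp add: blinfun.diff_right)
  also have "\<dots> = op_fun (\<lambda>l. 1 - l * g l) (gram (adj S)) (S x + u) - u"
    using newton_step_residual[of "S x + u" x] by (simp add: algebra_simps)
  also have "\<dots> = S (op_fun (\<lambda>l. 1 - l * g l) (gram S) x) + (op_fun (\<lambda>l. 1 - l * g l) (gram (adj S)) u - u)"
    by (simp add: blinfun.add_right op_fun_gram_left[OF S filter_stepD(4)[OF g]])
  also have "op_fun (\<lambda>l. 1 - l * g l) (gram (adj S)) u - u = S (newton_step g S x u - x)"
    using newton_step_residual[of u x] by (simp add: algebra_simps)
  finally have "norm (S (newton_step g S x (S x + u)))
      \<le> norm (S (op_fun (\<lambda>l. 1 - l * g l) (gram S) x)) + norm (S (newton_step g S x u - x))"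
    by (metis norm_triangle_ineq)
  moreover have "norm (S (op_fun (\<lambda>l. 1 - l * g l) (gram S) x)) \<le> 1 * norm (S x)"
    using filter_stepD(5,6)[OF g]
    by (intro norm_gram_op_fun_le[OF S filter_stepD(4)[OF g]]) auto
  ultimately show ?thesis using norm_newton_step_residual[of x u] by simp
qed

text \<open>The new error is p - v, with \<open>p\<close> the damped old error and \<open>v\<close>
  the propagated defect. The square in \<open>p\<close> is \<open>energy_weight_decrease\<close>.
  With w \<le> 2 + l / a, the cross term has symbol g w r \<le> 3 b / a, and the square in
  \<open>v\<close>, written as a form in \<open>u\<close>, has symbol l g^2 w \<le> (2 b + 1) /
  a.\<close>

lemma energy_newton_step:
  assumes q: "0 < q" "q < 1" and \<eta>: "0 < \<eta>" "\<eta> \<le> 1" and \<kappa>: "\<kappa> = \<eta> * q * (1 - q) / 9"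
  shows "energy \<eta> \<kappa> (q * a) S (newton_step g S x (S x + u)) \<le>
    energy \<eta> \<kappa> a S x - \<kappa> / a * (norm (S x))\<^sup>2 + 6 * b / a * (norm (S x) * norm u) + (2 * b + 1) / a * (norm u)\<^sup>2"
proof -
  note S' = norm_adj_le_1[OF S]
  note P = pos_contr_gram[OF S] and P' = pos_contr_gram[OF S'] and g' = filter_stepD[OF g]
  have qa: "q * a > 0" using q g' by simp
  define w where "w = energy_weight \<eta> \<kappa> (q * a)"
  define r where "r = (\<lambda>l. 1 - l * g l)"
  have cw: "continuous_on {0..1} w" unfolding w_def by (rule continuous_on_energy_weight[OF qa])
  have cr: "continuous_on {0..1} r" unfolding r_def by (rule g')
  note cg = g'(3)
  have k0: "0 \<le> \<kappa>" using \<eta> q by (simp add: \<kappa>)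
  have kq: "\<kappa> \<le> q"
  proof -
    have "\<eta> * (1 - q) \<le> 1 * 1" using \<eta> q by (intro mult_mono) auto
    then have "q * (\<eta> * (1 - q)) \<le> q * 9" using q by (intro mult_left_mono) auto
    then show ?thesis by (simp add: \<kappa> mult_ac)
  qed
  have w0: "0 \<le> w l" and w1: "w l \<le> 2 + l / a" if "l \<in> {0..1}" for l
  proof -
    have 0: "0 \<le> q * a / (q * a + l)" "q * a / (q * a + l) \<le> 1" using that qa by auto
    show "0 \<le> w l" using 0 \<eta> k0 qa that by (simp add: w_def energy_weight_def)
    have "\<eta> * (q * a / (q * a + l)) \<le> 1 * 1" using 0 \<eta> by (intro mult_mono) auto
    moreover have "\<kappa> / (q * a) * l \<le> q / (q * a) * l"
      using kq qa that by (intro mult_right_mono divide_right_mono) auto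
    ultimately show "w l \<le> 2 + l / a" using q by (simp add: w_def energy_weight_def)
  qed
  define p where "p = op_fun r (gram S) x"
  define v where "v = op_fun g (gram S) (adj S u)"
  have step: "newton_step g S x (S x + u) = p - v" by (simp add: newton_step_split p_def v_def r_def)
  have E: "energy \<eta> \<kappa> (q * a) S (p - v) =
     inner (op_fun w (gram S) p) p - 2 * inner (op_fun w (gram S) p) v + inner (op_fun w (gram S) v) v"
    unfolding energy_eq[OF S qa] w_def[symmetric]
    using inner_op_fun_commute[OF P cw, of v p]
    by (simp add: blinfun.diff_right inner_diff_left inner_diff_right inner_commute algebra_simps)
  have "inner (op_fun w (gram S) p) p = inner (op_fun (\<lambda>l. r l * (w l * r l)) (gram S) x) x"
    unfolding p_def op_fun_mult[OF P cr continuous_on_mult[OF cw cr]] op_fun_mult[OF P cw cr]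
    by (simp add: inner_op_fun_commute[OF P cr])
  also have "\<dots> \<le> inner (op_fun (\<lambda>l. energy_weight \<eta> \<kappa> a l - \<kappa> / a * l) (gram S) x) x"
  proof (rule op_fun_mono[OF P])
    show "continuous_on {0..1} (\<lambda>l. r l * (w l * r l))" by (intro continuous_intros cw cr)
    show "continuous_on {0..1} (\<lambda>l. energy_weight \<eta> \<kappa> a l - \<kappa> / a * l)"
      by (intro continuous_intros continuous_on_energy_weight g')
    fix l :: real assume l: "l \<in> {0..1}"
    have "w l * (r l)\<^sup>2 \<le> energy_weight \<eta> \<kappa> a l - \<kappa> / a * l"
      unfolding w_def r_def using l g'(5-7)[OF l]
      by (intro energy_weight_decrease g'(1) q \<eta> \<kappa>) auto
    then show "r l * (w l * r l) \<le> energy_weight \<eta> \<kappa> a l - \<kappa> / a * l"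
      by (simp add: power2_eq_square mult_ac)
  qed
  also have "\<dots> = energy \<eta> \<kappa> a S x - \<kappa> / a * (norm (S x))\<^sup>2"
  proof -
    have "op_fun (\<lambda>l. energy_weight \<eta> \<kappa> a l - \<kappa> / a * l) (gram S) x
        = op_fun (energy_weight \<eta> \<kappa> a) (gram S) x - (\<kappa> / a) *\<^sub>R gram S x"
      by (simp only: op_fun_diff[OF P continuous_on_energy_weight[OF g'(1)] continuous_on_mult[OF continuous_on_const continuous_on_id]]
          op_fun_scale[OF P continuous_on_id] op_fun_ident[OF P])
    then show ?thesis
      by (simp add: energy_eq[OF S g'(1)] inner_diff_left inner_adj_left power2_norm_eq_inner)
  qed
  finally have t1: "inner (op_fun w (gram S) p) p \<le> energy \<eta> \<kappa> a S x - \<kappa> / a * (norm (S x))\<^sup>2" .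
  have "inner (op_fun w (gram S) p) v = inner (op_fun (\<lambda>l. g l * (w l * r l)) (gram S) x) (adj S u)"
    unfolding p_def v_def op_fun_mult[OF P cg continuous_on_mult[OF cw cr]] op_fun_mult[OF P cw cr]
    by (simp add: inner_op_fun_commute[OF P cg])
  also have "\<dots> = inner (S (op_fun (\<lambda>l. g l * (w l * r l)) (gram S) x)) u" by (rule inner_adj_right)
  finally have eq2: "inner (op_fun w (gram S) p) v = inner (S (op_fun (\<lambda>l. g l * (w l * r l)) (gram S) x)) u" .
  have "norm (S (op_fun (\<lambda>l. g l * (w l * r l)) (gram S) x)) \<le> (3 * b / a) * norm (S x)"
  proof (rule norm_gram_op_fun_le[OF S])
    show "continuous_on {0..1} (\<lambda>l. g l * (w l * r l))" by (intro continuous_intros cg cw cr)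
    show "0 \<le> 3 * b / a" using g' by simp
    fix l :: real assume l: "l \<in> {0..1}"
    have r: "0 \<le> r l" "r l \<le> 1" "l * r l \<le> a" using g'(5-7)[OF l] by (simp_all add: r_def)
    have "w l * r l \<le> (2 + l / a) * r l" using w1[OF l] r by (intro mult_right_mono) auto
    also have "\<dots> = 2 * r l + l * r l / a" by (simp add: algebra_simps)
    also have "\<dots> \<le> 2 * 1 + 1" using r g'(1) by (intro add_mono mult_left_mono) auto
    finally have "w l * r l \<le> 3" by simp
    then have "g l * (w l * r l) \<le> b / a * 3" using g'(8,9)[OF l] w0[OF l] r by (intro mult_mono) auto
    then show "\<bar>g l * (w l * r l)\<bar> \<le> 3 * b / a" using g'(8)[OF l] w0[OF l] r by (simp add: mult.commute)
  qed
  then have "\<bar>inner (op_fun w (gram S) p) v\<bar> \<le> ((3 * b / a) * norm (S x)) * norm u"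
    unfolding eq2 using Cauchy_Schwarz_ineq2 by (meson mult_right_mono norm_ge_zero order_trans)
  then have t2: "- 2 * inner (op_fun w (gram S) p) v \<le> 6 * b / a * (norm (S x) * norm u)"
    by (simp add: abs_le_iff)
  have "inner (op_fun w (gram S) v) v = inner (op_fun (\<lambda>l. g l * (w l * g l)) (gram S) (adj S u)) (adj S u)"
    unfolding v_def op_fun_mult[OF P cg continuous_on_mult[OF cw cg]] op_fun_mult[OF P cw cg]
    by (simp add: inner_op_fun_commute[OF P cg])
  also have "\<dots> = inner (S (op_fun (\<lambda>l. g l * (w l * g l)) (gram S) (adj S u))) u" by (rule inner_adj_right)
  also have "S (op_fun (\<lambda>l. g l * (w l * g l)) (gram S) (adj S u))
      = op_fun (\<lambda>l. g l * (w l * g l) * l) (gram (adj S)) u"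
    using op_fun_gram_left[OF S continuous_on_mult[OF cg continuous_on_mult[OF cw cg]], of "adj S u"]
      op_fun_gram_mult_ident[OF S' continuous_on_mult[OF cg continuous_on_mult[OF cw cg]], of u] by (simp add: adj_adj)
  also have "inner (op_fun (\<lambda>l. g l * (w l * g l) * l) (gram (adj S)) u) u
      \<le> inner (op_fun (\<lambda>_. (2 * b + 1) / a) (gram (adj S)) u) u"
  proof (rule op_fun_mono[OF P'])
    show "continuous_on {0..1} (\<lambda>l. g l * (w l * g l) * l)" by (intro continuous_intros cg cw)
    fix l :: real assume l: "l \<in> {0..1}"
    have lg: "0 \<le> l * g l" "l * g l \<le> 1" using g'(10,11)[OF l] .
    have "w l * g l \<le> (2 + l / a) * g l" using w1[OF l] g'(8)[OF l] by (intro mult_right_mono) auto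
    also have "\<dots> = 2 * g l + l * g l / a" by (simp add: algebra_simps)
    also have "\<dots> \<le> 2 * (b / a) + 1 / a" using g'(9)[OF l] lg g'(1) by (intro add_mono mult_left_mono divide_right_mono) auto
    also have "\<dots> = (2 * b + 1) / a" by (simp add: add_divide_distrib)
    finally have "(l * g l) * (w l * g l) \<le> 1 * ((2 * b + 1) / a)"
      using lg w0[OF l] g'(8)[OF l] by (intro mult_mono) auto
    then show "g l * (w l * g l) * l \<le> (2 * b + 1) / a" by (simp add: mult_ac)
  qed simp
  also have "\<dots> = (2 * b + 1) / a * (norm u)\<^sup>2"
    by (simp add: op_fun_const[OF P'] power2_norm_eq_inner)
  finally have t3: "inner (op_fun w (gram S) v) v \<le> (2 * b + 1) / a * (norm u)\<^sup>2" .
  show ?thesis unfolding step E using t1 t2 t3 by linarith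
qed

end

text \<open>The energy passes from \<open>T\<close> to \<open>S\<close>, makes the step, and
  returns. In units of |S x|^2 / a the decrease \<kappa> is spent as \<kappa>/4 on Young's
  inequality, \<kappa>/4 on all terms with \<open>e\<close>, and \<kappa>/2 on the result, since |T
  x| \<le> 2 |S x|. The factor of \<open>e\<close> collects 6 b (cross term), 4 b + 2 (square of
  \<open>u\<close>), 28 and 42 / q (the two exchanges of operators).\<close>

lemma energy_newton_step_perturbed:
  fixes S T :: "'a::{real_inner,complete_space} \<Rightarrow>\<^sub>L 'b::{real_inner,complete_space}"
  assumes T: "norm T \<le> 1" and S: "norm S \<le> 1" and g: "filter_step g a b"
    and q: "0 < q" "q < 1" and \<eta>: "0 < \<eta>" "\<eta> \<le> 1" and \<kappa>: "\<kappa> = \<eta> * q * (1 - q) / 9"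
    and e: "0 \<le> e" "e \<le> 1" "e * (10 * b + 30 + 42 / q) \<le> \<kappa> / 4"
    and ST: "\<And>x. norm (S x - T x) \<le> e * norm (T x)" and TS: "\<And>x. norm (T x - S x) \<le> e * norm (S x)"
    and u: "norm u \<le> e * norm (S x) + \<delta>" and \<delta>: "\<delta> \<ge> 0"
  shows "energy \<eta> \<kappa> (q * a) T (newton_step g S x (S x + u)) \<le>
     energy \<eta> \<kappa> a T x - \<kappa> / 8 * ((norm (T x))\<^sup>2 / a) + (36 * b\<^sup>2 / \<kappa> + 4 * b + 2 + 28 / q) * (\<delta>\<^sup>2 / a)"
proof -
  define x' where "x' = newton_step g S x (S x + u)"
  define X where "X = norm (S x)"
  define v where "v = norm u"
  note g' = filter_stepD[OF g]
  have a: "a > 0" and b: "b \<ge> 1" using g' by auto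
  have qa: "q * a > 0" using q a by simp
  have k0: "0 < \<kappa>" using \<eta> q by (simp add: \<kappa>)
  have k1: "\<kappa> \<le> 1"
  proof -
    have "\<eta> * q * (1 - q) \<le> 1 * 1 * 1" using \<eta> q by (intro mult_mono) auto
    then show ?thesis by (simp add: \<kappa>)
  qed
  have X0: "X \<ge> 0" "v \<ge> 0" by (auto simp: X_def v_def)
  have vX: "v \<le> e * X + \<delta>" using u by (simp add: X_def v_def)
  have eX: "e * X \<le> X" using e X0 mult_right_mono[of e 1 X] by simp
  have v2: "v\<^sup>2 \<le> 2 * e * X\<^sup>2 + 2 * \<delta>\<^sup>2"
  proof -
    have "v\<^sup>2 \<le> (e * X + \<delta>)\<^sup>2" using vX X0 by (intro power_mono)
    also have "\<dots> \<le> 2 * (e * X)\<^sup>2 + 2 * \<delta>\<^sup>2"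
      using sum_squares_bound[of "e * X" \<delta>] by (simp add: power2_sum)
    also have "(e * X)\<^sup>2 \<le> e * X\<^sup>2"
      using e mult_right_mono[of "e * e" e "X\<^sup>2"] mult_left_le_one_le[of e e]
      by (simp add: power2_eq_square mult_ac)
    finally show ?thesis by simp
  qed
  have d1: "energy \<eta> \<kappa> (q * a) T x' \<le> energy \<eta> \<kappa> (q * a) S x' + 7 * e / (q * a) * (norm (S x'))\<^sup>2"
    using \<eta> k0 k1 e by (intro energy_diff_le S T qa TS ST) auto
  have d3: "energy \<eta> \<kappa> a S x \<le> energy \<eta> \<kappa> a T x + 7 * e / a * (norm (T x))\<^sup>2"
    using \<eta> k0 k1 e by (intro energy_diff_le S T a TS ST) auto
  have d2: "energy \<eta> \<kappa> (q * a) S x' \<le> energy \<eta> \<kappa> a S x - \<kappa> / a * X\<^sup>2 + 6 * b / a * (X * v) + (2 * b + 1) / a * v\<^sup>2"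
    unfolding x'_def X_def v_def by (rule energy_newton_step[OF S g q \<eta> \<kappa>])
  have x'X: "(norm (S x'))\<^sup>2 \<le> 6 * X\<^sup>2 + 4 * \<delta>\<^sup>2"
  proof -
    have "(norm (S x'))\<^sup>2 \<le> (X + v)\<^sup>2"
      unfolding x'_def X_def v_def by (intro power_mono norm_newton_step_le[OF S g]) simp
    also have "\<dots> \<le> 2 * X\<^sup>2 + 2 * v\<^sup>2" using sum_squares_bound[of X v] by (simp add: power2_sum)
    also have "v\<^sup>2 \<le> 2 * X\<^sup>2 + 2 * \<delta>\<^sup>2"
      using v2 e mult_right_mono[of e 1 "X\<^sup>2"] by simp
    finally show ?thesis by simp
  qed
  have TX: "norm (T x) \<le> 2 * X"
    using norm_triangle_ineq2[of "T x" "S x"] TS[of x] eX unfolding X_def by simp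
  then have TX2: "(norm (T x))\<^sup>2 \<le> 4 * X\<^sup>2" using power_mono[of "norm (T x)" "2 * X" 2] by (simp add: power_mult_distrib)
  have Xv: "6 * b * (X * v) \<le> 6 * b * e * X\<^sup>2 + \<kappa> / 4 * X\<^sup>2 + 36 * b\<^sup>2 / \<kappa> * \<delta>\<^sup>2"
  proof -
    \<comment> \<open>Young's inequality, weighted so that exactly \<kappa>/4 of the decrease is
      used.\<close>
    have "0 \<le> (\<kappa> * X - 12 * b * \<delta>)\<^sup>2 / (4 * \<kappa>)" using k0 by simp
    also have "\<dots> = \<kappa> / 4 * X\<^sup>2 + 36 * b\<^sup>2 / \<kappa> * \<delta>\<^sup>2 - 6 * b * (X * \<delta>)"
      using k0 by (simp add: power2_eq_square field_simps)
    finally have "6 * b * (X * \<delta>) \<le> \<kappa> / 4 * X\<^sup>2 + 36 * b\<^sup>2 / \<kappa> * \<delta>\<^sup>2" by simp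
    moreover have "6 * b * (X * v) \<le> 6 * b * (X * (e * X + \<delta>))"
      using vX X0 b by (intro mult_left_mono) auto
    ultimately show ?thesis by (simp add: power2_eq_square algebra_simps)
  qed
  have bv: "(2 * b + 1) * v\<^sup>2 \<le> (2 * b + 1) * (2 * e * X\<^sup>2 + 2 * \<delta>\<^sup>2)"
    using v2 b by (intro mult_left_mono) auto
  have ex': "7 * e / q * (norm (S x'))\<^sup>2 \<le> 42 * e / q * X\<^sup>2 + 28 / q * \<delta>\<^sup>2"
  proof -
    have "7 * e / q * (norm (S x'))\<^sup>2 \<le> 7 * e / q * (6 * X\<^sup>2 + 4 * \<delta>\<^sup>2)"
      using x'X e q by (intro mult_left_mono) auto
    moreover have "28 * e / q * \<delta>\<^sup>2 \<le> 28 / q * \<delta>\<^sup>2"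
      using e q by (intro mult_right_mono divide_right_mono) auto
    ultimately show ?thesis by (simp add: algebra_simps)
  qed
  have eT: "7 * e * (norm (T x))\<^sup>2 \<le> 28 * e * X\<^sup>2"
    using mult_left_mono[OF TX2, of "7 * e"] e by simp
  have coef: "e * (10 * b + 30 + 42 / q) * X\<^sup>2 \<le> \<kappa> / 4 * X\<^sup>2"
    using e by (intro mult_right_mono) auto
  have kT: "\<kappa> / 8 * (norm (T x))\<^sup>2 \<le> \<kappa> / 2 * X\<^sup>2"
    using mult_left_mono[OF TX2, of "\<kappa> / 8"] k0 by simp
  have main: "7 * e / q * (norm (S x'))\<^sup>2 - \<kappa> * X\<^sup>2 + 6 * b * (X * v) + (2 * b + 1) * v\<^sup>2 + 7 * e * (norm (T x))\<^sup>2
      \<le> - (\<kappa> / 8 * (norm (T x))\<^sup>2) + (36 * b\<^sup>2 / \<kappa> + 4 * b + 2 + 28 / q) * \<delta>\<^sup>2"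
  proof -
    have e1: "e * (10 * b + 30 + 42 / q) * X\<^sup>2
        = 6 * b * e * X\<^sup>2 + (4 * b + 2) * e * X\<^sup>2 + 28 * e * X\<^sup>2 + 42 * e / q * X\<^sup>2"
      by (simp add: algebra_simps)
    have e2: "(2 * b + 1) * (2 * e * X\<^sup>2 + 2 * \<delta>\<^sup>2) = (4 * b + 2) * e * X\<^sup>2 + (4 * b + 2) * \<delta>\<^sup>2"
      by (simp add: algebra_simps)
    have e3: "(36 * b\<^sup>2 / \<kappa> + 4 * b + 2 + 28 / q) * \<delta>\<^sup>2
        = 36 * b\<^sup>2 / \<kappa> * \<delta>\<^sup>2 + (4 * b + 2) * \<delta>\<^sup>2 + 28 / q * \<delta>\<^sup>2"
      by (simp add: algebra_simps)
    have arith: "x1 - K + x2 + x3 + x4 \<le> - kt + R"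
      if "x2 \<le> b1 + k4 + R1" "x3 \<le> P" "P = b2 + R2" "x1 \<le> b4 + R3" "x4 \<le> b3"
        "Q \<le> k4" "kt \<le> k2" "Q = b1 + b2 + b3 + b4" "R = R1 + R2 + R3" "k4 = K / 4" "k2 = K / 2" "K \<ge> 0"
      for x1 x2 x3 x4 K kt R b1 b2 b3 b4 k4 k2 R1 R2 R3 P Q :: real
      using that by linarith
    show ?thesis
      by (rule arith[OF Xv bv e2 ex' eT coef kT e1 e3]) (use k0 X0 in auto)
  qed
  have fin: "7 * e / (q * a) * (norm (S x'))\<^sup>2 - \<kappa> / a * X\<^sup>2 + 6 * b / a * (X * v) + (2 * b + 1) / a * v\<^sup>2 + 7 * e / a * (norm (T x))\<^sup>2
      \<le> - (\<kappa> / 8 * ((norm (T x))\<^sup>2 / a)) + (36 * b\<^sup>2 / \<kappa> + 4 * b + 2 + 28 / q) * (\<delta>\<^sup>2 / a)"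
  proof -
    have scale: "(x1 - K + x2 + x3 + x4) / a \<le> (- kt + R) / a"
      if "x1 - K + x2 + x3 + x4 \<le> - kt + R" for x1 x2 x3 x4 K kt R :: real
      using that a by (intro divide_right_mono) auto
    show ?thesis
      using scale[OF main] by (simp add: add_divide_distrib diff_divide_distrib distrib_right)
  qed
  have arith: "E1 \<le> E4 - s + t"
    if "E1 \<le> E2 + p" "E2 \<le> E3 - k + l + m" "E3 \<le> E4 + n" "p - k + l + m + n \<le> - s + t"
    for E1 E2 E3 E4 p k l m n s t :: real using that by linarith
  show ?thesis
    unfolding x'_def[symmetric] by (rule arith[OF d1 d2 d3 fin])
qed

section \<open>Estimates along the iteration\<close>

lemma adj_compose: "adj (R o\<^sub>L T) y = adj T (adj R y)"
  by (intro vector_eq_ldot[THEN iffD1]) (simp add: inner_adj_right)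

locale nonlinear_problem =
  fixes F :: "'a::{real_inner,complete_space} \<Rightarrow> 'b::{real_inner,complete_space}"
    and F' :: "'a \<Rightarrow> 'a \<Rightarrow>\<^sub>L 'b" and xdag :: 'a and \<rho> K0 :: real
  assumes deriv: "\<And>x. x \<in> ball xdag \<rho> \<Longrightarrow> (F has_derivative F' x) (at x)"
    and rho: "\<rho> > 0" and K0: "K0 \<ge> 0"
    and factor: "\<And>x z. x \<in> ball xdag \<rho> \<Longrightarrow> z \<in> ball xdag \<rho> \<Longrightarrow>
        \<exists>R. F' x = R o\<^sub>L F' z \<and> norm (id_blinfun - R) \<le> K0 * norm (x - z)"
    and deriv_le_1: "\<And>x. x \<in> ball xdag \<rho> \<Longrightarrow> norm (F' x) \<le> 1"
begin

text \<open>The bound is relative to the image \<open>F' z h\<close>; a mere Lipschitz bound in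
  \<open>h\<close> could not be absorbed by the decrease of the energy.\<close>

lemma deriv_diff:
  assumes "x \<in> ball xdag \<rho>" "z \<in> ball xdag \<rho>"
  shows "norm (F' x h - F' z h) \<le> K0 * norm (x - z) * norm (F' z h)"
proof -
  obtain R where R: "F' x = R o\<^sub>L F' z" "norm (id_blinfun - R) \<le> K0 * norm (x - z)"
    using factor[OF assms] by blast
  have "norm (F' x h - F' z h) = norm ((id_blinfun - R) (F' z h))"
    by (simp add: R(1) blinfun.diff_left norm_minus_commute)
  also have "\<dots> \<le> norm (id_blinfun - R) * norm (F' z h)" by (rule norm_blinfun)
  also have "\<dots> \<le> K0 * norm (x - z) * norm (F' z h)" using R by (intro mult_right_mono) auto
  finally show ?thesis .
qed

lemma taylor:
  assumes x: "x \<in> ball xdag \<rho>" and z: "z \<in> ball xdag \<rho>"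
  shows "norm (F z - F x - F' x (z - x)) \<le> K0 * norm (z - x) * norm (F' x (z - x))"
proof -
  define h where "h = z - x"
  define B where "B = K0 * norm h * norm (F' x h)"
  \<comment> \<open>With the linear part subtracted, the derivative along the segment is a
    difference of derivatives of \<open>F\<close>, to which \<open>deriv_diff\<close>
    applies.\<close>
  define G where "G = (\<lambda>t::real. F (x + t *\<^sub>R h) - t *\<^sub>R F' x h)"
  define G' where "G' = (\<lambda>t s::real. s *\<^sub>R (F' (x + t *\<^sub>R h) h - F' x h))"
  have inb: "x + t *\<^sub>R h \<in> ball xdag \<rho>" if "t \<in> {0..1}" for t
  proof -
    have "x + t *\<^sub>R h = (1 - t) *\<^sub>R x + t *\<^sub>R z" by (simp add: h_def algebra_simps)
    then show ?thesis using convexD[OF convex_ball x z, of "1 - t" t] that by simp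
  qed
  have "norm (G 1 - G 0) \<le> B * norm (1 - 0 :: real)"
  proof (rule differentiable_bound[of "{0..1}" G G'])
    fix t :: real assume t: "t \<in> {0..1}"
    have "((\<lambda>t. F (x + t *\<^sub>R h)) has_derivative (\<lambda>s. F' (x + t *\<^sub>R h) (s *\<^sub>R h))) (at t within {0..1})"
    proof (rule has_derivative_compose[of "\<lambda>t. x + t *\<^sub>R h" "\<lambda>s. s *\<^sub>R h"])
      show "((\<lambda>t. x + t *\<^sub>R h) has_derivative (\<lambda>s. s *\<^sub>R h)) (at t within {0..1})"
        by (auto intro!: derivative_eq_intros)
    qed (rule deriv[OF inb[OF t]])
    then show "(G has_derivative G' t) (at t within {0..1})"
      unfolding G_def G'_def
      by (auto intro!: derivative_eq_intros simp: blinfun.scaleR_right algebra_simps)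
    show "onorm (G' t) \<le> B"
    proof (rule onorm_le)
      fix s :: real
      have "norm (F' (x + t *\<^sub>R h) h - F' x h) \<le> K0 * norm (x + t *\<^sub>R h - x) * norm (F' x h)"
        by (rule deriv_diff[OF inb[OF t] x])
      also have "\<dots> \<le> K0 * norm h * norm (F' x h)"
        using t K0 mult_right_mono[of t 1 "norm h"] by (intro mult_right_mono mult_left_mono) auto
      finally have "norm (F' (x + t *\<^sub>R h) h - F' x h) \<le> B" by (simp add: B_def)
      then have "\<bar>s\<bar> * norm (F' (x + t *\<^sub>R h) h - F' x h) \<le> \<bar>s\<bar> * B" by (intro mult_left_mono) auto
      then show "norm (G' t s) \<le> B * norm s" by (simp add: G'_def mult.commute)
    qed
  qed auto
  then show ?thesis by (simp add: G_def B_def h_def algebra_simps)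
qed

lemma xdag_in: "xdag \<in> ball xdag \<rho>" using rho by simp

end

section \<open>One run of the iteration with fixed data\<close>

locale newton_run = nonlinear_problem F F' xdag \<rho> K0
  for F :: "'a::{real_inner,complete_space} \<Rightarrow> 'b::{real_inner,complete_space}" and F' xdag \<rho> K0 +
  fixes g :: "nat \<Rightarrow> real \<Rightarrow> real" and \<alpha> :: "nat \<Rightarrow> real" and q b \<delta> :: real and yd :: 'b and xs :: "nat \<Rightarrow> 'a"
  assumes q: "0 < q" "q < 1" and filter: "\<And>n. filter_step (g n) (\<alpha> n) b"
    and \<alpha>_Suc: "\<And>n. \<alpha> (Suc n) = q * \<alpha> n"
    and xs_Suc: "\<And>n. xs (Suc n) =
        xs n - op_fun (g n) (gram (F' (xs n))) (adj (F' (xs n)) (F (xs n) - yd))"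
    and noise: "norm (yd - F xdag) \<le> \<delta>"
begin

abbreviation "T \<equiv> F' xdag"

definition err :: "nat \<Rightarrow> 'a" where "err n = xs n - xdag"

definition res :: "nat \<Rightarrow> 'b" where "res n = F (xs n) - yd"

text \<open>Membership in the ball keeps the nonlinearity condition available; the second bound is
  the dimensionless size of the nonlinearity, which enters every estimate.\<close>

definition close :: "real \<Rightarrow> nat \<Rightarrow> bool" where
  "close e n \<longleftrightarrow> xs n \<in> ball xdag \<rho> \<and> K0 * norm (err n) \<le> e"

lemma \<alpha>_pos: "\<alpha> n > 0" using filter_stepD(1)[OF filter] .

lemma b1: "b \<ge> 1" using filter_stepD(2)[OF filter] .

lemma \<delta>0: "\<delta> \<ge> 0" using noise norm_ge_zero order_trans by blast

lemma T1: "norm T \<le> 1" by (rule deriv_le_1[OF xdag_in])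

lemma \<alpha>_add: "\<alpha> (n + k) = q ^ k * \<alpha> n"
  by (induction k) (auto simp: \<alpha>_Suc)

lemma err_Suc: "err (Suc n) = newton_step (g n) (F' (xs n)) (err n) (res n)"
  by (simp add: err_def res_def newton_step_def xs_Suc)

lemma close_deriv:
  assumes "close e n"
  shows "norm (F' (xs n) h - T h) \<le> e * norm (T h)" "norm (T h - F' (xs n) h) \<le> e * norm (F' (xs n) h)"
proof -
  note c = assms[unfolded close_def err_def]
  have "norm (F' (xs n) h - T h) \<le> K0 * norm (xs n - xdag) * norm (T h)"
    using c by (intro deriv_diff xdag_in) auto
  also have "\<dots> \<le> e * norm (T h)" using c by (intro mult_right_mono) auto
  finally show "norm (F' (xs n) h - T h) \<le> e * norm (T h)" .
  have "norm (T h - F' (xs n) h) \<le> K0 * norm (xdag - xs n) * norm (F' (xs n) h)"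
    using c by (intro deriv_diff xdag_in) auto
  also have "\<dots> \<le> e * norm (F' (xs n) h)"
    using c by (intro mult_right_mono) (auto simp: norm_minus_commute)
  finally show "norm (T h - F' (xs n) h) \<le> e * norm (F' (xs n) h)" .
qed

lemma close_nonneg: "close e n \<Longrightarrow> 0 \<le> e"
  unfolding close_def using K0 by (meson mult_nonneg_nonneg norm_ge_zero order_trans)

text \<open>The expansion is about \<open>xs n\<close> and evaluated at \<open>xdag\<close>, so that
  its linear part is the operator which the step actually uses.\<close>

lemma res_split:
  assumes c: "close e n"
  obtains u where "res n = F' (xs n) (err n) + u" "norm u \<le> e * norm (F' (xs n) (err n)) + \<delta>"
proof (rule that[of "res n - F' (xs n) (err n)"])
  have eq: "res n - F' (xs n) (err n) = - (F xdag - F (xs n) - F' (xs n) (xdag - xs n)) + (F xdag - yd)"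
    by (simp add: res_def err_def blinfun.diff_right)
  have "norm (F xdag - F (xs n) - F' (xs n) (xdag - xs n)) \<le> K0 * norm (xdag - xs n) * norm (F' (xs n) (xdag - xs n))"
    using c by (intro taylor xdag_in) (simp add: close_def)
  also have "\<dots> = K0 * norm (err n) * norm (F' (xs n) (err n))"
    using norm_minus_cancel[of "F' (xs n) (err n)"]
    by (simp add: err_def norm_minus_commute flip: blinfun.minus_right)
  also have "\<dots> \<le> e * norm (F' (xs n) (err n))" using c by (intro mult_right_mono) (auto simp: close_def)
  finally have "norm (- (F xdag - F (xs n) - F' (xs n) (xdag - xs n))) \<le> e * norm (F' (xs n) (err n))"
    by (simp only: norm_minus_cancel)
  then show "norm (res n - F' (xs n) (err n)) \<le> e * norm (F' (xs n) (err n)) + \<delta>"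
    unfolding eq using noise by (intro norm_triangle_le add_mono) (auto simp: norm_minus_commute)
qed simp

text \<open>Here the expansion is about \<open>xdag\<close>, which relates the residual to the fixed
  operator \<open>T\<close>; the second bound later turns the stopping criterion into smallness of T
  e_n.\<close>

lemma res_bounds:
  assumes c: "close e n" and e: "e \<le> 1/2"
  shows "norm (res n) \<le> 2 * norm (T (err n)) + \<delta>" "norm (T (err n)) \<le> 2 * (norm (res n) + \<delta>)"
proof -
  have "norm (F (xs n) - F xdag - T (xs n - xdag)) \<le> K0 * norm (xs n - xdag) * norm (T (xs n - xdag))"
    using c by (intro taylor xdag_in) (simp add: close_def)
  also have "\<dots> \<le> 1/2 * norm (T (err n))"
    using c e unfolding close_def err_def by (intro mult_right_mono) auto
  finally have t: "norm (F (xs n) - F xdag - T (err n)) \<le> 1/2 * norm (T (err n))" by (simp add: err_def)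
  have n: "norm (F xdag - yd) \<le> \<delta>" using noise by (simp add: norm_minus_commute)
  have tri: "norm (u + v + w) \<le> norm u + norm v + norm w" for u v w :: 'b
    by (intro norm_triangle_le add_right_mono norm_triangle_ineq)
  have "res n = (F (xs n) - F xdag - T (err n)) + T (err n) + (F xdag - yd)" by (simp add: res_def)
  then have "norm (res n) \<le> norm (F (xs n) - F xdag - T (err n)) + norm (T (err n)) + norm (F xdag - yd)"
    using tri[of "F (xs n) - F xdag - T (err n)" "T (err n)" "F xdag - yd"] by simp
  then show "norm (res n) \<le> 2 * norm (T (err n)) + \<delta>" using t n norm_ge_zero[of "T (err n)"] by linarith
  have eq: "res n + - (F (xs n) - F xdag - T (err n)) + - (F xdag - yd) = T (err n)" by (simp add: res_def)
  from tri[of "res n" "- (F (xs n) - F xdag - T (err n))" "- (F xdag - yd)"]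
  have "norm (T (err n)) \<le> norm (res n) + norm (F (xs n) - F xdag - T (err n)) + norm (F xdag - yd)"
    unfolding eq norm_minus_cancel .
  moreover have "x \<le> 2 * (r + d)" if "x \<le> r + f + s" "2 * f \<le> x" "s \<le> d" for x r f s d :: real
    using that by argo
  moreover have "2 * norm (F (xs n) - F xdag - T (err n)) \<le> norm (T (err n))" using t by simp
  ultimately show "norm (T (err n)) \<le> 2 * (norm (res n) + \<delta>)" using n by blast
qed

lemma energy_Suc:
  assumes c: "close e n" and \<eta>: "0 < \<eta>" "\<eta> \<le> 1" and \<kappa>: "\<kappa> = \<eta> * q * (1 - q) / 9"
    and e: "e \<le> 1" "e * (10 * b + 30 + 42 / q) \<le> \<kappa> / 4"
  shows "energy \<eta> \<kappa> (\<alpha> (Suc n)) T (err (Suc n)) \<le>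
     energy \<eta> \<kappa> (\<alpha> n) T (err n) - \<kappa> / 8 * ((norm (T (err n)))\<^sup>2 / \<alpha> n)
       + (36 * b\<^sup>2 / \<kappa> + 4 * b + 2 + 28 / q) * (\<delta>\<^sup>2 / \<alpha> n)"
proof -
  obtain u where u: "res n = F' (xs n) (err n) + u" "norm u \<le> e * norm (F' (xs n) (err n)) + \<delta>"
    using res_split[OF c] .
  show ?thesis
    unfolding err_Suc u(1) \<alpha>_Suc
    using c deriv_le_1 by (intro energy_newton_step_perturbed[OF T1 _ filter q \<eta> \<kappa> close_nonneg[OF c] e close_deriv[OF c] u(2) \<delta>0])
      (auto simp: close_def)
qed

lemma norm_adj_factor_le:
  assumes "norm (id_blinfun - R) \<le> d"
  shows "norm (adj R y) \<le> (1 + d) * norm y"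
proof -
  have "adj R y = y - adj (id_blinfun - R) y"
    by (intro vector_eq_ldot[THEN iffD1]) (simp add: inner_adj_right inner_diff_right blinfun.diff_left inner_diff_left)
  then have "norm (adj R y) \<le> norm y + norm (adj (id_blinfun - R) y)" by (simp add: norm_triangle_ineq4)
  also have "norm (adj (id_blinfun - R) y) \<le> norm (id_blinfun - R) * norm y" by (rule norm_adj_apply_le)
  also have "\<dots> \<le> d * norm y" using assms by (intro mult_right_mono) auto
  finally show ?thesis by (simp add: algebra_simps)
qed

text \<open>From F'(x_n) = R T the adjoint of the derivative factors through \<open>adj T\<close>.
  Thus all increments lie in the range of one fixed operator, although the derivatives vary. The 2
  bounds |R| and \<open>b / \<alpha> n\<close> bounds the filter.\<close>

lemma err_Suc_range:
  assumes c: "close e n" and e: "e \<le> 1"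
  obtains w where "err (Suc n) - err n = adj T w" "norm w \<le> 2 * b / \<alpha> n * norm (res n)"
proof -
  note g = filter_stepD[OF filter[of n]]
  define S where "S = F' (xs n)"
  have S: "norm S \<le> 1" using c deriv_le_1 by (simp add: S_def close_def)
  obtain R where R: "S = R o\<^sub>L T" "norm (id_blinfun - R) \<le> K0 * norm (xs n - xdag)"
    using factor[OF _ xdag_in] c unfolding S_def close_def by blast
  have R1: "norm (id_blinfun - R) \<le> 1" using R(2) c e by (simp add: close_def err_def)
  define v where "v = op_fun (g n) (gram (adj S)) (res n)"
  have "err (Suc n) - err n = - op_fun (g n) (gram S) (adj S (res n))"
    by (simp add: err_Suc newton_step_def S_def)
  also have "\<dots> = - adj S v" unfolding v_def op_fun_gram_right[OF S g(3)] ..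
  also have "\<dots> = adj T (- adj R v)" by (simp add: R(1) adj_compose blinfun.minus_right)
  finally have 1: "err (Suc n) - err n = adj T (- adj R v)" .
  have "norm v \<le> b / \<alpha> n * norm (res n)"
    unfolding v_def using g(1,2,8,9)
    by (intro norm_op_fun_le[OF pos_contr_gram[OF norm_adj_le_1[OF S]] g(3)]) auto
  then have "norm (- adj R v) \<le> (1 + 1) * (b / \<alpha> n * norm (res n))"
    using norm_adj_factor_le[OF R1, of v] by simp
  then show thesis using 1 by (intro that[of "- adj R v"]) simp_all
qed

lemma err_range:
  assumes c: "\<And>j. j < n \<Longrightarrow> close e j" and e: "e \<le> 1"
  obtains w where "err n - err 0 = adj T w" "norm w \<le> (\<Sum>j<n. 2 * b / \<alpha> j * norm (res j))"
  using c
proof (induction n arbitrary: thesis)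
  case 0
  show ?case by (rule 0(1)[of 0]) auto
next
  case (Suc n)
  obtain w where w: "err n - err 0 = adj T w" "norm w \<le> (\<Sum>j<n. 2 * b / \<alpha> j * norm (res j))"
    using Suc.IH Suc.prems(2) by (metis less_SucI)
  obtain v where v: "err (Suc n) - err n = adj T v" "norm v \<le> 2 * b / \<alpha> n * norm (res n)"
    using err_Suc_range[OF Suc.prems(2) e] by blast
  show ?case
  proof (rule Suc.prems(1))
    show "err (Suc n) - err 0 = adj T (w + v)"
      using w v by (simp add: blinfun.add_right algebra_simps)
    show "norm (w + v) \<le> (\<Sum>j<Suc n. 2 * b / \<alpha> j * norm (res j))"
      using w v by (simp add: norm_triangle_le)
  qed
qed

text \<open>A source representation up to \<open>s\<close> of the initial error persists along the iteration and
  turns smallness of the linearized residual into smallness of the error.\<close>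

lemma err_sq_le:
  assumes c: "\<And>j. j < n \<Longrightarrow> close e j" and e: "e \<le> 1"
  shows "(norm (err n))\<^sup>2 \<le> norm (T (err n)) * (norm v + (\<Sum>j<n. 2 * b / \<alpha> j * norm (res j)))
      + norm (err n) * norm (err 0 - adj T v)"
proof -
  obtain w where w: "err n - err 0 = adj T w" "norm w \<le> (\<Sum>j<n. 2 * b / \<alpha> j * norm (res j))"
    using err_range[OF c e] by blast
  have "err n = adj T (v + w) + (err 0 - adj T v)" using w(1) by (simp add: blinfun.add_right algebra_simps)
  then have "(norm (err n))\<^sup>2 = inner (err n) (adj T (v + w) + (err 0 - adj T v))"
    by (simp add: power2_norm_eq_inner)
  also have "\<dots> = inner (T (err n)) (v + w) + inner (err n) (err 0 - adj T v)"
    by (simp add: inner_add_right inner_adj_right)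
  also have "\<dots> \<le> norm (T (err n)) * norm (v + w) + norm (err n) * norm (err 0 - adj T v)"
    by (intro add_mono norm_cauchy_schwarz)
  also have "norm (T (err n)) * norm (v + w) \<le> norm (T (err n)) * (norm v + (\<Sum>j<n. 2 * b / \<alpha> j * norm (res j)))"
    using w(2) by (intro mult_left_mono norm_triangle_le) auto
  finally show ?thesis by simp
qed

lemma close_diff:
  assumes "close e n" "close e m"
  shows "K0 * norm (xs n - xs m) \<le> 2 * e"
proof -
  have "norm (xs n - xs m) \<le> norm (err n) + norm (err m)"
    using norm_triangle_ineq4[of "err n" "err m"] by (simp add: err_def)
  from mult_left_mono[OF this K0] show ?thesis using assms by (simp add: close_def algebra_simps)
qed

text \<open>The linearized residual is damped exactly by the filter, and the Taylor remainder is at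
  most K0 |h| |S h| with |S h| \<le> |res n|. The error is therefore relative to the residual, and
  the noise does not enter again.\<close>

lemma res_Suc:
  assumes c: "close e n" "close e (Suc n)"
  shows "norm (res (Suc n) - op_fun (\<lambda>l. 1 - l * g n l) (gram (adj (F' (xs n)))) (res n)) \<le> 2 * e * norm (res n)"
proof -
  define S where "S = F' (xs n)"
  have S: "norm S \<le> 1" using c deriv_le_1 by (simp add: S_def close_def)
  define h where "h = xs (Suc n) - xs n"
  have h: "h = newton_step (g n) S (err n) (res n) - err n" unfolding h_def S_def err_Suc[symmetric] by (simp add: err_def)
  have "res (Suc n) - op_fun (\<lambda>l. 1 - l * g n l) (gram (adj S)) (res n) = F (xs (Suc n)) - F (xs n) - S h"
    unfolding newton_step_residual[OF S filter, where f = "res n" and x = "err n", symmetric] h[symmetric]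
    by (simp add: res_def)
  moreover have "norm (F (xs (Suc n)) - F (xs n) - S h) \<le> K0 * norm h * norm (S h)"
    unfolding h_def S_def using c by (intro taylor) (auto simp: close_def)
  moreover have "K0 * norm h * norm (S h) \<le> (2 * e) * norm (res n)"
  proof (rule mult_mono)
    show "norm (S h) \<le> norm (res n)" unfolding h by (rule norm_newton_step_residual[OF S filter])
    show "K0 * norm h \<le> 2 * e" unfolding h_def by (rule close_diff[OF c(2,1)])
  qed (use close_nonneg[OF c(1)] in auto)
  ultimately show ?thesis by (simp add: S_def)
qed

text \<open>The second summand lies in the range of the current product of derivative and adjoint,
  where a later filter acts with factor l (1 - l g) \<le> \<alpha>. When the derivative changes, S =
  R S1 turns \<open>S1 (adj S z)\<close> into \<open>gram (adj S1) (adj R z)\<close>, and the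
  difference from \<open>S (adj S z)\<close>, of relative size 2 e, goes into \<open>p\<close>. The
  coefficient \<open>w\<close> grows by 1 + 2 e \<le> 1 / sqrt q per step, which uses up only half
  of the geometric decay of \<alpha>.\<close>

lemma res_decomposition:
  assumes c: "\<And>j. j \<le> i \<Longrightarrow> close e (n + j)" and e: "2 * e \<le> 1" "1 + 2 * e \<le> 1 / sqrt q" and a: "a > 0"
  defines "\<phi> \<equiv> norm (res n)"
  shows "\<exists>p w. res (n + i) = p + gram (adj (F' (xs (n + i)))) w \<and>
     norm p \<le> a * norm (op_fun (\<lambda>l. 1 / (a + l)) (gram (adj (F' (xs n)))) (res n)) + 4 * e * (2 ^ i - 1) * \<phi> \<and>
     norm w \<le> (1 / sqrt q) ^ i * (\<phi> / a) \<and> norm (gram (adj (F' (xs (n + i)))) w) \<le> 2 ^ i * \<phi> \<and>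
     norm (res (n + i)) \<le> 2 ^ i * \<phi>"
  using c
proof (induction i)
  case 0
  define S where "S = F' (xs n)"
  have S: "norm S \<le> 1" using 0[of 0] deriv_le_1 by (simp add: S_def close_def)
  note S' = norm_adj_le_1[OF S]
  define y where "y = op_fun (\<lambda>l. 1 / (a + l)) (gram (adj S)) (res n)"
  note y = resolvent_gram[OF S' a, of "res n", folded y_def]
  have cont: "continuous_on {0..1} (\<lambda>l. 1 / (a + l))" using a by (intro continuous_intros) auto
  have "gram (adj S) y = op_fun (\<lambda>l. l * (1 / (a + l))) (gram (adj S)) (res n)"
    unfolding y_def by (rule op_fun_gram_ident_mult[OF S' cont, symmetric])
  also have "norm \<dots> \<le> 1 * norm (res n)"
    using a by (intro norm_op_fun_le[OF pos_contr_gram[OF S']] continuous_intros) auto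
  finally have gy: "norm (gram (adj S) y) \<le> norm (res n)" by simp
  \<comment> \<open>The normal equation for y, with p = a y and w = y, is the initial
    splitting.\<close>
  show ?case
    using y(1,3) gy a
    by (rule_tac exI[of _ "a *\<^sub>R y"], rule_tac exI[of _ y])
      (simp add: \<phi>_def add.commute[of "a *\<^sub>R y"] flip: S_def y_def del: blinfun_apply_blinfun_compose)
next
  case (Suc i)
  define S S1 r where "S = F' (xs (n + i))" and "S1 = F' (xs (n + Suc i))" and "r = (\<lambda>l. 1 - l * g (n + i) l)"
  define P where "P = a * norm (op_fun (\<lambda>l. 1 / (a + l)) (gram (adj (F' (xs n)))) (res n))"
  have ci: "close e (n + i)" "close e (n + Suc i)" using Suc.prems[of i] Suc.prems[of "Suc i"] by auto
  have e0: "e \<ge> 0" using close_nonneg[OF ci(1)] .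
  have S: "norm S \<le> 1" using ci deriv_le_1 by (simp add: S_def close_def)
  note S' = norm_adj_le_1[OF S] note P' = pos_contr_gram[OF S']
  have g': "continuous_on {0..1} r" "\<And>l. l \<in> {0..1} \<Longrightarrow> \<bar>r l\<bar> \<le> 1"
    using filter_stepD(4-6)[OF filter[of "n + i"]] by (auto simp: r_def)
  have nr: "norm (op_fun r (gram (adj S)) v) \<le> norm v" for v
    using norm_op_fun_le[OF P' g'(1) zero_le_one g'(2), of v] by simp
  have phi0: "\<phi> \<ge> 0" by (simp add: \<phi>_def)
  obtain p w where IH: "res (n + i) = p + gram (adj S) w" "norm p \<le> P + 4 * e * (2 ^ i - 1) * \<phi>"
    "norm w \<le> (1 / sqrt q) ^ i * (\<phi> / a)" "norm (gram (adj S) w) \<le> 2 ^ i * \<phi>" "norm (res (n + i)) \<le> 2 ^ i * \<phi>"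
    using Suc.IH Suc.prems unfolding S_def P_def by (metis le_SucI)
  define ov where "ov = res (n + Suc i) - op_fun r (gram (adj S)) (res (n + i))"
  have ov: "norm ov \<le> 2 * e * norm (res (n + i))"
    using res_Suc[of e "n + i"] ci by (simp add: ov_def r_def S_def)
  define z where "z = op_fun r (gram (adj S)) w"
  have z: "norm z \<le> norm w" unfolding z_def by (rule nr)
  have comm: "op_fun r (gram (adj S)) (gram (adj S) w) = gram (adj S) z"
    unfolding z_def op_fun_gram_mult_ident[OF S' g'(1), symmetric] op_fun_gram_ident_mult[OF S' g'(1), symmetric]
    by (simp add: mult.commute)
  have Gz: "norm (gram (adj S) z) \<le> norm (gram (adj S) w)"
    unfolding comm[symmetric] by (rule nr)
  have Gz': "gram (adj S) z = S (adj S z)" by (simp add: adj_adj)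
  have d: "K0 * norm (xs (n + Suc i) - xs (n + i)) \<le> 2 * e" "K0 * norm (xs (n + i) - xs (n + Suc i)) \<le> 2 * e"
    using close_diff ci by blast+
  have diff: "norm (S1 v - S v) \<le> 2 * e * norm (S v)" for v
  proof -
    have "norm (S1 v - S v) \<le> K0 * norm (xs (n + Suc i) - xs (n + i)) * norm (S v)"
      unfolding S1_def S_def using ci by (intro deriv_diff) (auto simp: close_def)
    also have "\<dots> \<le> 2 * e * norm (S v)" using d by (intro mult_right_mono) auto
    finally show ?thesis .
  qed
  obtain R where R: "S = R o\<^sub>L S1" "norm (id_blinfun - R) \<le> 2 * e"
    using factor[of "xs (n + i)" "xs (n + Suc i)"] ci d unfolding S_def S1_def close_def by (meson order_trans)
  define w' where "w' = adj R z"
  have G1: "gram (adj S1) w' = S1 (adj S z)" by (simp add: w'_def adj_adj R(1) adj_compose)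
  \<comment> \<open>Linearization and exchange of derivatives each add at most 2 e 2^i \<phi>; the
    coefficient 4 e (2^i - 1) solves this recursion.\<close>
  define p' where "p' = op_fun r (gram (adj S)) p + ov - (S1 (adj S z) - S (adj S z))"
  have "res (n + Suc i) = p' + gram (adj S1) w'"
  proof -
    have "res (n + Suc i) = op_fun r (gram (adj S)) p + gram (adj S) z + ov"
      by (simp add: ov_def IH(1) blinfun.add_right comm del: blinfun_apply_blinfun_compose)
    then show ?thesis unfolding p'_def G1 Gz' by simp
  qed
  moreover have "norm p' \<le> P + 4 * e * (2 ^ Suc i - 1) * \<phi>"
  proof -
    have "norm (S1 (adj S z) - S (adj S z)) \<le> 2 * e * (2 ^ i * \<phi>)"
      using diff[of "adj S z"] Gz IH(4) e0 unfolding Gz' by (meson mult_left_mono mult_nonneg_nonneg order_trans zero_le_numeral)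
    moreover have "norm ov \<le> 2 * e * (2 ^ i * \<phi>)"
      using ov IH(5) e0 by (meson mult_left_mono mult_nonneg_nonneg order_trans zero_le_numeral)
    moreover have "norm p' \<le> norm (op_fun r (gram (adj S)) p) + norm ov + norm (S1 (adj S z) - S (adj S z))"
      unfolding p'_def by (meson add_right_mono norm_triangle_ineq norm_triangle_ineq4 order_trans)
    ultimately have "norm p' \<le> P + 4 * e * (2 ^ i - 1) * \<phi> + 2 * e * (2 ^ i * \<phi>) + 2 * e * (2 ^ i * \<phi>)"
      using nr[of p] IH(2) by linarith
    then show ?thesis by (simp add: algebra_simps)
  qed
  moreover have "norm w' \<le> (1 / sqrt q) ^ Suc i * (\<phi> / a)"
  proof -
    have "norm w' \<le> (1 + 2 * e) * norm z" unfolding w'_def by (rule norm_adj_factor_le[OF R(2)])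
    also have "\<dots> \<le> (1 / sqrt q) * ((1 / sqrt q) ^ i * (\<phi> / a))"
      using e e0 q z IH(3) by (intro mult_mono) auto
    finally show ?thesis by simp
  qed
  moreover have "norm (gram (adj S1) w') \<le> 2 ^ Suc i * \<phi>"
  proof -
    have "norm (S1 (adj S z)) \<le> norm (S (adj S z)) + norm (S1 (adj S z) - S (adj S z))"
      by (rule norm_triangle_sub)
    also have "\<dots> \<le> 2 * norm (S (adj S z))"
      using diff[of "adj S z"] mult_right_mono[OF e(1), of "norm (S (adj S z))"] by simp
    finally show ?thesis using Gz IH(4) unfolding G1 Gz' by simp
  qed
  moreover have "norm (res (n + Suc i)) \<le> 2 ^ Suc i * \<phi>"
  proof -
    have "norm (res (n + Suc i)) \<le> norm (op_fun r (gram (adj S)) (res (n + i))) + norm ov"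
      unfolding ov_def by (rule norm_triangle_sub)
    also have "\<dots> \<le> 2 * norm (res (n + i))"
      using nr[of "res (n + i)"] ov mult_right_mono[OF e(1), of "norm (res (n + i))"] by simp
    finally show ?thesis using IH(5) by simp
  qed
  ultimately show ?case unfolding S1_def P_def by blast
qed

lemma res_decay:
  assumes c: "\<And>j. j \<le> Suc m \<Longrightarrow> close e (n + j)" and e: "2 * e \<le> 1" "1 + 2 * e \<le> 1 / sqrt q" and k: "k > 0"
  shows "norm (res (n + Suc m)) \<le> \<delta> + sqrt (k * \<alpha> n) * norm (err n) + 2 * e * norm (T (err n))
     + (6 * e * 2 ^ m + sqrt q ^ m / k) * norm (res n)"
proof -
  define a where "a = k * \<alpha> n"
  have a: "a > 0" using k \<alpha>_pos by (simp add: a_def)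
  define \<phi> where "\<phi> = norm (res n)"
  have c0: "close e n" using c[of 0] by simp
  have e0: "e \<ge> 0" using close_nonneg[OF c0] .
  have "\<And>j. j \<le> m \<Longrightarrow> close e (n + j)" using c by simp
  from res_decomposition[OF this e a] obtain p w where pw: "res (n + m) = p + gram (adj (F' (xs (n + m)))) w"
     "norm p \<le> a * norm (op_fun (\<lambda>l. 1 / (a + l)) (gram (adj (F' (xs n)))) (res n)) + 4 * e * (2 ^ m - 1) * \<phi>"
     "norm w \<le> (1 / sqrt q) ^ m * (\<phi> / a)" "norm (res (n + m)) \<le> 2 ^ m * \<phi>"
    unfolding \<phi>_def by blast
  define S where "S = F' (xs n)"
  have S: "norm S \<le> 1" using c0 deriv_le_1 by (simp add: S_def close_def)
  note S' = norm_adj_le_1[OF S]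
  have cont: "continuous_on {0..1} (\<lambda>l. a / (a + l))" using a by (intro continuous_intros) auto
  obtain u where u: "res n = S (err n) + u" "norm u \<le> e * norm (S (err n)) + \<delta>"
    using res_split[OF c0] unfolding S_def .
  have "a * norm (op_fun (\<lambda>l. 1 / (a + l)) (gram (adj S)) (res n)) = norm (op_fun (\<lambda>l. a / (a + l)) (gram (adj S)) (res n))"
    unfolding resolvent_gram(4)[OF S' a] using a by simp
  also have "\<dots> \<le> norm (op_fun (\<lambda>l. a / (a + l)) (gram (adj S)) (S (err n))) + norm (op_fun (\<lambda>l. a / (a + l)) (gram (adj S)) u)"
    by (simp add: u(1) blinfun.add_right norm_triangle_ineq)
  also have "op_fun (\<lambda>l. a / (a + l)) (gram (adj S)) (S (err n)) = S (op_fun (\<lambda>l. a / (a + l)) (gram S) (err n))"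
    by (rule op_fun_gram_left[OF S cont, symmetric])
  also have "norm (S (op_fun (\<lambda>l. a / (a + l)) (gram S) (err n))) \<le> sqrt a * norm (err n)"
  proof (rule norm_gram_op_fun_le_sqrt[OF S cont])
    fix l :: real assume l: "l \<in> {0..1}"
    then have al: "a + l > 0" using a by (auto intro: add_pos_nonneg)
    have "l * a \<le> (a + l)\<^sup>2" using l a by (simp add: power2_eq_square algebra_simps)
    then have "l * a * a \<le> (a + l)\<^sup>2 * a" using a by (intro mult_right_mono) auto
    then show "l * (a / (a + l))\<^sup>2 \<le> (sqrt a)\<^sup>2"
      using a al by (simp add: power_divide divide_le_eq) (simp add: power2_eq_square mult_ac)
  qed (use a in simp)
  also have "norm (op_fun (\<lambda>l. a / (a + l)) (gram (adj S)) u) \<le> 1 * norm u"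
    using a by (intro norm_op_fun_le[OF pos_contr_gram[OF S'] cont]) auto
  finally have r0: "a * norm (op_fun (\<lambda>l. 1 / (a + l)) (gram (adj S)) (res n)) \<le> sqrt a * norm (err n) + norm u" by simp
  have "norm (S (err n)) \<le> norm (T (err n)) + e * norm (T (err n))"
    using norm_triangle_sub[of "S (err n)" "T (err n)"] close_deriv(1)[OF c0, of "err n"] by (simp add: S_def)
  also have "\<dots> \<le> 2 * norm (T (err n))"
    using mult_right_mono[of e 1 "norm (T (err n))"] e by simp
  finally have "e * norm (S (err n)) \<le> e * (2 * norm (T (err n)))" using e0 by (rule mult_left_mono)
  then have u': "norm u \<le> 2 * e * norm (T (err n)) + \<delta>" using u(2) by simp
  define S1 r where "S1 = F' (xs (n + m))" and "r = (\<lambda>l. 1 - l * g (n + m) l)"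
  have cm: "close e (n + m)" "close e (Suc (n + m))" using c[of m] c[of "Suc m"] by auto
  have S1: "norm S1 \<le> 1" using cm deriv_le_1 by (simp add: S1_def close_def)
  note S1' = norm_adj_le_1[OF S1]
  note g' = filter_stepD[OF filter[of "n + m"]]
  have cr: "continuous_on {0..1} r" unfolding r_def by (rule g')
  have "res (n + Suc m) = op_fun r (gram (adj S1)) p + op_fun r (gram (adj S1)) (gram (adj S1) w)
      + (res (Suc (n + m)) - op_fun r (gram (adj S1)) (res (n + m)))"
    by (simp add: pw(1) S1_def blinfun.add_right del: blinfun_apply_blinfun_compose)
  then have "norm (res (n + Suc m)) \<le> norm (op_fun r (gram (adj S1)) p) + norm (op_fun r (gram (adj S1)) (gram (adj S1) w))
      + norm (res (Suc (n + m)) - op_fun r (gram (adj S1)) (res (n + m)))"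
    by (metis (no_types, opaque_lifting) norm_triangle_ineq norm_triangle_mono order_refl)
  moreover have "norm (op_fun r (gram (adj S1)) p) \<le> 1 * norm p"
    using g'(5,6) by (intro norm_op_fun_le[OF pos_contr_gram[OF S1'] cr]) (auto simp: r_def)
  moreover have "norm (op_fun r (gram (adj S1)) (gram (adj S1) w)) \<le> \<alpha> (n + m) * norm w"
    unfolding op_fun_gram_mult_ident[OF S1' cr, symmetric]
    using g'(1,5,7) by (intro norm_op_fun_le[OF pos_contr_gram[OF S1']] continuous_intros cr) (auto simp: r_def mult.commute)
  moreover have "norm (res (Suc (n + m)) - op_fun r (gram (adj S1)) (res (n + m))) \<le> 2 * e * (2 ^ m * \<phi>)"
    using res_Suc[OF cm] pw(4) e0 unfolding S1_def r_def by (meson mult_left_mono mult_nonneg_nonneg order_trans zero_le_numeral)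
  \<comment> \<open>The decay q^m of \<alpha> against the growth q^(-m/2) of \<open>w\<close> leaves
    the net factor q^(m/2).\<close>
  moreover have "\<alpha> (n + m) * norm w \<le> sqrt q ^ m / k * \<phi>"
  proof -
    have "\<alpha> (n + m) * norm w \<le> \<alpha> (n + m) * ((1 / sqrt q) ^ m * (\<phi> / a))"
      using pw(3) \<alpha>_pos[of "n + m"] by (intro mult_left_mono) auto
    also have "\<dots> = (q * (1 / sqrt q)) ^ m * (\<phi> / k)"
      unfolding \<alpha>_add a_def power_mult_distrib using \<alpha>_pos[of n] k by (simp add: field_simps)
    also have "q * (1 / sqrt q) = sqrt q" using q by (simp add: real_div_sqrt)
    finally show ?thesis by simp
  qed
  moreover have "4 * e * (2 ^ m - 1) * \<phi> \<le> 4 * e * 2 ^ m * \<phi>"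
    using e0 by (intro mult_right_mono mult_left_mono) (auto simp: \<phi>_def)
  ultimately have "norm (res (n + Suc m)) \<le> (sqrt a * norm (err n) + (2 * e * norm (T (err n)) + \<delta>)) + 4 * e * 2 ^ m * \<phi>
      + sqrt q ^ m / k * \<phi> + 2 * e * (2 ^ m * \<phi>)"
    using r0 u' pw(2)[folded S_def] by linarith
  then show ?thesis by (simp add: \<phi>_def a_def algebra_simps)
qed

end

text \<open>The least element \<open>d\<close> of the closure of x - range(adj T) is orthogonal to
  that range, so T d = 0. As \<open>x\<close> is orthogonal to the null space, \<open>d\<close> is
  orthogonal to the whole set and its closure, in particular to itself.\<close>

lemma source_approximation:
  fixes T :: "'a::{real_inner,complete_space} \<Rightarrow>\<^sub>L 'b::{real_inner,complete_space}"
  assumes x: "x \<in> orthogonal_comp (null_space T)" and s: "s > 0"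
  obtains v where "norm (x - adj T v) < s"
proof -
  define A where "A = range (\<lambda>v. x - adj T v)"
  have "convex A"
    unfolding convex_def
  proof (intro ballI allI impI)
    fix y z and u v :: real assume yz: "y \<in> A" "z \<in> A" and uv: "0 \<le> u" "0 \<le> v" "u + v = 1"
    obtain y' z' where "y = x - adj T y'" "z = x - adj T z'" using yz by (auto simp: A_def)
    then have "u *\<^sub>R y + v *\<^sub>R z = (u + v) *\<^sub>R x - adj T (u *\<^sub>R y' + v *\<^sub>R z')"
      by (simp only: blinfun.add_right blinfun.scaleR_right scaleR_diff_right scaleR_add_left)
        (simp add: algebra_simps)
    then have "u *\<^sub>R y + v *\<^sub>R z = x - adj T (u *\<^sub>R y' + v *\<^sub>R z')" using uv by simp
    then show "u *\<^sub>R y + v *\<^sub>R z \<in> A" by (auto simp: A_def)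
  qed
  then obtain d where d: "d \<in> closure A" "\<And>y. y \<in> closure A \<Longrightarrow> norm d \<le> norm y"
    using convex_min_norm_element[of "closure A"] by (auto simp: A_def convex_closure)
  have "inner d (adj T v) = 0" for v
  proof (rule min_norm_orthogonal)
    fix t :: real
    \<comment> \<open>The set is invariant under shifts by the range, hence so is its closure; this
      makes \<open>d + t *\<^sub>R adj T v\<close> an admissible competitor.\<close>
    have "(+) (t *\<^sub>R adj T v) ` A \<subseteq> A"
    proof
      fix z assume "z \<in> (+) (t *\<^sub>R adj T v) ` A"
      then obtain y where "z = t *\<^sub>R adj T v + (x - adj T y)" by (auto simp: A_def)
      then have "z = x - adj T (y - t *\<^sub>R v)" by (simp add: blinfun.diff_right blinfun.scaleR_right)
      then show "z \<in> A" by (auto simp: A_def)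
    qed
    then have "closure ((+) (t *\<^sub>R adj T v) ` A) \<subseteq> closure A" by (rule closure_mono)
    then have "t *\<^sub>R adj T v + d \<in> closure A" using d(1) unfolding closure_translation by blast
    then show "norm d \<le> norm (d + t *\<^sub>R adj T v)" using d(2) by (simp add: add.commute)
  qed
  then have "inner (T d) (T d) = 0" by (simp add: inner_adj_right)
  then have Td: "T d = 0" by simp
  have "A \<subseteq> {y. inner d y = 0}"
    using x Td by (auto simp: A_def orthogonal_comp_def null_space_def orthogonal_def inner_diff_right inner_adj_right)
  moreover have "closed {y. inner d y = 0}" by (intro closed_Collect_eq continuous_intros)
  ultimately have "closure A \<subseteq> {y. inner d y = 0}" by (rule closure_minimal)
  then have "d = 0" using d(1) by auto
  then have "0 \<in> closure A" using d(1) by simp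
  then show thesis using s that unfolding closure_approachable by (auto simp: A_def)
qed

text \<open>\<open>CS\<close> is the noise constant of one energy step times q / (1 - q), the value
  of the geometric series that sums the noise over all earlier steps. \<open>M1\<close> turns s^2 +
  CS N^2 into (M1 (s + N))^2, and \<open>small\<close> is tuned to
  \<open>noise_le_of_discrepancy\<close>. \<open>Emax\<close> is the error radius that the energy
  bounds must maintain.\<close>

locale newton_analysis = newton_run F F' xdag \<rho> K0 g \<alpha> q b \<delta> yd xs
  for F :: "'a::{real_inner,complete_space} \<Rightarrow> 'b::{real_inner,complete_space}"
    and F' xdag \<rho> K0 g \<alpha> q b \<delta> yd xs +
  fixes \<eta> \<kappa> e Emax \<tau> k CS M1 :: real and m :: nat
  assumes \<eta>: "0 < \<eta>" "\<eta> \<le> 1" and \<kappa>: "\<kappa> = \<eta> * q * (1 - q) / 9"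
    and e: "e * (10 * b + 30 + 42 / q) \<le> \<kappa> / 4" "2 * e \<le> 1" "1 + 2 * e \<le> 1 / sqrt q"
    and CS: "CS = (36 * b\<^sup>2 / \<kappa> + 4 * b + 2 + 28 / q) * (q / (1 - q))"
    and k: "k > 0" and \<tau>: "\<tau> > 1" and M1: "M1 \<ge> 1" "CS \<le> M1\<^sup>2"
    and small: "sqrt k * M1 \<le> (\<tau> - 1) / 12"
      "2 * (6 * e * 2 ^ m + sqrt q ^ m / k) * M1 / sqrt \<kappa> \<le> (\<tau> - 1) / 12"
    and Emax: "Emax > 0" and closeI: "\<And>n. norm (err n) \<le> Emax \<Longrightarrow> close e n"
    and \<delta>_pos: "\<delta> > 0"
begin

section \<open>Energy bounds up to the stopping index\<close>

definition W :: "nat \<Rightarrow> real" where "W n = energy \<eta> \<kappa> (\<alpha> n) T (err n)"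

definition V :: "nat \<Rightarrow> real" where "V n = (norm (T (err n)))\<^sup>2 / \<alpha> n"

lemma \<kappa>_pos: "\<kappa> > 0" using \<eta> q by (simp add: \<kappa>)

lemma \<kappa>_le_1: "\<kappa> \<le> 1"
proof -
  have "\<eta> * q * (1 - q) \<le> 1 * 1 * 1" using \<eta> q by (intro mult_mono) auto
  then show ?thesis by (simp add: \<kappa>)
qed

lemma CS_nonneg: "CS \<ge> 0"
  using \<kappa>_pos b1 q by (simp add: CS)

lemma \<alpha>_antimono: "i \<le> j \<Longrightarrow> \<alpha> j \<le> \<alpha> i"
  using \<alpha>_add[of i "j - i"] q \<alpha>_pos[of i] by (simp add: power_le_one mult_left_le_one_le)

lemma noise_mono: "i \<le> j \<Longrightarrow> \<delta>\<^sup>2 / \<alpha> i \<le> \<delta>\<^sup>2 / \<alpha> j"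
  using \<alpha>_antimono[of i j] \<alpha>_pos[of j] by (intro divide_left_mono) (auto simp: \<alpha>_pos)

lemma V_nonneg: "V n \<ge> 0" using \<alpha>_pos[of n] by (simp add: V_def)

lemma W_ge: "(norm (err n))\<^sup>2 + \<kappa> * V n \<le> W n"
  using energy_bounds(1)[OF T1 \<alpha>_pos[of n], of \<eta> \<kappa> "err n"] \<eta> \<kappa>_pos by (simp add: W_def V_def)

lemma W_le: "W n \<le> 2 * (norm (err n))\<^sup>2 + V n"
proof -
  have "W n \<le> (1 + \<eta>) * (norm (err n))\<^sup>2 + \<kappa> * V n"
    using energy_bounds(2)[OF T1 \<alpha>_pos[of n], of \<eta> \<kappa> "err n"] \<eta> \<kappa>_pos by (simp add: W_def V_def)
  also have "\<dots> \<le> 2 * (norm (err n))\<^sup>2 + 1 * V n"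
    using \<eta> \<kappa>_le_1 V_nonneg by (intro add_mono mult_right_mono) auto
  finally show ?thesis by simp
qed

text \<open>The scaling |T| \<le> sqrt \<alpha>_0 gives V 0 \<le> |e_0|^2, and \<kappa> \<le>
  \<eta>. The factor tends to 1 with \<eta>, so the initial energy exceeds |e_0|^2 by as little as
  desired.\<close>

lemma W_0_le:
  assumes "norm T \<le> sqrt (\<alpha> 0)"
  shows "W 0 \<le> (1 + 2 * \<eta>) * (norm (err 0))\<^sup>2"
proof -
  have "norm (T (err 0)) \<le> sqrt (\<alpha> 0) * norm (err 0)"
    using norm_blinfun[of T "err 0"] mult_right_mono[OF assms norm_ge_zero] by (rule order_trans)
  then have "(norm (T (err 0)))\<^sup>2 \<le> (sqrt (\<alpha> 0) * norm (err 0))\<^sup>2" by (intro power_mono) auto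
  then have "V 0 \<le> (norm (err 0))\<^sup>2" using \<alpha>_pos[of 0] by (simp add: V_def power_mult_distrib divide_le_eq mult.commute)
  moreover have "\<kappa> \<le> \<eta>"
  proof -
    have "q * (1 - q) \<le> 1 * 1" using q by (intro mult_mono) auto
    then have "\<eta> * (q * (1 - q)) \<le> \<eta> * 9" using \<eta> by (intro mult_left_mono) auto
    then show ?thesis by (simp add: \<kappa> mult_ac)
  qed
  ultimately have "\<kappa> * V 0 \<le> \<eta> * (norm (err 0))\<^sup>2" using V_nonneg \<eta> by (intro mult_mono) auto
  moreover have "W 0 \<le> (1 + \<eta>) * (norm (err 0))\<^sup>2 + \<kappa> * V 0"
    using energy_bounds(2)[OF T1 \<alpha>_pos[of 0], of \<eta> \<kappa> "err 0"] \<eta> \<kappa>_pos by (simp add: W_def V_def)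
  ultimately show ?thesis by (simp add: algebra_simps)
qed

lemma err_le_of_W: "W n \<le> c\<^sup>2 \<Longrightarrow> c \<ge> 0 \<Longrightarrow> norm (err n) \<le> c"
proof (rule power2_le_imp_le)
  assume "W n \<le> c\<^sup>2"
  moreover have "0 \<le> \<kappa> * V n" using \<kappa>_pos V_nonneg by simp
  ultimately show "(norm (err n))\<^sup>2 \<le> c\<^sup>2" using W_ge[of n] by linarith
qed

lemma T_err_eq: "norm (T (err n)) = sqrt (\<alpha> n) * sqrt (V n)"
  using \<alpha>_pos[of n] by (simp add: V_def real_sqrt_divide)

lemma T_err_le_of_W:
  assumes "W n \<le> c\<^sup>2" "c \<ge> 0" shows "norm (T (err n)) \<le> sqrt (\<alpha> n) * (c / sqrt \<kappa>)"
proof -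
  have "\<kappa> * V n \<le> c\<^sup>2" using W_ge[of n] assms(1) zero_le_power2[of "norm (err n)"] by linarith
  then have "V n \<le> c\<^sup>2 / \<kappa>" using \<kappa>_pos by (simp add: field_simps)
  then have "sqrt (V n) \<le> sqrt (c\<^sup>2 / \<kappa>)" by (rule real_sqrt_le_mono)
  then have "sqrt (V n) \<le> c / sqrt \<kappa>" using assms(2) by (simp add: real_sqrt_divide)
  then show ?thesis unfolding T_err_eq using \<alpha>_pos[of n] by (intro mult_left_mono) auto
qed

text \<open>Closeness is required only below \<open>n\<close>, so that the resulting bound on
  \<open>W n\<close> can itself provide closeness at \<open>n\<close>.\<close>

lemma energy_sum:
  assumes c: "\<And>j. n0 \<le> j \<Longrightarrow> j < n \<Longrightarrow> close e j" and n: "n0 \<le> n"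
  shows "W n + \<kappa> / 8 * (\<Sum>j=n0..<n. V j) \<le> W n0 + CS * (\<delta>\<^sup>2 / \<alpha> n)"
proof -
  define C where "C = 36 * b\<^sup>2 / \<kappa> + 4 * b + 2 + 28 / q"
  have C: "C \<ge> 0" "CS = C * (q / (1 - q))" using \<kappa>_pos b1 q by (auto simp: C_def CS)
  show ?thesis using n c
  proof (induction rule: dec_induct)
    case base
    show ?case using CS_nonneg \<alpha>_pos[of n0] by simp
  next
    case (step j)
    have "W (Suc j) \<le> W j - \<kappa> / 8 * V j + C * (\<delta>\<^sup>2 / \<alpha> j)"
      unfolding W_def V_def C_def using e
      by (intro energy_Suc[OF step.prems[OF step.hyps(1) lessI] \<eta> \<kappa> _ e(1)]) auto
    moreover have "W j + \<kappa> / 8 * (\<Sum>j=n0..<j. V j) \<le> W n0 + CS * (\<delta>\<^sup>2 / \<alpha> j)"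
      using step by auto
    moreover have "CS * (\<delta>\<^sup>2 / \<alpha> j) + C * (\<delta>\<^sup>2 / \<alpha> j) = CS * (\<delta>\<^sup>2 / \<alpha> (Suc j))"
    proof -
      \<comment> \<open>This identity closes the induction: old noise plus new noise at level
        \<open>j\<close> is the allowance at level \<open>Suc j\<close>.\<close>
      have "CS + C = CS / q" using q unfolding C(2) by (simp add: field_simps)
      then have "(CS + C) * (\<delta>\<^sup>2 / \<alpha> j) = CS / q * (\<delta>\<^sup>2 / \<alpha> j)" by simp
      then show ?thesis unfolding distrib_right[symmetric] \<alpha>_Suc by simp
    qed
    moreover have "(\<Sum>j=n0..<Suc j. V j) = (\<Sum>j=n0..<j. V j) + V j" using step.hyps by simp
    ultimately show ?case by (simp add: distrib_left)
  qed
qed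

lemma W_le_noise:
  assumes c: "\<And>j. n0 \<le> j \<Longrightarrow> j < n \<Longrightarrow> close e j" and n: "n0 \<le> n"
  shows "W n \<le> W n0 + CS * (\<delta>\<^sup>2 / \<alpha> n)"
proof -
  have "0 \<le> \<kappa> / 8 * (\<Sum>j=n0..<n. V j)"
    using \<kappa>_pos by (intro mult_nonneg_nonneg sum_nonneg V_nonneg) auto
  then show ?thesis using energy_sum[OF assms] by linarith
qed

text \<open>Bootstrap: closeness at smaller indices bounds the energy, the energy bounds the error
  by \<open>Emax\<close>, and this gives closeness at \<open>n\<close>.\<close>

lemma phase1:
  assumes W0: "W 0 + CS * (\<delta>\<^sup>2 / \<alpha> n1) \<le> Emax\<^sup>2" and n: "n \<le> n1"
  shows "W n \<le> Emax\<^sup>2 \<and> close e n"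
  using n
proof (induction n rule: less_induct)
  case (less n)
  have "W n \<le> W 0 + CS * (\<delta>\<^sup>2 / \<alpha> n)" using less by (intro W_le_noise) auto
  also have "\<dots> \<le> W 0 + CS * (\<delta>\<^sup>2 / \<alpha> n1)"
    using noise_mono[OF less.prems] CS_nonneg by (intro add_left_mono mult_left_mono)
  finally have "W n \<le> Emax\<^sup>2" using W0 by simp
  then show ?case using closeI[OF err_le_of_W] Emax by simp
qed

text \<open>In units of sqrt \<alpha>_n the noise is N = \<delta> / sqrt \<alpha>_n, and the error
  and the linearized residual are of order s + N. By \<open>res_decay\<close> the residual m + 1
  steps later exceeds \<delta> by at most a small multiple of \<tau> - 1 times s + N; an unmet
  criterion then forces N \<le> s.\<close>

lemma noise_le_of_discrepancy:
  assumes c: "\<And>j. j \<le> Suc m \<Longrightarrow> close e (n + j)" and s: "s > 0"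
    and W: "W n \<le> s\<^sup>2 + CS * (\<delta>\<^sup>2 / \<alpha> n)" and disc: "\<tau> * \<delta> < norm (res (n + Suc m))"
  shows "\<delta>\<^sup>2 / \<alpha> n \<le> s\<^sup>2"
proof -
  define A where "A = sqrt (\<alpha> n)"
  define N where "N = \<delta> / A"
  have A: "A > 0" using \<alpha>_pos by (simp add: A_def)
  have N: "N > 0" "\<delta> = A * N" using \<delta>_pos A by (auto simp: N_def)
  have N2: "\<delta>\<^sup>2 / \<alpha> n = N\<^sup>2" using \<alpha>_pos[of n] by (simp add: N_def A_def power_divide)
  define \<gamma> where "\<gamma> = 6 * e * 2 ^ m + sqrt q ^ m / k"
  have e0: "e \<ge> 0" using close_nonneg[OF c[of 0]] by simp
  have g0: "\<gamma> \<ge> 0" using e0 q k by (simp add: \<gamma>_def)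
  have eg: "e \<le> \<gamma>"
  proof -
    have "e * 1 \<le> e * (6 * 2 ^ m)" using e0 one_le_power[of "2::real" m] by (intro mult_left_mono) linarith+
    moreover have "0 \<le> sqrt q ^ m / k" using q k by simp
    ultimately show ?thesis by (simp add: \<gamma>_def mult_ac)
  qed
  define L where "L = M1 * (s + N)"
  have L0: "L \<ge> 0" using M1 s N by (simp add: L_def)
  have "W n \<le> L\<^sup>2"
  proof -
    have "s\<^sup>2 + CS * N\<^sup>2 \<le> M1\<^sup>2 * s\<^sup>2 + M1\<^sup>2 * N\<^sup>2"
      using M1 mult_right_mono[of 1 "M1\<^sup>2" "s\<^sup>2"] by (intro add_mono mult_right_mono) auto
    also have "\<dots> \<le> L\<^sup>2" unfolding L_def power_mult_distrib distrib_left[symmetric]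
      using s N by (intro mult_left_mono) (auto simp: power2_sum)
    finally show ?thesis using W N2 by simp
  qed
  then have a: "norm (err n) \<le> L" and t: "norm (T (err n)) \<le> A * (L / sqrt \<kappa>)"
    using err_le_of_W T_err_le_of_W L0 by (auto simp: A_def)
  have f: "norm (res n) \<le> 2 * (A * (L / sqrt \<kappa>)) + A * N"
    using res_bounds(1)[OF c[of 0]] e t N(2) by simp
  have "\<tau> * (A * N) < A * N + sqrt (k * \<alpha> n) * norm (err n) + 2 * e * norm (T (err n)) + \<gamma> * norm (res n)"
    unfolding \<gamma>_def N(2)[symmetric] by (rule less_le_trans[OF disc res_decay[OF c e(2,3) k]])
  also have "\<dots> \<le> A * N + (sqrt k * A) * L + 2 * \<gamma> * (A * (L / sqrt \<kappa>)) + \<gamma> * (2 * (A * (L / sqrt \<kappa>)) + A * N)"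
    using a t f e0 g0 eg k A L0 \<alpha>_pos[of n] \<kappa>_pos
    by (intro add_mono mult_mono mult_left_mono) (auto simp: A_def real_sqrt_mult)
  also have "\<dots> = A * (N + sqrt k * L + 4 * (\<gamma> * (L / sqrt \<kappa>)) + \<gamma> * N)" by (simp add: algebra_simps)
  finally have "A * (\<tau> * N) < A * (N + sqrt k * L + 4 * (\<gamma> * (L / sqrt \<kappa>)) + \<gamma> * N)" by (simp add: mult_ac)
  then have main: "\<tau> * N < N + sqrt k * L + 4 * (\<gamma> * (L / sqrt \<kappa>)) + \<gamma> * N" using A by simp
  have "sqrt k * M1 * (s + N) \<le> (\<tau> - 1) / 12 * (s + N)"
    using small(1) s N by (intro mult_right_mono) auto
  then have k1: "sqrt k * L \<le> (\<tau> - 1) / 12 * (s + N)" by (simp add: L_def mult.assoc)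
  have gM: "\<gamma> * M1 / sqrt \<kappa> \<le> (\<tau> - 1) / 24" using small(2)[folded \<gamma>_def] by (simp add: mult_ac)
  then have "\<gamma> * M1 / sqrt \<kappa> * (s + N) \<le> (\<tau> - 1) / 24 * (s + N)"
    using s N by (intro mult_right_mono) auto
  then have k2: "\<gamma> * (L / sqrt \<kappa>) \<le> (\<tau> - 1) / 24 * (s + N)" by (simp add: L_def mult_ac)
  have "\<gamma> * 1 \<le> \<gamma> * (M1 / sqrt \<kappa>)"
    using g0 M1 \<kappa>_pos \<kappa>_le_1 by (intro mult_left_mono) (auto simp: le_divide_eq order_trans[of "sqrt \<kappa>" 1 M1])
  also have "\<gamma> * (M1 / sqrt \<kappa>) \<le> (\<tau> - 1) / 24" using gM by simp
  finally have "\<gamma> \<le> (\<tau> - 1) / 24" by simp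
  then have k3: "\<gamma> * N \<le> (\<tau> - 1) / 24 * N" using N by (intro mult_right_mono) auto
  \<comment> \<open>The fraction 1/4 is 1/12 from \<open>k1\<close> plus four times 1/24 from
    \<open>k2\<close>.\<close>
  have "\<tau> * N - N < (\<tau> - 1) / 4 * (s + N) + (\<tau> - 1) / 24 * N"
    using main k1 k2 k3 by argo
  then have "(\<tau> - 1) * N < (\<tau> - 1) * ((s + N) / 4 + N / 24)" by (simp add: algebra_simps)
  then have "N < (s + N) / 4 + N / 24" using \<tau> by simp
  then have "N \<le> s" using s N(1) by argo
  then show ?thesis unfolding N2 using N by (intro power_mono) auto
qed

text \<open>The criterion is assumed unmet only below \<open>n\<close>, so \<open>n\<close> may be
  the stopping index itself. The exponent m + 2 is the look-back of m + 1 steps plus the last step,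
  across each of which \<delta>^2 / \<alpha> grows by 1 / q.\<close>

lemma phase2:
  assumes W0: "W n0 \<le> s\<^sup>2" and s: "s > 0" and \<delta>s: "\<delta>\<^sup>2 / \<alpha> (n0 + Suc m) \<le> s\<^sup>2"
    and sE: "(1 + CS / q ^ (m + 2)) * s\<^sup>2 \<le> Emax\<^sup>2"
    and n: "n0 \<le> n" and disc: "\<And>j. n0 \<le> j \<Longrightarrow> j < n \<Longrightarrow> \<tau> * \<delta> < norm (res j)"
  shows "W n \<le> (1 + CS / q ^ (m + 2)) * s\<^sup>2 \<and> close e n \<and> (n0 < n \<longrightarrow> \<delta>\<^sup>2 / \<alpha> n \<le> s\<^sup>2 / q ^ (m + 2))"
  using n disc
proof (induction n rule: less_induct)
  case (less n)
  have cl: "close e j" if "n0 \<le> j" "j < n" for j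
    using less.IH[OF that(2,1)] less.prems(2) that by auto
  have claim: "W n \<le> (1 + CS / q ^ (m + 2)) * s\<^sup>2 \<and> (n0 < n \<longrightarrow> \<delta>\<^sup>2 / \<alpha> n \<le> s\<^sup>2 / q ^ (m + 2))"
  proof (cases "n = n0")
    case True
    have "0 \<le> CS / q ^ (m + 2) * s\<^sup>2" using CS_nonneg q by simp
    then show ?thesis using W0 True by (simp add: distrib_right)
  next
    case False
    then obtain p where p: "n = Suc p" "n0 \<le> p" using less.prems(1) by (cases n) auto
    have "\<delta>\<^sup>2 / \<alpha> p \<le> s\<^sup>2 / q ^ Suc m"
    proof (cases "p \<le> n0 + Suc m")
      case True
      have "s\<^sup>2 * 1 \<le> s\<^sup>2 * (1 / q ^ Suc m)"
        using q power_le_one[of q "Suc m"] by (intro mult_left_mono) (auto simp del: power_Suc)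
      then show ?thesis using noise_mono[OF True] \<delta>s by (simp del: power_Suc)
    next
      case False
      define l where "l = p - Suc m"
      have l: "p = l + Suc m" "n0 \<le> l" using False by (auto simp: l_def)
      have "W l \<le> W n0 + CS * (\<delta>\<^sup>2 / \<alpha> l)"
        using cl l p by (intro W_le_noise) auto
      then have "W l \<le> s\<^sup>2 + CS * (\<delta>\<^sup>2 / \<alpha> l)" using W0 by simp
      then have "\<delta>\<^sup>2 / \<alpha> l \<le> s\<^sup>2"
        using cl l p less.prems(2)[of p] by (intro noise_le_of_discrepancy s) auto
      then have "\<delta>\<^sup>2 / \<alpha> l / q ^ Suc m \<le> s\<^sup>2 / q ^ Suc m" using q by (intro divide_right_mono) auto
      then show ?thesis unfolding l(1) \<alpha>_add by (simp add: mult_ac)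
    qed
    then have "\<delta>\<^sup>2 / \<alpha> p / q \<le> s\<^sup>2 / q ^ Suc m / q" using q by (intro divide_right_mono) auto
    then have d: "\<delta>\<^sup>2 / \<alpha> n \<le> s\<^sup>2 / q ^ (m + 2)" by (simp add: p(1) \<alpha>_Suc mult_ac)
    have "W n \<le> W n0 + CS * (\<delta>\<^sup>2 / \<alpha> n)" using cl less.prems(1) by (intro W_le_noise) auto
    also have "\<dots> \<le> s\<^sup>2 + CS * (s\<^sup>2 / q ^ (m + 2))"
      using W0 d CS_nonneg by (intro add_mono mult_left_mono)
    finally show ?thesis using d by (simp add: distrib_right)
  qed
  then have "norm (err n) \<le> Emax" using sE Emax by (intro err_le_of_W) auto
  then show ?case using claim closeI by blast
qed

text \<open>Each residual is of order sqrt \<alpha>_j, so the summands grow like 1 / sqrt \<alpha>_j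
  and the last one dominates. With p = sqrt q, p / (1 - p) + 1 = 1 / (1 - p) closes the
  induction.\<close>

lemma sum_res_le:
  assumes W0: "W 0 + CS * (\<delta>\<^sup>2 / \<alpha> n1) \<le> Emax\<^sup>2" and \<delta>E: "\<delta>\<^sup>2 / \<alpha> n1 \<le> Emax\<^sup>2" and n: "n \<le> n1"
  shows "(\<Sum>j<n. 2 * b / \<alpha> j * norm (res j)) \<le> 2 * b * Emax * (2 / sqrt \<kappa> + 1) * (sqrt q / (1 - sqrt q)) / sqrt (\<alpha> n)"
  using n
proof (induction n)
  case 0
  then show ?case using b1 Emax q \<kappa>_pos \<alpha>_pos[of 0] by simp
next
  case (Suc n)
  define D where "D = 2 * b * Emax * (2 / sqrt \<kappa> + 1)"
  define p where "p = sqrt q"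
  have p: "0 < p" "p < 1" using q by (auto simp: p_def)
  have a: "sqrt (\<alpha> n) > 0" using \<alpha>_pos by simp
  have W: "W n \<le> Emax\<^sup>2" "close e n" using phase1[OF W0, of n] Suc.prems by auto
  have "\<delta>\<^sup>2 / \<alpha> n \<le> Emax\<^sup>2" using noise_mono[of n n1] \<delta>E Suc.prems by simp
  then have "\<delta>\<^sup>2 \<le> (sqrt (\<alpha> n) * Emax)\<^sup>2" using \<alpha>_pos[of n] by (simp add: power_mult_distrib field_simps)
  then have d: "\<delta> \<le> sqrt (\<alpha> n) * Emax" using a Emax by (auto elim: power2_le_imp_le)
  have "norm (res n) \<le> 2 * norm (T (err n)) + \<delta>" using res_bounds(1)[OF W(2)] e by simp
  also have "\<dots> \<le> 2 * (sqrt (\<alpha> n) * (Emax / sqrt \<kappa>)) + sqrt (\<alpha> n) * Emax"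
    using T_err_le_of_W[OF W(1)] Emax d by simp
  also have "\<dots> = sqrt (\<alpha> n) * (Emax * (2 / sqrt \<kappa> + 1))" by (simp add: algebra_simps)
  finally have "2 * b / \<alpha> n * norm (res n) \<le> 2 * b / \<alpha> n * (sqrt (\<alpha> n) * (Emax * (2 / sqrt \<kappa> + 1)))"
    using b1 \<alpha>_pos[of n] by (intro mult_left_mono) auto
  also have "\<dots> = D * (sqrt (\<alpha> n) / \<alpha> n)" by (simp add: D_def)
  also have "sqrt (\<alpha> n) / \<alpha> n = 1 / sqrt (\<alpha> n)" using \<alpha>_pos[of n] by (simp add: field_simps)
  finally have "(\<Sum>j<Suc n. 2 * b / \<alpha> j * norm (res j)) \<le> D * (p / (1 - p)) / sqrt (\<alpha> n) + D * (1 / sqrt (\<alpha> n))"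
    using Suc by (simp add: D_def p_def)
  also have "\<dots> = D * (p / (1 - p)) / sqrt (\<alpha> (Suc n))"
    using a p by (simp add: \<alpha>_Suc real_sqrt_mult p_def[symmetric] field_simps)
  finally show ?case by (simp add: D_def p_def)
qed

text \<open>If every V j below \<open>n1\<close> exceeded \<omega>, the total decrease would be
  larger than the available energy \<open>Emax\<close> squared.\<close>

lemma exists_V_le:
  assumes W0: "W 0 + CS * (\<delta>\<^sup>2 / \<alpha> n1) \<le> Emax\<^sup>2" and n1: "8 * Emax\<^sup>2 / (\<kappa> * \<omega>) \<le> real n1" and \<omega>: "\<omega> > 0" and "n1 > 0"
  obtains n where "n < n1" "V n \<le> \<omega>"
proof (rule ccontr)
  assume *: "\<not> thesis"
  have "\<kappa> / 8 * (\<Sum>j=0..<n1. V j) \<le> Emax\<^sup>2"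
  proof -
    have "0 \<le> \<kappa> * V n1" using \<kappa>_pos V_nonneg by simp
    then have "W n1 \<ge> 0" using W_ge[of n1] zero_le_power2[of "norm (err n1)"] by linarith
    moreover have "W n1 + \<kappa> / 8 * (\<Sum>j=0..<n1. V j) \<le> W 0 + CS * (\<delta>\<^sup>2 / \<alpha> n1)"
      using phase1[OF W0] by (intro energy_sum) auto
    ultimately show ?thesis using W0 by linarith
  qed
  moreover have "(\<Sum>j=0..<n1. \<omega>) < (\<Sum>j=0..<n1. V j)"
  proof (rule sum_strict_mono)
    fix j assume "j \<in> {0..<n1}"
    then show "\<omega> < V j" using * that[of j] by (metis atLeastLessThan_iff not_le)
  qed (use \<open>n1 > 0\<close> in auto)
  then have "\<kappa> / 8 * (real n1 * \<omega>) < \<kappa> / 8 * (\<Sum>j=0..<n1. V j)" using \<kappa>_pos by simp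
  moreover have "Emax\<^sup>2 \<le> \<kappa> / 8 * (real n1 * \<omega>)"
    using n1 \<kappa>_pos \<omega> by (simp add: field_simps)
  ultimately show False by linarith
qed

text \<open>The iteration may stop on either side of \<open>n1\<close>. Up to \<open>n1\<close>, the
  criterion gives |T e_N| \<le> 2 (\<tau> + 1) \<delta>, and since \<alpha>_N \<ge> \<alpha>_n1 is
  bounded below independently of \<delta>, \<open>err_sq\<close> is small for small \<delta>. Beyond
  \<open>n1\<close>, the small energy found at some n0 < n1 persists by
  \<open>phase2\<close>.\<close>

lemma conclusion:
  assumes W0: "W 0 + CS * (\<delta>\<^sup>2 / \<alpha> n1) \<le> Emax\<^sup>2" and \<delta>E: "\<delta>\<^sup>2 / \<alpha> n1 \<le> Emax\<^sup>2"
    and s: "s > 0" and sE: "(1 + CS / q ^ (m + 2)) * s\<^sup>2 \<le> Emax\<^sup>2" and st: "(1 + CS / q ^ (m + 2)) * s\<^sup>2 \<le> t\<^sup>2" and t: "t > 0"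
    and \<delta>s: "\<delta>\<^sup>2 / \<alpha> (n1 + Suc m) \<le> s\<^sup>2"
    and v: "Emax * norm (err 0 - adj T v) \<le> s\<^sup>2 / 8"
    and D: "D = 2 * b * Emax * (2 / sqrt \<kappa> + 1) * (sqrt q / (1 - sqrt q))"
    and \<omega>: "\<omega> > 0" "\<omega> \<le> s\<^sup>2 / 4" "sqrt \<omega> * (sqrt (\<alpha> 0) * norm v + D) \<le> s\<^sup>2 / 8"
    and n1: "8 * Emax\<^sup>2 / (\<kappa> * \<omega>) \<le> real n1" "n1 > 0"
    and \<delta>v: "2 * (\<tau> + 1) * \<delta> * (norm v + D / sqrt (\<alpha> n1)) \<le> t\<^sup>2 / 2"
  shows "\<exists>N. norm (res N) \<le> \<tau> * \<delta> \<and> (\<forall>n<N. \<tau> * \<delta> < norm (res n)) \<and> (\<forall>n\<le>N. xs n \<in> ball xdag \<rho>) \<and> norm (err N) \<le> t"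
proof -
  have e1: "e \<le> 1" using e by simp
  have D0: "D \<ge> 0" unfolding D using b1 Emax \<kappa>_pos q by (intro mult_nonneg_nonneg) auto
  note ph1 = phase1[OF W0]
  have err_sq: "(norm (err n))\<^sup>2 \<le> norm (T (err n)) * (norm v + D / sqrt (\<alpha> n)) + s\<^sup>2 / 8" if n: "n \<le> n1" for n
  proof -
    have "(norm (err n))\<^sup>2 \<le> norm (T (err n)) * (norm v + (\<Sum>j<n. 2 * b / \<alpha> j * norm (res j)))
        + norm (err n) * norm (err 0 - adj T v)"
      using ph1 n by (intro err_sq_le[OF _ e1]) auto
    also have "\<dots> \<le> norm (T (err n)) * (norm v + D / sqrt (\<alpha> n)) + Emax * norm (err 0 - adj T v)"
      using sum_res_le[OF W0 \<delta>E n] err_le_of_W[of n Emax] ph1[OF n] Emax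
      by (intro add_mono mult_left_mono mult_right_mono) (auto simp: D)
    finally show ?thesis using v by simp
  qed
  obtain n0 where n0: "n0 < n1" "V n0 \<le> \<omega>" using exists_V_le[OF W0 n1(1) \<omega>(1) n1(2)] .
  have "W n0 \<le> s\<^sup>2"
  proof -
    have a: "sqrt (\<alpha> n0) > 0" using \<alpha>_pos by simp
    \<comment> \<open>The factor sqrt \<alpha> in |T e| cancels the growth 1 / sqrt \<alpha> of the
      source element, so the bound does not depend on where below \<open>n1\<close> the index
      \<open>n0\<close> lies.\<close>
    have "norm (T (err n0)) * (norm v + D / sqrt (\<alpha> n0)) = sqrt (V n0) * (sqrt (\<alpha> n0) * norm v + D)"
      unfolding T_err_eq using a by (simp add: field_simps)
    also have "\<dots> \<le> sqrt \<omega> * (sqrt (\<alpha> 0) * norm v + D)"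
      using n0(2) \<alpha>_antimono[of 0 n0] D0 \<omega>(1) a by (intro mult_mono add_mono mult_right_mono) auto
    finally have "(norm (err n0))\<^sup>2 \<le> s\<^sup>2 / 8 + s\<^sup>2 / 8" using err_sq[of n0] n0(1) \<omega>(3) by simp
    then show ?thesis using W_le[of n0] n0(2) \<omega>(2) zero_le_power2[of s] by linarith
  qed
  moreover have "\<delta>\<^sup>2 / \<alpha> (n0 + Suc m) \<le> s\<^sup>2"
    using noise_mono[of "n0 + Suc m" "n1 + Suc m"] n0(1) \<delta>s by simp
  ultimately have ph2: "W n \<le> (1 + CS / q ^ (m + 2)) * s\<^sup>2" "close e n" "n0 < n \<Longrightarrow> \<delta>\<^sup>2 / \<alpha> n \<le> s\<^sup>2 / q ^ (m + 2)"
    if "n0 \<le> n" "\<And>j. j < n \<Longrightarrow> \<tau> * \<delta> < norm (res j)" for n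
    using phase2[OF _ s _ sE that(1)] that(2) by blast+
  \<comment> \<open>A run that never stops would keep \<delta>^2 / \<alpha>_n bounded for fixed
    \<delta> > 0, while \<alpha>_n tends to 0.\<close>
  have ex: "\<exists>n. \<not> \<tau> * \<delta> < norm (res n)"
  proof (rule ccontr)
    assume "\<not> ?thesis"
    then have all: "\<delta>\<^sup>2 / \<alpha> n \<le> s\<^sup>2 / q ^ (m + 2)" if "n0 < n" for n
      using ph2(3)[of n] that by auto
    define x where "x = \<delta>\<^sup>2 * q ^ (m + 2) / (s\<^sup>2 * \<alpha> (Suc n0))"
    have "x > 0" using \<delta>_pos q s \<alpha>_pos[of "Suc n0"] by (simp add: x_def)
    then obtain i where i: "q ^ i < x" using real_arch_pow_inv[of x q] q by auto
    have "\<delta>\<^sup>2 / (q ^ i * \<alpha> (Suc n0)) \<le> s\<^sup>2 / q ^ (m + 2)"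
      using all[of "Suc n0 + i"] unfolding \<alpha>_add by simp
    then have "\<delta>\<^sup>2 * q ^ (m + 2) \<le> s\<^sup>2 * (q ^ i * \<alpha> (Suc n0))"
      using q \<alpha>_pos[of "Suc n0"] by (simp add: divide_le_eq le_divide_eq mult_ac)
    then have "x \<le> q ^ i" using s \<alpha>_pos[of "Suc n0"] by (simp add: x_def divide_le_eq mult_ac)
    then show False using i by simp
  qed
  define N where "N = (LEAST n. \<not> \<tau> * \<delta> < norm (res n))"
  have N: "norm (res N) \<le> \<tau> * \<delta>" using LeastI_ex[OF ex] by (simp add: N_def)
  have less_N: "\<tau> * \<delta> < norm (res n)" if "n < N" for n
    using not_less_Least[of n] that unfolding N_def by blast
  have close_N: "close e n" if "n \<le> N" for n
  proof (cases "n \<le> n1")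
    case True
    then show ?thesis using ph1 by blast
  next
    case False
    then show ?thesis using ph2(2)[of n] n0(1) less_N that by simp
  qed
  have "norm (err N) \<le> t"
  proof (cases "N \<le> n1")
    case True
    have "norm (T (err N)) \<le> 2 * (norm (res N) + \<delta>)" using res_bounds(2)[OF close_N] e by simp
    also have "\<dots> \<le> 2 * (\<tau> + 1) * \<delta>" using N by (simp add: algebra_simps)
    finally have "norm (T (err N)) * (norm v + D / sqrt (\<alpha> N)) \<le> 2 * (\<tau> + 1) * \<delta> * (norm v + D / sqrt (\<alpha> n1))"
      using D0 \<alpha>_antimono[OF True] \<alpha>_pos \<tau> \<delta>_pos
      by (intro mult_mono add_mono divide_left_mono)
        (auto intro!: add_nonneg_nonneg divide_nonneg_nonneg simp: less_imp_le)
    then have "(norm (err N))\<^sup>2 \<le> t\<^sup>2 / 2 + s\<^sup>2 / 8" using err_sq[OF True] \<delta>v by linarith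
    moreover have "1 * s\<^sup>2 \<le> (1 + CS / q ^ (m + 2)) * s\<^sup>2"
      using CS_nonneg q by (intro mult_right_mono) auto
    ultimately have "(norm (err N))\<^sup>2 \<le> t\<^sup>2" using st zero_le_power2[of s] by linarith
    then show ?thesis using t by (auto elim: power2_le_imp_le)
  next
    case False
    then show ?thesis using ph2(1)[of N] n0(1) less_N st t by (intro err_le_of_W) auto
  qed
  then show ?thesis using N less_N close_N by (auto simp: close_def)
qed

end

section \<open>Convergence of the discrepancy principle\<close>

lemma discrepancy_unique:
  "discrepancy F x yd \<tau> \<delta> N \<Longrightarrow> discrepancy F x yd \<tau> \<delta> M \<Longrightarrow> M = N"
  unfolding discrepancy_def by (meson linorder_neqE_nat not_less)

text \<open>Condition A yields continuity, because the analytic extension is continuous and \<alpha>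
  + l does not vanish on [0,1]. Condition B is read at j = n, where the second product is empty and
  the difference of the sums is 1 / \<alpha>_n, with \<mu> = 0 and \<mu> = 1.\<close>

lemma filter_conditions_imp_filter_step:
  assumes A: "filter_condition_A g c1 b0 b1" and B: "filter_condition_B g \<alpha> b2" and pos: "\<alpha> n > 0"
  shows "filter_step (g (\<alpha> n)) (\<alpha> n) (max 1 b2)"
proof -
  have s: "inv_sum \<alpha> (int n) - inv_sum \<alpha> (int n - 1) = 1 / \<alpha> n"
  proof -
    have "nat (int n + 1) = Suc n" by simp
    then show ?thesis by (simp add: inv_sum_def)
  qed
  have "continuous_on {0..1} (g (\<alpha> n))"
  proof -
    obtain D \<Phi> where D: "complex_of_real ` {0..1} \<subseteq> D" "\<Phi> holomorphic_on D"
      and \<Phi>: "\<forall>l\<in>{0..1}. \<Phi> (complex_of_real l) = complex_of_real (g (\<alpha> n) l - 1 / (\<alpha> n + l))"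
      using A[unfolded filter_condition_A_def, rule_format, OF pos] by (elim exE conjE) (rule that)
    have "continuous_on {0..1} (\<lambda>l. \<Phi> (complex_of_real l))"
      by (rule continuous_on_compose2[OF holomorphic_on_imp_continuous_on[OF D(2)] _ D(1)])
        (intro continuous_intros)
    moreover have "\<alpha> n + l \<noteq> 0" if "l \<in> {0..1}" for l using pos that by auto
    ultimately have "continuous_on {0..1} (\<lambda>l. Re (\<Phi> (complex_of_real l)) + 1 / (\<alpha> n + l))"
      by (intro continuous_intros) auto
    moreover have "Re (\<Phi> (complex_of_real l)) + 1 / (\<alpha> n + l) = g (\<alpha> n) l" if "l \<in> {0..1}" for l
      unfolding bspec[OF \<Phi> that] by simp
    ultimately show ?thesis by (rule continuous_on_eq)
  qed
  moreover have "0 \<le> 1 - l * g (\<alpha> n) l \<and> 1 - l * g (\<alpha> n) l \<le> 1 \<and> l * (1 - l * g (\<alpha> n) l) \<le> \<alpha> n \<and>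
      0 \<le> g (\<alpha> n) l \<and> g (\<alpha> n) l \<le> max 1 b2 / \<alpha> n" if l: "l \<in> {0..1}" for l
  proof -
    have B': "0 \<le> rpow l \<mu> * (1 - l * g (\<alpha> n) l) \<and> rpow l \<mu> * (1 - l * g (\<alpha> n) l) \<le> (1 / \<alpha> n) powr (- \<mu>) \<and>
        0 \<le> rpow l \<mu> * g (\<alpha> n) l \<and> rpow l \<mu> * g (\<alpha> n) l \<le> b2 * (1 / \<alpha> n) * (1 / \<alpha> n) powr (- \<mu>)"
      if "\<mu> \<in> {0..1}" for \<mu>
      using B[unfolded filter_condition_B_def, THEN conjunct2, rule_format, OF that l order_refl[of n]]
      by (simp add: s residual_filter_def)
    have "b2 * (1 / \<alpha> n) \<le> max 1 b2 / \<alpha> n" using pos by (simp add: divide_right_mono)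
    then show ?thesis
      using B'[of 0] B'[of 1] pos l by (auto simp: rpow_def powr_minus)
  qed
  ultimately show ?thesis using pos by (simp add: filter_step_def)
qed

text \<open>The derivative within \<open>D\<close> becomes an unrestricted one since the ball is
  open and contained in \<open>D\<close>.\<close>

lemma nonlinearity_conditionD:
  assumes "frechet_derivative_on F F' D" "nonlinearity_condition F' D xdag \<rho> K0 \<alpha>0" "\<rho> > 0"
  shows "nonlinear_problem F F' xdag \<rho> K0"
proof
  note nl = assms(2)[unfolded nonlinearity_condition_def]
  fix x z assume x: "x \<in> ball xdag \<rho>"
  have "(F has_derivative F' x) (at x within D)"
    using assms(1) nl x unfolding frechet_derivative_on_def by blast
  then have "(F has_derivative F' x) (at x within ball xdag \<rho>)"
    using nl has_derivative_subset by blast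
  then show "(F has_derivative F' x) (at x)" using x by (simp add: at_within_open[OF x open_ball])
  show "norm (F' x) \<le> 1" using nl x by simp
  show "\<exists>R. F' x = R o\<^sub>L F' z \<and> norm (id_blinfun - R) \<le> K0 * norm (x - z)" if "z \<in> ball xdag \<rho>"
    using nl x that by blast
qed (use assms in \<open>auto simp: nonlinearity_condition_def\<close>)

lemma eventually_le_at_right_0:
  assumes "(f \<longlongrightarrow> 0) (at_right (0::real))" "c > (0::real)"
  shows "\<forall>\<^sub>F \<delta> in at_right 0. f \<delta> \<le> c"
  using order_tendstoD(2)[OF assms] by (rule eventually_mono) simp

text \<open>\<open>\<epsilon>\<close> precedes \<open>F\<close>, \<open>x0\<close> and the data, so
  the smallness is uniform over the problems. The factor \<theta> < 1 leaves room in the ball, as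
  the energy bounds confine the errors only to a slightly larger radius than |x0 - xdag|. Unique
  existence is part of the conclusion because \<open>stopping_index\<close> is a definite
  description.\<close>

theorem theorem2p2:
  fixes g :: "real \<Rightarrow> real \<Rightarrow> real" and \<alpha> :: "nat \<Rightarrow> real"
    and \<alpha>0 r c0 c1 b0 b1 b2 \<tau> \<theta> :: real
  assumes "\<alpha>0 > 0" and "0 < r" and "r < 1" and "\<And>n. \<alpha> n = \<alpha>0 * r ^ n"
    and "c0 > 1" and "\<And>n::nat. inv_sum \<alpha> (int n + 1) \<le> c0 * inv_sum \<alpha> (int n)"
    and "c1 > 0" and "\<And>n. 0 < \<alpha> n \<and> \<alpha> n \<le> c1"
    and "filter_condition_A g c1 b0 b1"
    and "filter_condition_B g \<alpha> b2"
    and "\<tau> > 1"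
    and "0 < \<theta>" and "\<theta> < 1"
  shows "\<exists>\<epsilon>>0. \<forall>(F :: 'a::{real_inner,complete_space} \<Rightarrow> 'b::{real_inner,complete_space})
            F' D xdag y \<rho> K0 x0 yd.
     frechet_derivative_on F F' D \<and> xdag \<in> D \<and> F xdag = y \<and> \<rho> > 0 \<and>
     nonlinearity_condition F' D xdag \<rho> K0 \<alpha>0 \<and>
     x0 \<in> D \<and> x0 - xdag \<in> orthogonal_comp (null_space (F' xdag)) \<and>
     norm (x0 - xdag) \<le> \<theta> * \<rho> \<and>
     K0 * norm (x0 - xdag) \<le> \<epsilon> \<and>
     (\<forall>\<delta>>0. norm (yd \<delta> - y) \<le> \<delta>)
     \<longrightarrow>
     (let x = (\<lambda>\<delta>. newton_iterate \<alpha> g F F' x0 (yd \<delta>));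
          N = (\<lambda>\<delta>. stopping_index F (x \<delta>) (yd \<delta>) \<tau> \<delta>)
      in (\<forall>\<^sub>F \<delta> in at_right 0. (\<exists>!n. discrepancy F (x \<delta>) (yd \<delta>) \<tau> \<delta> n) \<and>
                                (\<forall>n\<le>N \<delta>. x \<delta> n \<in> ball xdag \<rho>)) \<and>
         ((\<lambda>\<delta>. x \<delta> (N \<delta>)) \<longlongrightarrow> xdag) (at_right 0))"
proof -
  note q = assms(2,3) and \<alpha>_eq = assms(4) and \<tau> = assms(11) and \<theta> = assms(12,13)
  have \<alpha>_pos: "\<alpha> n > 0" for n using assms(8) by blast
  define b where "b = max 1 b2"
  have b: "b \<ge> 1" by (simp add: b_def)
  have filter: "filter_step (g (\<alpha> n)) (\<alpha> n) b" for n
    unfolding b_def by (rule filter_conditions_imp_filter_step[OF assms(9,10) \<alpha>_pos])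
  \<comment> \<open>The midpoint of 1 and 1 / \<theta>: errors may grow up to \<sigma> |x0 - xdag|
    and still stay in the ball.\<close>
  define \<sigma> where "\<sigma> = (1 + 1 / \<theta>) / 2"
  have \<sigma>: "\<sigma> > 1" "\<sigma> * \<theta> < 1" using \<theta> by (simp_all add: \<sigma>_def field_simps)
  then have \<sigma>2: "\<sigma>\<^sup>2 > 1" by (simp add: one_less_power)
  \<comment> \<open>With this \<eta> the initial energy uses at most half of the margin \<sigma>^2 -
    1; the other half is left for the noise.\<close>
  define \<eta> where "\<eta> = min 1 ((\<sigma>\<^sup>2 - 1) / 4)"
  have \<eta>: "0 < \<eta>" "\<eta> \<le> 1" and \<eta>\<sigma>: "2 * \<eta> \<le> (\<sigma>\<^sup>2 - 1) / 2"
    using \<sigma>2 by (auto simp: \<eta>_def min_def)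
  define \<kappa> where "\<kappa> = \<eta> * r * (1 - r) / 9"
  have \<kappa>: "\<kappa> > 0" using \<eta> q by (simp add: \<kappa>_def)
  define CS where "CS = (36 * b\<^sup>2 / \<kappa> + 4 * b + 2 + 28 / r) * (r / (1 - r))"
  have CS: "CS > 0" unfolding CS_def using b \<kappa> q by (intro mult_pos_pos add_pos_pos add_nonneg_pos) auto
  define M1 where "M1 = max 1 (sqrt CS)"
  have M1: "M1 \<ge> 1" "CS \<le> M1\<^sup>2"
  proof -
    have "(sqrt CS)\<^sup>2 \<le> M1\<^sup>2" using CS by (intro power_mono) (auto simp: M1_def)
    then show "CS \<le> M1\<^sup>2" using CS by simp
  qed (simp add: M1_def)
  define k where "k = ((\<tau> - 1) / (12 * M1))\<^sup>2"
  have k: "k > 0" "sqrt k * M1 \<le> (\<tau> - 1) / 12" using \<tau> M1 by (simp_all add: k_def real_sqrt_power)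
  \<comment> \<open>The value of 6 e 2^m + sqrt r^m / k at which the second smallness condition is
    an equality. Half is assigned to \<open>m\<close>, half to \<open>e\<close>.\<close>
  define G where "G = (\<tau> - 1) * sqrt \<kappa> / (24 * M1)"
  have G: "G > 0" using \<tau> \<kappa> M1 by (simp add: G_def)
  obtain m where "sqrt r ^ m < k * (G / 2)" using real_arch_pow_inv[of "k * (G / 2)" "sqrt r"] k G q by auto
  then have m: "sqrt r ^ m / k \<le> G / 2" using k by (simp add: divide_le_eq mult_ac)
  \<comment> \<open>The four bounds serve, in order, the energy step, 2 e \<le> 1, the growth of
    \<open>w\<close> in \<open>res_decomposition\<close>, and the share G / 2; the last contains
    2^m, so \<open>m\<close> had to be fixed before.\<close>
  define e where "e = min (min (\<kappa> / (4 * (10 * b + 30 + 42 / r))) (1 / 2)) (min ((1 / sqrt r - 1) / 2) (G / (12 * 2 ^ m)))"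
  have L: "10 * b + 30 + 42 / r > 0" using b q by (intro add_pos_pos) auto
  have e: "e > 0" "e * (10 * b + 30 + 42 / r) \<le> \<kappa> / 4" "2 * e \<le> 1" "1 + 2 * e \<le> 1 / sqrt r" "6 * e * 2 ^ m \<le> G / 2"
  proof -
    have "1 / sqrt r > 1" using q by simp
    then show "e > 0" using L \<kappa> G by (simp add: e_def)
    have "e \<le> \<kappa> / (4 * (10 * b + 30 + 42 / r))" by (simp add: e_def)
    then have "e * (10 * b + 30 + 42 / r) \<le> \<kappa> / (4 * (10 * b + 30 + 42 / r)) * (10 * b + 30 + 42 / r)"
      using L by (intro mult_right_mono) auto
    also have "\<kappa> / (4 * z) * z = \<kappa> / 4" if "z > 0" for z using that by simp
    from this[OF L] have "\<kappa> / (4 * (10 * b + 30 + 42 / r)) * (10 * b + 30 + 42 / r) = \<kappa> / 4" .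
    finally show "e * (10 * b + 30 + 42 / r) \<le> \<kappa> / 4" .
    have "e \<le> 1 / 2" "e \<le> (1 / sqrt r - 1) / 2" by (simp_all only: e_def min.coboundedI1 min.coboundedI2 order_refl)
    then show "2 * e \<le> 1" "1 + 2 * e \<le> 1 / sqrt r" by argo+
    have "e \<le> G / (12 * 2 ^ m)" by (simp add: e_def)
    then show "6 * e * 2 ^ m \<le> G / 2" by (simp add: field_simps)
  qed
  have small2: "2 * (6 * e * 2 ^ m + sqrt r ^ m / k) * M1 / sqrt \<kappa> \<le> (\<tau> - 1) / 12"
  proof -
    have "6 * e * 2 ^ m + sqrt r ^ m / k \<le> G" using add_mono[OF e(5) m] by simp
    then have "2 * (6 * e * 2 ^ m + sqrt r ^ m / k) * M1 / sqrt \<kappa> \<le> 2 * G * M1 / sqrt \<kappa>"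
      using M1 \<kappa> by (intro divide_right_mono mult_right_mono mult_left_mono) auto
    also have "\<dots> = (\<tau> - 1) / 12" using M1 \<kappa> by (simp add: G_def)
    finally show ?thesis .
  qed
  show ?thesis
  \<comment> \<open>Division by \<sigma> gives K0 Emax \<le> e on the enlarged radius Emax =
    \<sigma> |x0 - xdag|.\<close>
  proof (intro exI[of _ "e / \<sigma>"] conjI allI impI)
    show "e / \<sigma> > 0" using e \<sigma> by simp
    fix F :: "'a \<Rightarrow> 'b" and F' D xdag y \<rho> K0 x0 yd
    assume "frechet_derivative_on F F' D \<and> xdag \<in> D \<and> F xdag = y \<and> \<rho> > 0 \<and>
       nonlinearity_condition F' D xdag \<rho> K0 \<alpha>0 \<and>
       x0 \<in> D \<and> x0 - xdag \<in> orthogonal_comp (null_space (F' xdag)) \<and>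
       norm (x0 - xdag) \<le> \<theta> * \<rho> \<and> K0 * norm (x0 - xdag) \<le> e / \<sigma> \<and> (\<forall>\<delta>>0. norm (yd \<delta> - y) \<le> \<delta>)"
    then have P: "frechet_derivative_on F F' D" "F xdag = y" "\<rho> > 0" "nonlinearity_condition F' D xdag \<rho> K0 \<alpha>0"
      and orth: "x0 - xdag \<in> orthogonal_comp (null_space (F' xdag))"
      and x0: "norm (x0 - xdag) \<le> \<theta> * \<rho>" "K0 * norm (x0 - xdag) \<le> e / \<sigma>"
      and yd: "\<And>\<delta>. \<delta> > 0 \<Longrightarrow> norm (yd \<delta> - y) \<le> \<delta>" by auto
    interpret nonlinear_problem F F' xdag \<rho> K0 by (rule nonlinearity_conditionD[OF P(1,4,3)])
    define x where "x = (\<lambda>\<delta>. newton_iterate \<alpha> g F F' x0 (yd \<delta>))"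
    define N where "N = (\<lambda>\<delta>. stopping_index F (x \<delta>) (yd \<delta>) \<tau> \<delta>)"
    define E where "E = norm (x0 - xdag)"
    have T\<alpha>: "norm (F' xdag) \<le> sqrt (\<alpha> 0)"
      using P(3,4) by (auto simp: nonlinearity_condition_def \<alpha>_eq)
    have key: "\<forall>\<^sub>F \<delta> in at_right 0. \<exists>n. discrepancy F (x \<delta>) (yd \<delta>) \<tau> \<delta> n \<and>
        (\<forall>i\<le>n. x \<delta> i \<in> ball xdag \<rho>) \<and> norm (x \<delta> n - xdag) \<le> t" if t: "t > 0" for t
    \<comment> \<open>Separated because \<open>Emax\<close> has to be positive; here
      \<open>x0\<close> is the solution and the iteration stops at index 0.\<close>
    proof (cases "E = 0")
      case True
      have "discrepancy F (x \<delta>) (yd \<delta>) \<tau> \<delta> 0" if "\<delta> > 0" for \<delta>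
      proof -
        have "norm (F x0 - yd \<delta>) \<le> \<delta>" using yd[OF that] True P(2) by (simp add: E_def norm_minus_commute)
        also have "\<dots> \<le> \<tau> * \<delta>" using \<tau> that by simp
        finally show ?thesis by (simp add: discrepancy_def x_def)
      qed
      then show ?thesis using True t P(3)
        by (intro eventually_at_right_less[THEN eventually_mono] exI[of _ 0]) (auto simp: x_def E_def)
    next
      case False
      then have E: "E > 0" by (simp add: E_def)
      define Emax where "Emax = \<sigma> * E"
      have Emax: "Emax > 0" using E \<sigma> by (simp add: Emax_def)
      have Emax\<rho>: "Emax < \<rho>"
      proof -
        have "Emax \<le> \<sigma> * (\<theta> * \<rho>)" unfolding Emax_def E_def using x0 \<sigma> by (intro mult_left_mono) auto
        also have "\<dots> = (\<sigma> * \<theta>) * \<rho>" by simp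
        also have "\<dots> < 1 * \<rho>" using \<sigma> P(3) by (intro mult_strict_right_mono) auto
        finally show ?thesis by simp
      qed
      have K0E: "K0 * Emax \<le> e" using x0(2) \<sigma> by (simp add: Emax_def E_def field_simps)
      define c where "c = 1 + CS / r ^ (m + 2)"
      have c: "c \<ge> 1" using CS q by (simp add: c_def)
      \<comment> \<open>\<open>c\<close> is the energy growth allowed by \<open>phase2\<close>, so c
        s^2 respects both the radius \<open>Emax\<close> and the target accuracy
        \<open>t\<close>.\<close>
      define s where "s = min Emax t / sqrt c"
      have s: "s > 0" using Emax t c by (simp add: s_def)
      have cs: "c * s\<^sup>2 = (min Emax t)\<^sup>2" using c by (simp add: s_def power_divide)
      have sE: "c * s\<^sup>2 \<le> Emax\<^sup>2" "c * s\<^sup>2 \<le> t\<^sup>2" unfolding cs using Emax t by (auto intro!: power_mono)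
      obtain v where v: "norm (x0 - xdag - adj (F' xdag) v) < s\<^sup>2 / (8 * Emax)"
        using source_approximation[OF orth, of "s\<^sup>2 / (8 * Emax)"] s Emax by auto
      define C where "C = 2 * b * Emax * (2 / sqrt \<kappa> + 1) * (sqrt r / (1 - sqrt r))"
      have C: "C > 0" unfolding C_def using b Emax \<kappa> q by (intro mult_pos_pos add_pos_pos) auto
      define Q where "Q = sqrt (\<alpha> 0) * norm v + C"
      have Q: "Q > 0" using C \<alpha>_pos[of 0] by (simp add: Q_def add_nonneg_pos)
      \<comment> \<open>With the source error these bounds give W \<le> 2 (s^2/8 + s^2/8) + s^2/4 <
        s^2 at the index where V \<le> \<omega>.\<close>
      define \<omega> where "\<omega> = min (s\<^sup>2 / 4) ((s\<^sup>2 / (8 * Q))\<^sup>2)"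
      have \<omega>: "\<omega> > 0" "\<omega> \<le> s\<^sup>2 / 4" "sqrt \<omega> * Q \<le> s\<^sup>2 / 8"
      proof -
        show "\<omega> > 0" "\<omega> \<le> s\<^sup>2 / 4" using s Q by (auto simp: \<omega>_def)
        have "sqrt \<omega> \<le> sqrt ((s\<^sup>2 / (8 * Q))\<^sup>2)" by (intro real_sqrt_le_mono) (simp add: \<omega>_def)
        also have "\<dots> = s\<^sup>2 / (8 * Q)" using Q by simp
        finally show "sqrt \<omega> * Q \<le> s\<^sup>2 / 8" using Q by (simp add: field_simps)
      qed
      obtain n' where n': "8 * Emax\<^sup>2 / (\<kappa> * \<omega>) \<le> real n'" using real_arch_simple by blast
      define n1 where "n1 = Suc n'"
      have n1: "8 * Emax\<^sup>2 / (\<kappa> * \<omega>) \<le> real n1" "n1 > 0" using n' by (auto simp: n1_def)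
      have Z: "0 < norm v + C / sqrt (\<alpha> n1)" using C \<alpha>_pos by (simp add: add_nonneg_pos)
      have lim: "((\<lambda>\<delta>. a * \<delta>\<^sup>2) \<longlongrightarrow> 0) (at_right 0)" "((\<lambda>\<delta>. a * \<delta>) \<longlongrightarrow> 0) (at_right 0)" for a :: real
        by (auto intro!: tendsto_eq_intros)
      \<comment> \<open>Everything except \<delta> is fixed by now, \<open>n1\<close> included, so
        each bound compares a multiple of \<delta> or \<delta>^2 with a positive constant.\<close>
      have "\<forall>\<^sub>F \<delta> in at_right 0. \<delta> > 0 \<and> CS / \<alpha> n1 * \<delta>\<^sup>2 \<le> (\<sigma>\<^sup>2 - 1) / 2 * E\<^sup>2 \<and> 1 / \<alpha> n1 * \<delta>\<^sup>2 \<le> Emax\<^sup>2 \<and>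
          1 / \<alpha> (n1 + Suc m) * \<delta>\<^sup>2 \<le> s\<^sup>2 \<and> (2 * (\<tau> + 1) * (norm v + C / sqrt (\<alpha> n1))) * \<delta> \<le> t\<^sup>2 / 2"
        using \<sigma>2 E Emax s t
        by (intro eventually_conj eventually_at_right_less eventually_le_at_right_0 lim) auto
      then show ?thesis
      proof (rule eventually_mono, elim conjE)
        fix \<delta> :: real
        assume \<delta>: "\<delta> > 0" and d1: "CS / \<alpha> n1 * \<delta>\<^sup>2 \<le> (\<sigma>\<^sup>2 - 1) / 2 * E\<^sup>2" and d2: "1 / \<alpha> n1 * \<delta>\<^sup>2 \<le> Emax\<^sup>2"
          and d3: "1 / \<alpha> (n1 + Suc m) * \<delta>\<^sup>2 \<le> s\<^sup>2"
          and d4: "(2 * (\<tau> + 1) * (norm v + C / sqrt (\<alpha> n1))) * \<delta> \<le> t\<^sup>2 / 2"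
        interpret run: newton_run F F' xdag \<rho> K0 "\<lambda>n. g (\<alpha> n)" \<alpha> r b \<delta> "yd \<delta>" "x \<delta>"
        proof
          show "\<alpha> (Suc n) = r * \<alpha> n" for n by (simp add: \<alpha>_eq)
          show "x \<delta> (Suc n) = x \<delta> n - op_fun (g (\<alpha> n)) (gram (F' (x \<delta> n))) (adj (F' (x \<delta> n)) (F (x \<delta> n) - yd \<delta>))" for n
            by (simp add: x_def Let_def)
          show "norm (yd \<delta> - F xdag) \<le> \<delta>" using yd[OF \<delta>] P(2) by simp
        qed (use q filter in auto)
        interpret newton_analysis F F' xdag \<rho> K0 "\<lambda>n. g (\<alpha> n)" \<alpha> r b \<delta> "yd \<delta>" "x \<delta>" \<eta> \<kappa> e Emax \<tau> k CS M1 m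
        proof
          show "run.close e n" if "norm (run.err n) \<le> Emax" for n
          proof -
            have "K0 * norm (run.err n) \<le> e" using mult_left_mono[OF that K0] K0E by linarith
            then show ?thesis using that Emax\<rho> by (auto simp: run.close_def run.err_def dist_norm norm_minus_commute)
          qed
        qed (use \<eta> \<kappa>_def e CS_def k \<tau> M1 small2 Emax \<delta> in auto)
        have "x \<delta> 0 = x0" by (simp add: x_def)
        then have err0: "run.err 0 = x0 - xdag" by (simp add: run.err_def)
        have "W 0 \<le> (1 + 2 * \<eta>) * E\<^sup>2" using W_0_le[OF T\<alpha>] by (simp add: err0 E_def)
        also have "\<dots> \<le> (1 + (\<sigma>\<^sup>2 - 1) / 2) * E\<^sup>2" using \<eta>\<sigma> by (intro mult_right_mono) auto
        finally have "W 0 \<le> (1 + (\<sigma>\<^sup>2 - 1) / 2) * E\<^sup>2" .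
        from add_mono[OF this d1]
        have "W 0 + CS * (\<delta>\<^sup>2 / \<alpha> n1) \<le> (1 + (\<sigma>\<^sup>2 - 1) / 2) * E\<^sup>2 + (\<sigma>\<^sup>2 - 1) / 2 * E\<^sup>2"
          by simp
        also have "\<dots> = Emax\<^sup>2" by (simp add: Emax_def power_mult_distrib algebra_simps)
        finally have W0: "W 0 + CS * (\<delta>\<^sup>2 / \<alpha> n1) \<le> Emax\<^sup>2" .
        have "\<exists>N. norm (run.res N) \<le> \<tau> * \<delta> \<and> (\<forall>n<N. \<tau> * \<delta> < norm (run.res n)) \<and>
            (\<forall>n\<le>N. x \<delta> n \<in> ball xdag \<rho>) \<and> norm (run.err N) \<le> t"
        proof (rule conclusion[OF W0 _ s _ _ t _ _ C_def \<omega>(1,2) _ n1])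
          show "\<delta>\<^sup>2 / \<alpha> n1 \<le> Emax\<^sup>2" "\<delta>\<^sup>2 / \<alpha> (n1 + Suc m) \<le> s\<^sup>2" using d2 d3 by simp_all
          show "(1 + CS / r ^ (m + 2)) * s\<^sup>2 \<le> Emax\<^sup>2" "(1 + CS / r ^ (m + 2)) * s\<^sup>2 \<le> t\<^sup>2"
            using sE by (simp_all add: c_def)
          have "Emax * norm (x0 - xdag - adj (F' xdag) v) \<le> Emax * (s\<^sup>2 / (8 * Emax))"
            using v Emax by (intro mult_left_mono) auto
          then show "Emax * norm (run.err 0 - adj (F' xdag) v) \<le> s\<^sup>2 / 8" using Emax by (simp add: err0)
          show "sqrt \<omega> * (sqrt (\<alpha> 0) * norm v + C) \<le> s\<^sup>2 / 8" using \<omega>(3) by (simp add: Q_def)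
          show "2 * (\<tau> + 1) * \<delta> * (norm v + C / sqrt (\<alpha> n1)) \<le> t\<^sup>2 / 2" using d4 by (simp add: mult_ac)
        qed
        then show "\<exists>n. discrepancy F (x \<delta>) (yd \<delta>) \<tau> \<delta> n \<and> (\<forall>i\<le>n. x \<delta> i \<in> ball xdag \<rho>) \<and> norm (x \<delta> n - xdag) \<le> t"
          by (simp add: discrepancy_def run.res_def run.err_def)
      qed
    qed
    have key': "\<forall>\<^sub>F \<delta> in at_right 0. (\<exists>!n. discrepancy F (x \<delta>) (yd \<delta>) \<tau> \<delta> n) \<and>
        (\<forall>i\<le>N \<delta>. x \<delta> i \<in> ball xdag \<rho>) \<and> norm (x \<delta> (N \<delta>) - xdag) \<le> t" if "t > 0" for t
      using key[OF that]
    proof (rule eventually_mono)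
      fix \<delta> assume "\<exists>n. discrepancy F (x \<delta>) (yd \<delta>) \<tau> \<delta> n \<and> (\<forall>i\<le>n. x \<delta> i \<in> ball xdag \<rho>) \<and> norm (x \<delta> n - xdag) \<le> t"
      then obtain n where n: "discrepancy F (x \<delta>) (yd \<delta>) \<tau> \<delta> n" "\<forall>i\<le>n. x \<delta> i \<in> ball xdag \<rho>" "norm (x \<delta> n - xdag) \<le> t"
        by blast
      then have "N \<delta> = n" unfolding N_def stopping_index_def using discrepancy_unique by blast
      then show "(\<exists>!n. discrepancy F (x \<delta>) (yd \<delta>) \<tau> \<delta> n) \<and> (\<forall>i\<le>N \<delta>. x \<delta> i \<in> ball xdag \<rho>) \<and> norm (x \<delta> (N \<delta>) - xdag) \<le> t"
        using n discrepancy_unique by blast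
    qed
    have "((\<lambda>\<delta>. x \<delta> (N \<delta>)) \<longlongrightarrow> xdag) (at_right 0)"
    proof (rule tendstoI)
      fix t :: real assume "t > 0"
      then show "\<forall>\<^sub>F \<delta> in at_right 0. dist (x \<delta> (N \<delta>)) xdag < t"
        using key'[of "t / 2"] by (auto elim!: eventually_mono simp: dist_norm)
    qed
    moreover have "\<forall>\<^sub>F \<delta> in at_right 0. (\<exists>!n. discrepancy F (x \<delta>) (yd \<delta>) \<tau> \<delta> n) \<and> (\<forall>n\<le>N \<delta>. x \<delta> n \<in> ball xdag \<rho>)"
      using key'[OF zero_less_one] by (rule eventually_mono) blast
    ultimately show "let x = (\<lambda>\<delta>. newton_iterate \<alpha> g F F' x0 (yd \<delta>));
          N = (\<lambda>\<delta>. stopping_index F (x \<delta>) (yd \<delta>) \<tau> \<delta>)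
      in (\<forall>\<^sub>F \<delta> in at_right 0. (\<exists>!n. discrepancy F (x \<delta>) (yd \<delta>) \<tau> \<delta> n) \<and>
                                (\<forall>n\<le>N \<delta>. x \<delta> n \<in> ball xdag \<rho>)) \<and>
         ((\<lambda>\<delta>. x \<delta> (N \<delta>)) \<longlongrightarrow> xdag) (at_right 0)"
      unfolding Let_def x_def N_def by blast
  qed
qed

end
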